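(* The Burnside category of groupoids is an additive category, in which the disjoint union $G\amalg H$ is both a product and a coproduct of groupoids $G$ and $H$. Here the Burnside category has groupoids as objects; the abelian group of morphisms from $H$ to $G$ is the group completion of the commutative monoid, under disjoint union, of isomorphism classes of admissible $(H,G)$-bi-sets; and composition is the bilinear extension of $([X],[Y])\mapsto[X\otimes_HY]$ for $X$ an admissible $(H,G)$-bi-set and $Y$ an admissible $(K,H)$-bi-set.
   Context: All groupoids are small; $G_0$ is the object set of $G$. A (left) $G$-set is a functor $X:G\to\mathbf{Set}$, with values $X_\gamma$ and action $x\mapsto gx$; a right $G$-set is a functor $Y:G^{\mathrm{op}}\to\mathbf{Set}$, with values $Y^\gamma$ and action $y\mapsto yg$. A $G$-set $X$ is free if for all $\gamma,\gamma'\in G_0$ and $x\in X_{\gamma'}$ the map $G(\gamma',\gamma)\to X_\gamma$, $g\mapsto gx$, is injective; it is finitely generated if $\mathrm{colim}_GX$ is finite. An $(H,G)$-bi-set is a functor $X:H^{\mathrm{op}}\times G\to\mathbf{Set}$, with values $X^\eta_\gamma$; it is admissible if for every $\eta\in H_0$ the $G$-set $X^\eta$ is free and finitely generated. For a right $H$-set $X$ and left $H$-set $Y$, $X\otimes_HY=\coprod_{\eta\in H_0}X^\eta\times Y_\eta/\sim$, with $(xh,y)\sim(x,hy)$; for an $(H,G)$-bi-set $X$ and a $(K,H)$-bi-set $Y$, $(X\otimes_HY)^\kappa_\gamma=X_\gamma\otimes_HY^\kappa$. The identity of $G$ in the Burnside category is the class of the bi-set $(\gamma',\gamma)\mapsto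 G(\gamma',\gamma)$. *)

theory Defs
  imports "HOL-Algebra.Group"
begin

section \<open>Categories and groupoids\<close>

text \<open>Composition takes the three objects as arguments, so hom-sets need not be disjoint:
  \<open>Cmp C a b c g f\<close> is the composite of \<open>f \<in> Hom C a b\<close> and \<open>g \<in> Hom C b c\<close>.\<close>

record ('o, 'a) cat =
  Ob :: "'o set"
  Hom :: "'o \<Rightarrow> 'o \<Rightarrow> 'a set"
  Cmp :: "'o \<Rightarrow> 'o \<Rightarrow> 'o \<Rightarrow> 'a \<Rightarrow> 'a \<Rightarrow> 'a"
  Idn :: "'o \<Rightarrow> 'a"

definition category :: "('o, 'a, 'm) cat_scheme \<Rightarrow> bool" where
  "category C \<longleftrightarrow>
    (\<forall>a\<in>Ob C. Idn C a \<in> Hom C a a) \<and>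
    (\<forall>a\<in>Ob C. \<forall>b\<in>Ob C. \<forall>c\<in>Ob C. \<forall>f\<in>Hom C a b. \<forall>g\<in>Hom C b c.
       Cmp C a b c g f \<in> Hom C a c) \<and>
    (\<forall>a\<in>Ob C. \<forall>b\<in>Ob C. \<forall>f\<in>Hom C a b.
       Cmp C a a b f (Idn C a) = f \<and> Cmp C a b b (Idn C b) f = f) \<and>
    (\<forall>a\<in>Ob C. \<forall>b\<in>Ob C. \<forall>c\<in>Ob C. \<forall>d\<in>Ob C.
     \<forall>f\<in>Hom C a b. \<forall>g\<in>Hom C b c. \<forall>h\<in>Hom C c d.
       Cmp C a c d h (Cmp C a b c g f) = Cmp C a b d (Cmp C b c d h g) f)"

definition groupoid :: "('o, 'a, 'm) cat_scheme \<Rightarrow> bool" where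
  "groupoid G \<longleftrightarrow> category G \<and>
    (\<forall>a\<in>Ob G. \<forall>b\<in>Ob G. \<forall>f\<in>Hom G a b. \<exists>g\<in>Hom G b a.
       Cmp G a b a g f = Idn G a \<and> Cmp G b a b f g = Idn G b)"

definition op_cat :: "('o, 'a) cat \<Rightarrow> ('o, 'a) cat" where
  "op_cat C = \<lparr> Ob = Ob C, Hom = (\<lambda>a b. Hom C b a),
     Cmp = (\<lambda>a b c g f. Cmp C c b a f g), Idn = Idn C \<rparr>"

definition prod_cat ::
    "('o, 'a) cat \<Rightarrow> ('p, 'b) cat \<Rightarrow> ('o \<times> 'p, 'a \<times> 'b) cat" where
  "prod_cat C D = \<lparr> Ob = Ob C \<times> Ob D,
     Hom = (\<lambda>(a, a') (b, b'). Hom C a b \<times> Hom D a' b'),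
     Cmp = (\<lambda>(a, a') (b, b') (c, c') (g, g') (f, f'). (Cmp C a b c g f, Cmp D a' b' c' g' f')),
     Idn = (\<lambda>(a, a'). (Idn C a, Idn D a')) \<rparr>"

definition sum_cat ::
    "('o, 'a) cat \<Rightarrow> ('p, 'b) cat \<Rightarrow> ('o + 'p, 'a + 'b) cat" where
  "sum_cat C D = \<lparr> Ob = Ob C <+> Ob D,
     Hom = (\<lambda>a b. case (a, b) of
         (Inl a', Inl b') \<Rightarrow> Inl ` Hom C a' b'
       | (Inr a', Inr b') \<Rightarrow> Inr ` Hom D a' b'
       | _ \<Rightarrow> {}),
     Cmp = (\<lambda>a b c g f. case a of
         Inl a' \<Rightarrow> Inl (Cmp C a' (projl b) (projl c) (projl g) (projl f))
       | Inr a' \<Rightarrow> Inr (Cmp D a' (projr b) (projr c) (projr g) (projr f))),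
     Idn = (\<lambda>a. case a of Inl a' \<Rightarrow> Inl (Idn C a') | Inr a' \<Rightarrow> Inr (Idn D a')) \<rparr>"

text \<open>The isomorphic copy of a category along injections \<open>i\<close> on objects and \<open>j\<close> on arrows.\<close>

definition relabel :: "('o \<Rightarrow> 'p) \<Rightarrow> ('a \<Rightarrow> 'b) \<Rightarrow> ('o, 'a) cat \<Rightarrow> ('p, 'b) cat" where
  "relabel i j C = (let i' = inv_into UNIV i; j' = inv_into UNIV j in
     \<lparr> Ob = i ` Ob C, Hom = (\<lambda>a b. j ` Hom C (i' a) (i' b)),
       Cmp = (\<lambda>a b c g f. j (Cmp C (i' a) (i' b) (i' c) (j' g) (j' f))),
       Idn = (\<lambda>a. j (Idn C (i' a))) \<rparr>)"

text \<open>Small groupoids are those whose objects and arrows are elements of a fixed type \<open>'u\<close>,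
  an arbitrary infinite type playing the role of the universe.  The disjoint union of two such
  groupoids lives over \<open>'u + 'u\<close>; it is brought back to \<open>'u\<close> along an injection
  \<open>c :: 'u + 'u \<Rightarrow> 'u\<close>, which exists when \<open>'u\<close> is infinite.\<close>

type_synonym 'u grpd = "('u, 'u) cat"

definition disjoint_union :: "('u + 'u \<Rightarrow> 'u) \<Rightarrow> 'u grpd \<Rightarrow> 'u grpd \<Rightarrow> 'u grpd" where
  "disjoint_union c G H = relabel c c (sum_cat G H)"

lemma ex_inj_sum:
  includes cardinal_syntax
  assumes "infinite (UNIV :: 'u set)"
  shows "\<exists>c :: 'u + 'u \<Rightarrow> 'u. inj c"
proof -
  have "|(UNIV :: 'u set) <+> (UNIV :: 'u set)| =o |UNIV :: 'u set|"
    by (rule card_of_Plus_infinite1[OF assms card_of_mono1[OF subset_refl]])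
  then obtain c :: "'u + 'u \<Rightarrow> 'u" where "bij_betw c (UNIV <+> UNIV) UNIV"
    using card_of_ordIso by blast
  then show ?thesis
    by (auto simp: bij_betw_def)
qed


section \<open>Set-valued functors and bi-sets\<close>

record ('o, 'a, 'x) set_fun =
  FOb :: "'o \<Rightarrow> 'x set"
  FAr :: "'o \<Rightarrow> 'o \<Rightarrow> 'a \<Rightarrow> 'x \<Rightarrow> 'x"

definition set_functor :: "('o, 'a) cat \<Rightarrow> ('o, 'a, 'x) set_fun \<Rightarrow> bool" where
  "set_functor C X \<longleftrightarrow>
    (\<forall>a\<in>Ob C. \<forall>b\<in>Ob C. \<forall>f\<in>Hom C a b. FAr X a b f \<in> FOb X a \<rightarrow> FOb X b) \<and>
    (\<forall>a\<in>Ob C. \<forall>x\<in>FOb X a. FAr X a a (Idn C a) x = x) \<and>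
    (\<forall>a\<in>Ob C. \<forall>b\<in>Ob C. \<forall>c\<in>Ob C. \<forall>f\<in>Hom C a b. \<forall>g\<in>Hom C b c. \<forall>x\<in>FOb X a.
       FAr X a c (Cmp C a b c g f) x = FAr X b c g (FAr X a b f x))"

definition nat_iso ::
    "('o, 'a) cat \<Rightarrow> ('o, 'a, 'x) set_fun \<Rightarrow> ('o, 'a, 'y) set_fun \<Rightarrow> bool" where
  "nat_iso C X Y \<longleftrightarrow> (\<exists>t.
    (\<forall>a\<in>Ob C. bij_betw (t a) (FOb X a) (FOb Y a)) \<and>
    (\<forall>a\<in>Ob C. \<forall>b\<in>Ob C. \<forall>f\<in>Hom C a b. \<forall>x\<in>FOb X a.
       t b (FAr X a b f x) = FAr Y a b f (t a x)))"

definition colim :: "('o, 'a) cat \<Rightarrow> ('o, 'a, 'x) set_fun \<Rightarrow> ('o \<times> 'x) set set" where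
  "colim C X = (let r = {((a, x), (b, FAr X a b f x)) | a b f x.
       a \<in> Ob C \<and> b \<in> Ob C \<and> f \<in> Hom C a b \<and> x \<in> FOb X a}
     in (SIGMA a : Ob C. FOb X a) // (r \<union> r\<inverse>)\<^sup>*)"

definition free_set :: "('o, 'a) cat \<Rightarrow> ('o, 'a, 'x) set_fun \<Rightarrow> bool" where
  "free_set G X \<longleftrightarrow> (\<forall>a\<in>Ob G. \<forall>b\<in>Ob G. \<forall>x\<in>FOb X a.
     inj_on (\<lambda>g. FAr X a b g x) (Hom G a b))"

definition fin_gen :: "('o, 'a) cat \<Rightarrow> ('o, 'a, 'x) set_fun \<Rightarrow> bool" where
  "fin_gen G X \<longleftrightarrow> finite (colim G X)"

type_synonym ('h, 'hm, 'g, 'gm, 'x) biset = "('h \<times> 'g, 'hm \<times> 'gm, 'x) set_fun"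

abbreviation bicat ::
    "('h, 'hm) cat \<Rightarrow> ('g, 'gm) cat \<Rightarrow> ('h \<times> 'g, 'hm \<times> 'gm) cat" where
  "bicat H G \<equiv> prod_cat (op_cat H) G"

definition left_part ::
    "('h, 'hm) cat \<Rightarrow> ('h, 'hm, 'g, 'gm, 'x) biset \<Rightarrow> 'h \<Rightarrow> ('g, 'gm, 'x) set_fun" where
  "left_part H X \<eta> = \<lparr> FOb = (\<lambda>\<gamma>. FOb X (\<eta>, \<gamma>)),
     FAr = (\<lambda>\<gamma> \<gamma>' g. FAr X (\<eta>, \<gamma>) (\<eta>, \<gamma>') (Idn H \<eta>, g)) \<rparr>"

definition right_part ::
    "('g, 'gm) cat \<Rightarrow> ('h, 'hm, 'g, 'gm, 'x) biset \<Rightarrow> 'g \<Rightarrow> ('h, 'hm, 'x) set_fun" where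
  "right_part G X \<gamma> = \<lparr> FOb = (\<lambda>\<eta>. FOb X (\<eta>, \<gamma>)),
     FAr = (\<lambda>\<eta> \<eta>' h. FAr X (\<eta>, \<gamma>) (\<eta>', \<gamma>) (h, Idn G \<gamma>)) \<rparr>"

definition admissible ::
    "('h, 'hm) cat \<Rightarrow> ('g, 'gm) cat \<Rightarrow> ('h, 'hm, 'g, 'gm, 'x) biset \<Rightarrow> bool" where
  "admissible H G X \<longleftrightarrow> set_functor (bicat H G) X \<and>
     (\<forall>\<eta>\<in>Ob H. free_set G (left_part H X \<eta>) \<and> fin_gen G (left_part H X \<eta>))"

text \<open>The bi-set \<open>(a, b) \<mapsto> P (F a, E b)\<close> for functors \<open>F\<close>, \<open>E\<close> into \<open>P\<close>, each given by its maps
  on objects and on arrows.\<close>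

definition hom_biset ::
    "('p, 'pm) cat \<Rightarrow> ('h \<Rightarrow> 'p) \<Rightarrow> ('hm \<Rightarrow> 'pm) \<Rightarrow> ('g \<Rightarrow> 'p) \<Rightarrow> ('gm \<Rightarrow> 'pm) \<Rightarrow>
     ('h, 'hm, 'g, 'gm, 'pm) biset" where
  "hom_biset P F0 F1 E0 E1 = \<lparr> FOb = (\<lambda>(a, b). Hom P (F0 a) (E0 b)),
     FAr = (\<lambda>(a, b) (a', b') (h, g) x.
       Cmp P (F0 a') (E0 b) (E0 b') (E1 g) (Cmp P (F0 a') (F0 a) (E0 b) x (F1 h))) \<rparr>"

abbreviation id_biset :: "('g, 'gm) cat \<Rightarrow> ('g, 'gm, 'g, 'gm, 'gm) biset" where
  "id_biset G \<equiv> hom_biset G id id id id"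

definition empty_biset :: "('h, 'hm, 'g, 'gm, 'x) biset" where
  "empty_biset = \<lparr> FOb = (\<lambda>_. {}), FAr = (\<lambda>_ _ _ x. x) \<rparr>"

definition sum_biset ::
    "('h, 'hm, 'g, 'gm, 'x) biset \<Rightarrow> ('h, 'hm, 'g, 'gm, 'y) biset \<Rightarrow>
     ('h, 'hm, 'g, 'gm, 'x + 'y) biset" where
  "sum_biset X Y = \<lparr> FOb = (\<lambda>p. FOb X p <+> FOb Y p),
     FAr = (\<lambda>p q f. map_sum (FAr X p q f) (FAr Y p q f)) \<rparr>"

text \<open>For a right \<open>H\<close>-set \<open>X\<close> and a left \<open>H\<close>-set \<open>Y\<close>: the equivalence relation on the triples
  \<open>(\<eta>, x, y)\<close> generated by \<open>(x h, y) \<sim> (x, h y)\<close>, and the quotient by it.\<close>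

definition tensor_rel ::
    "('h, 'hm) cat \<Rightarrow> ('h, 'hm, 'x) set_fun \<Rightarrow> ('h, 'hm, 'y) set_fun \<Rightarrow>
     (('h \<times> 'x \<times> 'y) \<times> ('h \<times> 'x \<times> 'y)) set" where
  "tensor_rel H X Y = (let r = {((\<eta>', FAr X \<eta> \<eta>' h x, y), (\<eta>, x, FAr Y \<eta>' \<eta> h y)) | \<eta> \<eta>' h x y.
       \<eta> \<in> Ob H \<and> \<eta>' \<in> Ob H \<and> h \<in> Hom H \<eta>' \<eta> \<and> x \<in> FOb X \<eta> \<and> y \<in> FOb Y \<eta>'}
     in (r \<union> r\<inverse>)\<^sup>*)"

definition tensor ::
    "('h, 'hm) cat \<Rightarrow> ('h, 'hm, 'x) set_fun \<Rightarrow> ('h, 'hm, 'y) set_fun \<Rightarrow>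
     ('h \<times> 'x \<times> 'y) set set" where
  "tensor H X Y = (SIGMA \<eta> : Ob H. FOb X \<eta> \<times> FOb Y \<eta>) // tensor_rel H X Y"

text \<open>The action on \<open>X \<otimes>\<^sub>H Y\<close> sends the class of \<open>(\<eta>, x, y)\<close> to that of \<open>(\<eta>, g x, y k)\<close>.\<close>

definition tensor_biset ::
    "('k, 'km) cat \<Rightarrow> ('h, 'hm) cat \<Rightarrow> ('g, 'gm) cat \<Rightarrow>
     ('h, 'hm, 'g, 'gm, 'x) biset \<Rightarrow> ('k, 'km, 'h, 'hm, 'y) biset \<Rightarrow>
     ('k, 'km, 'g, 'gm, ('h \<times> 'x \<times> 'y) set) biset" where
  "tensor_biset K H G X Y = \<lparr>
     FOb = (\<lambda>(\<kappa>, \<gamma>). tensor H (right_part G X \<gamma>) (left_part K Y \<kappa>)),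
     FAr = (\<lambda>(\<kappa>, \<gamma>) (\<kappa>', \<gamma>') (k, g) S.
       tensor_rel H (right_part G X \<gamma>') (left_part K Y \<kappa>') ``
         ((\<lambda>(\<eta>, x, y). (\<eta>, FAr (left_part H X \<eta>) \<gamma> \<gamma>' g x,
                            FAr (right_part H Y \<eta>) \<kappa> \<kappa>' k y)) ` S)) \<rparr>"


section \<open>Group completion\<close>

definition gc_rel :: "('a, 'm) monoid_scheme \<Rightarrow> (('a \<times> 'a) \<times> ('a \<times> 'a)) set" where
  "gc_rel M = {((a, b), (a', b')) | a b a' b'.
     a \<in> carrier M \<and> b \<in> carrier M \<and> a' \<in> carrier M \<and> b' \<in> carrier M \<and>
     (\<exists>k\<in>carrier M. a \<otimes>\<^bsub>M\<^esub> b' \<otimes>\<^bsub>M\<^esub> k = a' \<otimes>\<^bsub>M\<^esub> b \<otimes>\<^bsub>M\<^esub> k)}"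

definition group_completion :: "('a, 'm) monoid_scheme \<Rightarrow> ('a \<times> 'a) set monoid" where
  "group_completion M = \<lparr>
     carrier = (carrier M \<times> carrier M) // gc_rel M,
     mult = (\<lambda>A B. \<Union>(a, b)\<in>A. \<Union>(a', b')\<in>B.
       gc_rel M `` {(a \<otimes>\<^bsub>M\<^esub> a', b \<otimes>\<^bsub>M\<^esub> b')}),
     one = gc_rel M `` {(\<one>\<^bsub>M\<^esub>, \<one>\<^bsub>M\<^esub>)} \<rparr>"

definition gc_of :: "('a, 'm) monoid_scheme \<Rightarrow> 'a \<Rightarrow> ('a \<times> 'a) set" where
  "gc_of M a = gc_rel M `` {(a, \<one>\<^bsub>M\<^esub>)}"

text \<open>The extension of a bi-additive \<open>f\<close> with values in \<open>M\<close>: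
  \<open>(a - b, a' - b') \<mapsto> (f a a' + f b b') - (f a b' + f b a')\<close>.\<close>

definition bilinear_ext ::
    "('c, 'm) monoid_scheme \<Rightarrow> ('a \<Rightarrow> 'b \<Rightarrow> 'c) \<Rightarrow>
     ('a \<times> 'a) set \<Rightarrow> ('b \<times> 'b) set \<Rightarrow> ('c \<times> 'c) set" where
  "bilinear_ext M f A B = (\<Union>(a, b)\<in>A. \<Union>(a', b')\<in>B.
     gc_rel M `` {(f a a' \<otimes>\<^bsub>M\<^esub> f b b', f a b' \<otimes>\<^bsub>M\<^esub> f b a')})"


section \<open>Additive categories\<close>

text \<open>The abelian groups \<open>HomGrp C a b\<close> are written multiplicatively, as always in HOL-Algebra.\<close>

record ('o, 'a) preadd_cat = "('o, 'a) cat" +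
  HomGrp :: "'o \<Rightarrow> 'o \<Rightarrow> 'a monoid"

definition preadditive :: "('o, 'a) preadd_cat \<Rightarrow> bool" where
  "preadditive C \<longleftrightarrow> category C \<and>
    (\<forall>a\<in>Ob C. \<forall>b\<in>Ob C. comm_group (HomGrp C a b) \<and> carrier (HomGrp C a b) = Hom C a b) \<and>
    (\<forall>a\<in>Ob C. \<forall>b\<in>Ob C. \<forall>c\<in>Ob C.
      (\<forall>g\<in>Hom C b c. Cmp C a b c g \<in> hom (HomGrp C a b) (HomGrp C a c)) \<and>
      (\<forall>f\<in>Hom C a b. (\<lambda>g. Cmp C a b c g f) \<in> hom (HomGrp C b c) (HomGrp C a c)))"

definition zero_object :: "('o, 'a, 'm) cat_scheme \<Rightarrow> 'o \<Rightarrow> bool" where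
  "zero_object C z \<longleftrightarrow> z \<in> Ob C \<and>
    (\<forall>a\<in>Ob C. (\<exists>!f. f \<in> Hom C z a) \<and> (\<exists>!f. f \<in> Hom C a z))"

definition is_product ::
    "('o, 'a, 'm) cat_scheme \<Rightarrow> 'o \<Rightarrow> 'o \<Rightarrow> 'o \<Rightarrow> 'a \<Rightarrow> 'a \<Rightarrow> bool" where
  "is_product C a b p \<pi>\<^sub>1 \<pi>\<^sub>2 \<longleftrightarrow> p \<in> Ob C \<and> \<pi>\<^sub>1 \<in> Hom C p a \<and> \<pi>\<^sub>2 \<in> Hom C p b \<and>
    (\<forall>k\<in>Ob C. \<forall>f\<in>Hom C k a. \<forall>g\<in>Hom C k b.
      \<exists>!h. h \<in> Hom C k p \<and> Cmp C k p a \<pi>\<^sub>1 h = f \<and> Cmp C k p b \<pi>\<^sub>2 h = g)"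

definition is_coproduct ::
    "('o, 'a, 'm) cat_scheme \<Rightarrow> 'o \<Rightarrow> 'o \<Rightarrow> 'o \<Rightarrow> 'a \<Rightarrow> 'a \<Rightarrow> bool" where
  "is_coproduct C a b p \<iota>\<^sub>1 \<iota>\<^sub>2 \<longleftrightarrow> p \<in> Ob C \<and> \<iota>\<^sub>1 \<in> Hom C a p \<and> \<iota>\<^sub>2 \<in> Hom C b p \<and>
    (\<forall>k\<in>Ob C. \<forall>f\<in>Hom C a k. \<forall>g\<in>Hom C b k.
      \<exists>!h. h \<in> Hom C p k \<and> Cmp C a p k h \<iota>\<^sub>1 = f \<and> Cmp C b p k h \<iota>\<^sub>2 = g)"

definition additive_category :: "('o, 'a) preadd_cat \<Rightarrow> bool" where
  "additive_category C \<longleftrightarrow> preadditive C \<and> (\<exists>z. zero_object C z) \<and>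
    (\<forall>a\<in>Ob C. \<forall>b\<in>Ob C.
      (\<exists>p \<pi>\<^sub>1 \<pi>\<^sub>2. is_product C a b p \<pi>\<^sub>1 \<pi>\<^sub>2) \<and> (\<exists>p \<iota>\<^sub>1 \<iota>\<^sub>2. is_coproduct C a b p \<iota>\<^sub>1 \<iota>\<^sub>2))"


section \<open>The Burnside category\<close>

type_synonym 'u ubiset = "('u, 'u, 'u, 'u, 'u) biset"

text \<open>The class \<open>[X]\<close> consists of the \<open>'u\<close>-valued bi-sets isomorphic to \<open>X\<close>, where \<open>X\<close> itself may
  take values in another type.  A free, finitely generated set over a groupoid on \<open>'u\<close> is a finite
  disjoint union of representable ones, so for infinite \<open>'u\<close> the class of an admissible bi-set is
  never empty; in particular this applies to disjoint unions and to tensor products.\<close>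

definition iso_class ::
    "'u grpd \<Rightarrow> 'u grpd \<Rightarrow> ('u, 'u, 'u, 'u, 'x) biset \<Rightarrow> 'u ubiset set" where
  "iso_class H G X = {Y. admissible H G Y \<and> nat_iso (bicat H G) X Y}"

definition biset_monoid :: "'u grpd \<Rightarrow> 'u grpd \<Rightarrow> 'u ubiset set monoid" where
  "biset_monoid H G = \<lparr>
     carrier = {iso_class H G X | X :: 'u ubiset. admissible H G X},
     mult = (\<lambda>C D. \<Union>X\<in>C. \<Union>Y\<in>D. iso_class H G (sum_biset X Y)),
     one = iso_class H G (empty_biset :: 'u ubiset) \<rparr>"

definition tensor_class ::
    "'u grpd \<Rightarrow> 'u grpd \<Rightarrow> 'u grpd \<Rightarrow> 'u ubiset set \<Rightarrow> 'u ubiset set \<Rightarrow> 'u ubiset set" where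
  "tensor_class K H G C D = (\<Union>X\<in>C. \<Union>Y\<in>D. iso_class K G (tensor_biset K H G X Y))"

type_synonym 'u bmor = "('u ubiset set \<times> 'u ubiset set) set"

text \<open>The morphism from \<open>H\<close> to \<open>G\<close> represented by an admissible \<open>(H, G)\<close>-bi-set.\<close>

definition bclass :: "'u grpd \<Rightarrow> 'u grpd \<Rightarrow> ('u, 'u, 'u, 'u, 'x) biset \<Rightarrow> 'u bmor" where
  "bclass H G X = gc_of (biset_monoid H G) (iso_class H G X)"

definition burnside :: "('u grpd, 'u bmor) preadd_cat" where
  "burnside = \<lparr>
     Ob = {G. groupoid G},
     Hom = (\<lambda>H G. carrier (group_completion (biset_monoid H G))),
     Cmp = (\<lambda>K H G. bilinear_ext (biset_monoid K G) (tensor_class K H G)),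
     Idn = (\<lambda>G. bclass G G (id_biset G)),
     HomGrp = (\<lambda>H G. group_completion (biset_monoid H G)) \<rparr>"

text \<open>For \<open>P = disjoint_union c G H\<close> and \<open>i = c \<circ> Inl\<close> or \<open>i = c \<circ> Inr\<close>, the inclusion of the
  summand \<open>G\<close> or \<open>H\<close>: the bi-set \<open>(\<gamma>, \<pi>) \<mapsto> P (i \<gamma>, \<pi>)\<close> gives the coproduct inclusion, and
  \<open>(\<pi>, \<gamma>) \<mapsto> P (\<pi>, i \<gamma>)\<close> gives the product projection.\<close>

definition incl :: "'u grpd \<Rightarrow> 'u grpd \<Rightarrow> ('u \<Rightarrow> 'u) \<Rightarrow> 'u bmor" where
  "incl G P i = bclass G P (hom_biset P i i id id)"

definition proj :: "'u grpd \<Rightarrow> 'u grpd \<Rightarrow> ('u \<Rightarrow> 'u) \<Rightarrow> 'u bmor" where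
  "proj P G i = bclass P G (hom_biset P id id i i)"

end

theory Submission
  imports Defs
begin

text \<open>Composition of bi-sets is associative, unital and biadditive up to isomorphism, so the
  isomorphism classes form a category enriched in commutative monoids, and completing every
  hom-monoid to a group gives a preadditive category.  There a biproduct is detected by the
  equations \<open>r i = 1\<close>, \<open>s j = 1\<close>, \<open>r j = 0\<close>, \<open>s i = 0\<close>, \<open>i r + j s = 1\<close>, and these already hold for
  bi-sets: with \<open>P = G \<amalg> H\<close>, the composites \<open>P(-, i -) \<otimes>\<^sub>P P(i -, -)\<close> are hom bi-sets by the Yoneda
  lemma, while \<open>P(i -, -) \<otimes>\<^sub>G P(-, i -)\<close> is the part of the bi-set \<open>P(-, -)\<close> lying over \<open>G\<close>.
  The empty groupoid is a zero object.

  No equivalence classes need to be handled: over a groupoid, \<open>(x, y)\<close> and \<open>(x', y')\<close> agree in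
  \<open>X \<otimes>\<^sub>H Y\<close> iff a single arrow \<open>h\<close> satisfies \<open>x = x' h\<close> and \<open>y' = h y\<close>, and a surjective,
  equivariant family of maps \<open>(x, y) \<mapsto> m x y\<close> with this kernel characterizes the tensor product
  up to isomorphism.\<close>

section \<open>Group completion of a category enriched in commutative monoids\<close>

text \<open>Two obstacles shape the proof. The first is size: sums and tensor products of bi-sets
  take values in larger types than \<open>'u\<close>, while a class contains only
  \<open>'u\<close>-valued bi-sets. The tensor product is therefore allowed to live in any type, and
  bi-sets over different types are compared through the \<open>'u\<close>-valued members of their
  classes. Such members exist because finite generation covers each value of a bi-set by finitely
  many images of hom-sets. The second is that morphisms are formal differences, to which a universal
  property of bi-sets does not directly apply. Equations do carry over, because \<open>gc_of\<close>
  is additive and respects composition; this is why biproduct equations are verified for bi-sets.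
  Invertibility of arrows enters twice: it makes the relations that generate orbits and tensor
  products symmetric and transitive, so that no zigzags occur, and it makes two factorizations of
  one arrow differ by an arrow between the middle objects.\<close>

definition gc_class :: "('a, 'm) monoid_scheme \<Rightarrow> 'a \<Rightarrow> 'a \<Rightarrow> ('a \<times> 'a) set" where
  "gc_class M a b = gc_rel M `` {(a, b)}"

text \<open>The operations on classes are unions over all pairs of representatives. Once the result
  is independent of the representatives the union is constant, and one given pair keeps it from
  being empty.\<close>

lemma UN_UN_const:
  assumes "(a, b) \<in> A" "(c, d) \<in> B"
    and "\<And>a b c d. (a, b) \<in> A \<Longrightarrow> (c, d) \<in> B \<Longrightarrow> f a b c d = S"
  shows "(\<Union>(a, b)\<in>A. \<Union>(c, d)\<in>B. f a b c d) = S"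
proof -
  have "(\<Union>(a, b)\<in>A. \<Union>(c, d)\<in>B. f a b c d) = (\<Union>p\<in>A. \<Union>q\<in>B. S)"
    using assms(3) by (intro SUP_cong refl) auto
  with assms(1,2) show ?thesis
    by auto
qed

section \<open>Formal differences over a commutative monoid\<close>

context comm_monoid
begin

text \<open>Without cancellation the middle entry \<open>d\<close> cannot be removed from the
  combined equation, so it is absorbed into the witness together with \<open>k\<close> and
  \<open>l\<close>.\<close>

lemma gc_rel_trans:
  assumes "a \<in> carrier G" "b \<in> carrier G" "c \<in> carrier G" "d \<in> carrier G" "e \<in> carrier G"
    "f \<in> carrier G" "k \<in> carrier G" "l \<in> carrier G"
    and k: "a \<otimes> d \<otimes> k = c \<otimes> b \<otimes> k" and l: "c \<otimes> f \<otimes> l = e \<otimes> d \<otimes> l"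
  shows "a \<otimes> f \<otimes> (d \<otimes> k \<otimes> l) = e \<otimes> b \<otimes> (d \<otimes> k \<otimes> l)"
proof -
  have "a \<otimes> f \<otimes> (d \<otimes> k \<otimes> l) = (a \<otimes> d \<otimes> k) \<otimes> (f \<otimes> l)"
    using assms(1-8) by (simp add: m_ac)
  also have "\<dots> = (c \<otimes> f \<otimes> l) \<otimes> (b \<otimes> k)"
    using assms(1-8) unfolding k by (simp add: m_ac)
  also have "\<dots> = e \<otimes> b \<otimes> (d \<otimes> k \<otimes> l)"
    using assms(1-8) unfolding l by (simp add: m_ac)
  finally show ?thesis .
qed

lemma equiv_gc_rel: "equiv (carrier G \<times> carrier G) (gc_rel G)"
proof (rule equivI)
  show "gc_rel G \<subseteq> (carrier G \<times> carrier G) \<times> (carrier G \<times> carrier G)"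
    by (auto simp: gc_rel_def)
  show "refl_on (carrier G \<times> carrier G) (gc_rel G)"
    by (auto simp: refl_on_def gc_rel_def)
  show "sym (gc_rel G)"
    unfolding gc_rel_def sym_def by simp metis
  show "trans (gc_rel G)"
  proof (rule transI)
    fix p q r assume "(p, q) \<in> gc_rel G" "(q, r) \<in> gc_rel G"
    then obtain a b c d e f k l where *: "p = (a, b)" "q = (c, d)" "r = (e, f)"
      "a \<in> carrier G" "b \<in> carrier G" "c \<in> carrier G" "d \<in> carrier G" "e \<in> carrier G"
      "f \<in> carrier G" "k \<in> carrier G" "l \<in> carrier G"
      "a \<otimes> d \<otimes> k = c \<otimes> b \<otimes> k" "c \<otimes> f \<otimes> l = e \<otimes> d \<otimes> l"
      unfolding gc_rel_def by blast
    show "(p, r) \<in> gc_rel G"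
      unfolding gc_rel_def *(1-3)
      using gc_rel_trans[OF *(4-13)] m_closed[OF m_closed[OF *(7,10)] *(11)] *(4,5,8,9) by auto
  qed
qed

lemma gc_class_eq_iff:
  assumes "a \<in> carrier G" "b \<in> carrier G" "c \<in> carrier G" "d \<in> carrier G"
  shows "gc_class G a b = gc_class G c d \<longleftrightarrow> (\<exists>k\<in>carrier G. a \<otimes> d \<otimes> k = c \<otimes> b \<otimes> k)"
  using assms eq_equiv_class_iff[OF equiv_gc_rel, of "(a, b)" "(c, d)"]
  by (simp add: gc_class_def) (simp add: gc_rel_def)

lemma gc_class_eqI:
  assumes "a \<otimes> d \<otimes> k = c \<otimes> b \<otimes> k" "k \<in> carrier G"
    "a \<in> carrier G" "b \<in> carrier G" "c \<in> carrier G" "d \<in> carrier G"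
  shows "gc_class G a b = gc_class G c d"
  using assms by (auto simp: gc_class_eq_iff)

text \<open>Turns the representatives over which the unions range into equations between classes,
  which \<open>gc_class_eq_iff\<close> then unpacks.\<close>

lemma mem_gc_class:
  assumes "a \<in> carrier G" "b \<in> carrier G"
  shows "p \<in> gc_class G a b \<longleftrightarrow>
    (\<exists>c d. p = (c, d) \<and> c \<in> carrier G \<and> d \<in> carrier G \<and> gc_class G c d = gc_class G a b)"
proof -
  have "(c, d) \<in> gc_class G a b \<longleftrightarrow>
      c \<in> carrier G \<and> d \<in> carrier G \<and> gc_class G c d = gc_class G a b" for c d
    using eq_equiv_class_iff[OF equiv_gc_rel, of "(c, d)" "(a, b)"] assms equivE[OF equiv_gc_rel]
    by (auto simp: gc_class_def dest: symD equiv_class_eq[OF equiv_gc_rel])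
  then show ?thesis
    by (cases p) auto
qed

lemma carrier_group_completion:
  "carrier (group_completion G) = {gc_class G a b | a b. a \<in> carrier G \<and> b \<in> carrier G}"
  by (auto simp: group_completion_def quotient_def gc_class_def)

lemma group_completion_cases:
  assumes "x \<in> carrier (group_completion G)"
  obtains a b where "a \<in> carrier G" "b \<in> carrier G" "x = gc_class G a b"
  using assms by (auto simp: carrier_group_completion)

lemma gc_class_in_carrier:
  "a \<in> carrier G \<Longrightarrow> b \<in> carrier G \<Longrightarrow> gc_class G a b \<in> carrier (group_completion G)"
  by (auto simp: carrier_group_completion)

lemma one_group_completion: "\<one>\<^bsub>group_completion G\<^esub> = gc_class G \<one> \<one>"
  by (simp add: group_completion_def gc_class_def)

lemma gc_of_eq: "gc_of G a = gc_class G a \<one>"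
  by (simp add: gc_of_def gc_class_def)

lemma mult_gc_class:
  assumes "a \<in> carrier G" "b \<in> carrier G" "c \<in> carrier G" "d \<in> carrier G"
  shows "gc_class G a b \<otimes>\<^bsub>group_completion G\<^esub> gc_class G c d = gc_class G (a \<otimes> c) (b \<otimes> d)"
proof -
  have *: "gc_class G (a' \<otimes> c') (b' \<otimes> d') = gc_class G (a \<otimes> c) (b \<otimes> d)"
    if "(a', b') \<in> gc_class G a b" "(c', d') \<in> gc_class G c d" for a' b' c' d'
  proof -
    from that assms have in_carrier: "a' \<in> carrier G" "b' \<in> carrier G" "c' \<in> carrier G" "d' \<in> carrier G"
      and eq: "gc_class G a' b' = gc_class G a b" "gc_class G c' d' = gc_class G c d"
      by (auto simp: mem_gc_class)
    from eq obtain k l where kl: "k \<in> carrier G" "l \<in> carrier G"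
      and k: "a' \<otimes> b \<otimes> k = a \<otimes> b' \<otimes> k" and l: "c' \<otimes> d \<otimes> l = c \<otimes> d' \<otimes> l"
      using assms in_carrier by (auto simp: gc_class_eq_iff)
    \<comment> \<open>By commutativity the two given equations can be multiplied, and so can their
      witnesses.\<close>
    have "(a' \<otimes> c') \<otimes> (b \<otimes> d) \<otimes> (k \<otimes> l) = (a' \<otimes> b \<otimes> k) \<otimes> (c' \<otimes> d \<otimes> l)"
      using assms in_carrier kl by (simp add: m_ac)
    also have "\<dots> = (a \<otimes> c) \<otimes> (b' \<otimes> d') \<otimes> (k \<otimes> l)"
      unfolding k l using assms in_carrier kl by (simp add: m_ac)
    finally show ?thesis
      by (rule gc_class_eqI) (simp_all add: assms in_carrier kl)
  qed
  have "(a, b) \<in> gc_class G a b" "(c, d) \<in> gc_class G c d"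
    using assms by (auto simp: mem_gc_class)
  then have "(\<Union>(a', b')\<in>gc_class G a b. \<Union>(c', d')\<in>gc_class G c d. gc_class G (a' \<otimes> c') (b' \<otimes> d')) =
      gc_class G (a \<otimes> c) (b \<otimes> d)"
    by (rule UN_UN_const) (rule *)
  then show ?thesis
    by (simp add: group_completion_def gc_class_def)
qed

lemma comm_group_group_completion: "comm_group (group_completion G)"
proof (rule comm_groupI)
  fix x assume "x \<in> carrier (group_completion G)"
  then obtain a b where ab: "a \<in> carrier G" "b \<in> carrier G" "x = gc_class G a b"
    by (rule group_completion_cases)
  \<comment> \<open>The negative of the formal difference \<open>a - b\<close> is
    \<open>b - a\<close>.\<close>
  have "gc_class G (b \<otimes> a) (a \<otimes> b) = gc_class G \<one> \<one>"
    using ab by (intro gc_class_eqI[where k = \<one>]) (simp_all add: m_comm)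
  with ab show "\<exists>y\<in>carrier (group_completion G). y \<otimes>\<^bsub>group_completion G\<^esub> x = \<one>\<^bsub>group_completion G\<^esub>"
    by (intro bexI[of _ "gc_class G b a"])
      (simp_all add: mult_gc_class one_group_completion gc_class_in_carrier)
next
  show "\<one>\<^bsub>group_completion G\<^esub> \<in> carrier (group_completion G)"
    by (simp add: one_group_completion gc_class_in_carrier)
next
  fix x y assume "x \<in> carrier (group_completion G)" "y \<in> carrier (group_completion G)"
  then show "x \<otimes>\<^bsub>group_completion G\<^esub> y \<in> carrier (group_completion G)"
    by (auto elim!: group_completion_cases simp: mult_gc_class gc_class_in_carrier)
qed (auto elim!: group_completion_cases simp: mult_gc_class one_group_completion m_ac)

end

text \<open>Preservation of zero is an axiom of its own: without cancellation in \<open>M\<close>,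
  additivity only makes the value at zero idempotent.\<close>

locale biadditive =
  L: comm_monoid L + R: comm_monoid R + M: comm_monoid M
  for L :: "('a, 'l) monoid_scheme" and R :: "('b, 'r) monoid_scheme"
    and M :: "('c, 'm) monoid_scheme" +
  fixes f :: "'a \<Rightarrow> 'b \<Rightarrow> 'c"
  assumes closed: "x \<in> carrier L \<Longrightarrow> y \<in> carrier R \<Longrightarrow> f x y \<in> carrier M"
    and add_left: "x \<in> carrier L \<Longrightarrow> x' \<in> carrier L \<Longrightarrow> y \<in> carrier R \<Longrightarrow>
      f (x \<otimes>\<^bsub>L\<^esub> x') y = f x y \<otimes>\<^bsub>M\<^esub> f x' y"
    and add_right: "x \<in> carrier L \<Longrightarrow> y \<in> carrier R \<Longrightarrow> y' \<in> carrier R \<Longrightarrow>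
      f x (y \<otimes>\<^bsub>R\<^esub> y') = f x y \<otimes>\<^bsub>M\<^esub> f x y'"
    and zero_left: "y \<in> carrier R \<Longrightarrow> f \<one>\<^bsub>L\<^esub> y = \<one>\<^bsub>M\<^esub>"
    and zero_right: "x \<in> carrier L \<Longrightarrow> f x \<one>\<^bsub>R\<^esub> = \<one>\<^bsub>M\<^esub>"
begin

text \<open>Apply \<open>f\<close> in its first argument, once with \<open>x\<close> and once with
  \<open>y\<close>, to the equation behind \<open>a - b = c - d\<close>. The equation for
  \<open>x\<close> is used from left to right and the one for \<open>y\<close> from right to left,
  and both leave their witness behind.\<close>

lemma gc_class_cong_left:
  assumes "a \<in> carrier L" "b \<in> carrier L" "c \<in> carrier L" "d \<in> carrier L"
    "x \<in> carrier R" "y \<in> carrier R" "gc_class L a b = gc_class L c d"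
  shows "gc_class M (f a x \<otimes>\<^bsub>M\<^esub> f b y) (f a y \<otimes>\<^bsub>M\<^esub> f b x) =
    gc_class M (f c x \<otimes>\<^bsub>M\<^esub> f d y) (f c y \<otimes>\<^bsub>M\<^esub> f d x)"
proof -
  from assms obtain k where k: "k \<in> carrier L"
    and eq: "a \<otimes>\<^bsub>L\<^esub> d \<otimes>\<^bsub>L\<^esub> k = c \<otimes>\<^bsub>L\<^esub> b \<otimes>\<^bsub>L\<^esub> k"
    by (auto simp: L.gc_class_eq_iff)
  have e: "f a z \<otimes>\<^bsub>M\<^esub> f d z \<otimes>\<^bsub>M\<^esub> f k z = f c z \<otimes>\<^bsub>M\<^esub> f b z \<otimes>\<^bsub>M\<^esub> f k z"
    if "z \<in> carrier R" for z
    using arg_cong[OF eq, of "\<lambda>w. f w z"] that assms k by (simp add: add_left)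
  let ?k = "f k x \<otimes>\<^bsub>M\<^esub> f k y"
  have "(f a x \<otimes>\<^bsub>M\<^esub> f b y) \<otimes>\<^bsub>M\<^esub> (f c y \<otimes>\<^bsub>M\<^esub> f d x) \<otimes>\<^bsub>M\<^esub> ?k =
     (f a x \<otimes>\<^bsub>M\<^esub> f d x \<otimes>\<^bsub>M\<^esub> f k x) \<otimes>\<^bsub>M\<^esub> (f c y \<otimes>\<^bsub>M\<^esub> f b y \<otimes>\<^bsub>M\<^esub> f k y)"
    using assms k by (simp add: M.m_ac closed)
  also have "\<dots> = (f c x \<otimes>\<^bsub>M\<^esub> f b x \<otimes>\<^bsub>M\<^esub> f k x) \<otimes>\<^bsub>M\<^esub> (f a y \<otimes>\<^bsub>M\<^esub> f d y \<otimes>\<^bsub>M\<^esub> f k y)"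
    using assms by (simp add: e)
  also have "\<dots> = (f c x \<otimes>\<^bsub>M\<^esub> f d y) \<otimes>\<^bsub>M\<^esub> (f a y \<otimes>\<^bsub>M\<^esub> f b x) \<otimes>\<^bsub>M\<^esub> ?k"
    using assms k by (simp add: M.m_ac closed)
  finally show ?thesis
    by (rule M.gc_class_eqI) (simp_all add: assms k closed)
qed

text \<open>Makes independence of the representative in the second argument an instance of
  \<open>gc_class_cong_left\<close>.\<close>

lemma flip: "biadditive R L M (\<lambda>y x. f x y)"
  by unfold_locales (simp_all add: closed add_left add_right zero_left zero_right)

lemma bilinear_ext_gc_class:
  assumes "a \<in> carrier L" "b \<in> carrier L" "c \<in> carrier R" "d \<in> carrier R"
  shows "bilinear_ext M f (gc_class L a b) (gc_class R c d) =
    gc_class M (f a c \<otimes>\<^bsub>M\<^esub> f b d) (f a d \<otimes>\<^bsub>M\<^esub> f b c)"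
proof -
  interpret flip: biadditive R L M "\<lambda>y x. f x y"
    by (rule flip)
  have *: "gc_class M (f a' c' \<otimes>\<^bsub>M\<^esub> f b' d') (f a' d' \<otimes>\<^bsub>M\<^esub> f b' c') =
      gc_class M (f a c \<otimes>\<^bsub>M\<^esub> f b d) (f a d \<otimes>\<^bsub>M\<^esub> f b c)"
    if "(a', b') \<in> gc_class L a b" "(c', d') \<in> gc_class R c d" for a' b' c' d'
  proof -
    from that assms have in_carrier: "a' \<in> carrier L" "b' \<in> carrier L" "c' \<in> carrier R" "d' \<in> carrier R"
      and eq: "gc_class L a' b' = gc_class L a b" "gc_class R c' d' = gc_class R c d"
      by (auto simp: L.mem_gc_class R.mem_gc_class)
    \<comment> \<open>The representatives are exchanged one argument at a time, passing through
      \<open>(a, b)\<close> paired with \<open>(c', d')\<close>.\<close>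
    then show ?thesis
      using gc_class_cong_left[of a' b' a b c' d'] flip.gc_class_cong_left[of c' d' c d a b] assms
      by (simp add: M.m_comm closed)
  qed
  have "(a, b) \<in> gc_class L a b" "(c, d) \<in> gc_class R c d"
    using assms by (auto simp: L.mem_gc_class R.mem_gc_class)
  then have "(\<Union>(a', b')\<in>gc_class L a b. \<Union>(c', d')\<in>gc_class R c d.
      gc_class M (f a' c' \<otimes>\<^bsub>M\<^esub> f b' d') (f a' d' \<otimes>\<^bsub>M\<^esub> f b' c')) =
      gc_class M (f a c \<otimes>\<^bsub>M\<^esub> f b d) (f a d \<otimes>\<^bsub>M\<^esub> f b c)"
    by (rule UN_UN_const) (rule *)
  then show ?thesis
    by (simp add: bilinear_ext_def gc_class_def)
qed

text \<open>Three of the four terms of the extension have a zero argument. Hence equations between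
  composites in the monoids carry over to the completion.\<close>

lemma bilinear_ext_gc_of:
  assumes "a \<in> carrier L" "c \<in> carrier R"
  shows "bilinear_ext M f (gc_of L a) (gc_of R c) = gc_of M (f a c)"
  using assms by (simp add: L.gc_of_eq R.gc_of_eq M.gc_of_eq bilinear_ext_gc_class zero_left zero_right closed)

end

section \<open>Group completion of all hom-monoids\<close>

text \<open>\<open>T a b c y x\<close> is the composite of \<open>x : a \<rightarrow> b\<close> and \<open>y : b \<rightarrow> c\<close>.\<close>

locale monoid_enriched =
  fixes Obj :: "'o set" and M :: "'o \<Rightarrow> 'o \<Rightarrow> 'a monoid"
    and T :: "'o \<Rightarrow> 'o \<Rightarrow> 'o \<Rightarrow> 'a \<Rightarrow> 'a \<Rightarrow> 'a" and e :: "'o \<Rightarrow> 'a"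
  assumes biadditive: "a \<in> Obj \<Longrightarrow> b \<in> Obj \<Longrightarrow> c \<in> Obj \<Longrightarrow> biadditive (M b c) (M a b) (M a c) (T a b c)"
    and assoc: "a \<in> Obj \<Longrightarrow> b \<in> Obj \<Longrightarrow> c \<in> Obj \<Longrightarrow> d \<in> Obj \<Longrightarrow>
      x \<in> carrier (M a b) \<Longrightarrow> y \<in> carrier (M b c) \<Longrightarrow> z \<in> carrier (M c d) \<Longrightarrow>
      T a c d z (T a b c y x) = T a b d (T b c d z y) x"
    and unit_closed: "a \<in> Obj \<Longrightarrow> e a \<in> carrier (M a a)"
    and unit_right: "a \<in> Obj \<Longrightarrow> b \<in> Obj \<Longrightarrow> x \<in> carrier (M a b) \<Longrightarrow> T a a b x (e a) = x"
    and unit_left: "a \<in> Obj \<Longrightarrow> b \<in> Obj \<Longrightarrow> x \<in> carrier (M a b) \<Longrightarrow> T a b b (e b) x = x"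
begin

text \<open>Built field by field like \<open>burnside\<close>, so that
  \<open>burnside_eq_completion\<close> is mere unfolding.\<close>

definition completion :: "('o, ('a \<times> 'a) set) preadd_cat" where
  "completion = \<lparr> Ob = Obj, Hom = (\<lambda>a b. carrier (group_completion (M a b))),
     Cmp = (\<lambda>a b c. bilinear_ext (M a c) (T a b c)),
     Idn = (\<lambda>a. gc_of (M a a) (e a)), HomGrp = (\<lambda>a b. group_completion (M a b)) \<rparr>"

lemma completion_simps [simp]:
  "Ob completion = Obj" "Hom completion a b = carrier (group_completion (M a b))"
  "Cmp completion a b c = bilinear_ext (M a c) (T a b c)"
  "Idn completion a = gc_of (M a a) (e a)" "HomGrp completion a b = group_completion (M a b)"
  by (simp_all add: completion_def)

lemma comm_monoid: "a \<in> Obj \<Longrightarrow> b \<in> Obj \<Longrightarrow> comm_monoid (M a b)"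
  using biadditive[of a b a] by (simp add: biadditive_def)

text \<open>Together with \<open>gc_cases\<close>, these rules turn an identity between morphisms of
  the completion into one between elements of the monoids \<open>M a b\<close>, which
  \<open>M_simps\<close> and \<open>M_ac\<close> settle.\<close>

lemmas gc_simps = comm_monoid.gc_of_eq[OF comm_monoid] comm_monoid.mult_gc_class[OF comm_monoid]
  comm_monoid.gc_class_in_carrier[OF comm_monoid] comm_monoid.one_group_completion[OF comm_monoid]
  biadditive.bilinear_ext_gc_class[OF biadditive]

lemmas M_simps = biadditive.closed[OF biadditive] biadditive.add_left[OF biadditive]
  biadditive.add_right[OF biadditive] biadditive.zero_left[OF biadditive] biadditive.zero_right[OF biadditive]
  monoid.one_closed[OF comm_monoid.axioms(1)[OF comm_monoid]]
  monoid.m_closed[OF comm_monoid.axioms(1)[OF comm_monoid]]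
  monoid.l_one[OF comm_monoid.axioms(1)[OF comm_monoid]]
  monoid.r_one[OF comm_monoid.axioms(1)[OF comm_monoid]]
  unit_closed unit_left unit_right

lemmas M_ac = monoid.m_assoc[OF comm_monoid.axioms(1)[OF comm_monoid]]
  comm_monoid.m_comm[OF comm_monoid] comm_monoid.m_lcomm[OF comm_monoid]

lemma gc_cases:
  assumes "x \<in> carrier (group_completion (M a b))" "a \<in> Obj" "b \<in> Obj"
  obtains s t where "s \<in> carrier (M a b)" "t \<in> carrier (M a b)" "x = gc_class (M a b) s t"
  using assms by (auto simp: comm_monoid.carrier_group_completion[OF comm_monoid])

lemma category_completion: "category completion"
  unfolding category_def
proof (intro conjI ballI; simp)
  fix a assume "a \<in> Obj"
  then show "gc_of (M a a) (e a) \<in> carrier (group_completion (M a a))"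
    by (simp add: gc_simps M_simps)
next
  fix a b c f g
  assume obj: "a \<in> Obj" "b \<in> Obj" "c \<in> Obj"
    and fg: "f \<in> carrier (group_completion (M a b))" "g \<in> carrier (group_completion (M b c))"
  from fg obj show "bilinear_ext (M a c) (T a b c) g f \<in> carrier (group_completion (M a c))"
    by (elim gc_cases) (simp_all add: gc_simps M_simps)
next
  fix a b f
  assume obj: "a \<in> Obj" "b \<in> Obj" and f: "f \<in> carrier (group_completion (M a b))"
  then show "bilinear_ext (M a b) (T a a b) f (gc_of (M a a) (e a)) = f"
    by (elim gc_cases) (simp_all add: gc_simps M_simps)
  from obj f show "bilinear_ext (M a b) (T a b b) (gc_of (M b b) (e b)) f = f"
    by (elim gc_cases) (simp_all add: gc_simps M_simps)
next
  fix a b c d f g h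
  assume obj: "a \<in> Obj" "b \<in> Obj" "c \<in> Obj" "d \<in> Obj"
    and "f \<in> carrier (group_completion (M a b))" "g \<in> carrier (group_completion (M b c))"
      "h \<in> carrier (group_completion (M c d))"
  then show "bilinear_ext (M a d) (T a c d) h (bilinear_ext (M a c) (T a b c) g f) =
      bilinear_ext (M a d) (T a b d) (bilinear_ext (M b d) (T b c d) h g) f"
    \<comment> \<open>Both sides become a difference of two sums of four triple composites:
      \<open>assoc\<close> makes the summands agree, and AC rewriting makes their order
      agree.\<close>
    apply (elim gc_cases; simp add: gc_simps M_simps)
    apply (simp add: M_simps assoc)
    apply (simp add: M_simps M_ac)
    done
qed

lemma preadditive_completion: "preadditive completion"
  unfolding preadditive_def
proof (intro conjI ballI category_completion; simp)
  fix a b assume "a \<in> Obj" "b \<in> Obj"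
  then show "comm_group (group_completion (M a b))"
    by (simp add: comm_monoid.comm_group_group_completion comm_monoid)
next
  fix a b c g assume obj: "a \<in> Obj" "b \<in> Obj" "c \<in> Obj" and "g \<in> carrier (group_completion (M b c))"
  then show "bilinear_ext (M a c) (T a b c) g \<in> hom (group_completion (M a b)) (group_completion (M a c))"
    by (elim gc_cases) (auto elim!: gc_cases simp: hom_def gc_simps M_simps M_ac)
next
  fix a b c f assume obj: "a \<in> Obj" "b \<in> Obj" "c \<in> Obj" and "f \<in> carrier (group_completion (M a b))"
  then show "(\<lambda>g. bilinear_ext (M a c) (T a b c) g f) \<in> hom (group_completion (M b c)) (group_completion (M a c))"
    by (elim gc_cases) (auto elim!: gc_cases simp: hom_def gc_simps M_simps M_ac)
qed

end

text \<open>The arrow into \<open>p\<close> with components \<open>f\<close> and \<open>g\<close> is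
  \<open>i f + j g\<close>, and the arrow out of \<open>p\<close> is \<open>f r + g s\<close>. The
  four equations pairing \<open>r\<close>, \<open>s\<close> with \<open>i\<close>, \<open>j\<close>
  compute the components; uniqueness comes from \<open>i r + j s = 1\<close>, by which
  \<open>h\<close> equals \<open>(i r + j s) h\<close> in the first case and
  \<open>h (i r + j s)\<close> in the second.\<close>

lemma preadditive_biproduct:
  assumes C: "preadditive C" and ob: "a \<in> Ob C" "b \<in> Ob C" "p \<in> Ob C"
    and mor: "i \<in> Hom C a p" "j \<in> Hom C b p" "r \<in> Hom C p a" "s \<in> Hom C p b"
    and eqs: "Cmp C a p a r i = Idn C a" "Cmp C b p b s j = Idn C b"
      "Cmp C b p a r j = \<one>\<^bsub>HomGrp C b a\<^esub>" "Cmp C a p b s i = \<one>\<^bsub>HomGrp C a b\<^esub>"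
      "Cmp C p a p i r \<otimes>\<^bsub>HomGrp C p p\<^esub> Cmp C p b p j s = Idn C p"
  shows "is_product C a b p r s" "is_coproduct C a b p i j"
proof -
  have cat: "category C"
    using C by (simp add: preadditive_def)
  have grp: "comm_group (HomGrp C x y)" and carr: "carrier (HomGrp C x y) = Hom C x y"
    if "x \<in> Ob C" "y \<in> Ob C" for x y
    using C that by (auto simp: preadditive_def)
  have homr: "Cmp C x y z g \<in> hom (HomGrp C x y) (HomGrp C x z)"
    if "x \<in> Ob C" "y \<in> Ob C" "z \<in> Ob C" "g \<in> Hom C y z" for x y z g
    using C that by (auto simp: preadditive_def)
  have homl: "(\<lambda>g. Cmp C x y z g f) \<in> hom (HomGrp C y z) (HomGrp C x z)"
    if "x \<in> Ob C" "y \<in> Ob C" "z \<in> Ob C" "f \<in> Hom C x y" for x y z f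
    using C that by (auto simp: preadditive_def)
  have closed: "Cmp C x y z g f \<in> Hom C x z"
    if "x \<in> Ob C" "y \<in> Ob C" "z \<in> Ob C" "f \<in> Hom C x y" "g \<in> Hom C y z" for x y z f g
    using cat that by (auto simp: category_def)
  have ass: "Cmp C w y z h (Cmp C w x y g f) = Cmp C w x z (Cmp C x y z h g) f"
    if "w \<in> Ob C" "x \<in> Ob C" "y \<in> Ob C" "z \<in> Ob C" "f \<in> Hom C w x" "g \<in> Hom C x y" "h \<in> Hom C y z"
    for w x y z f g h
    using cat that by (auto simp: category_def)
  have idl: "Cmp C x y y (Idn C y) f = f" and idr: "Cmp C x x y f (Idn C x) = f"
    if "x \<in> Ob C" "y \<in> Ob C" "f \<in> Hom C x y" for x y f
    using cat that by (auto simp: category_def)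
  have addr: "Cmp C x y z g (f \<otimes>\<^bsub>HomGrp C x y\<^esub> f') = Cmp C x y z g f \<otimes>\<^bsub>HomGrp C x z\<^esub> Cmp C x y z g f'"
    if "x \<in> Ob C" "y \<in> Ob C" "z \<in> Ob C" "g \<in> Hom C y z" "f \<in> Hom C x y" "f' \<in> Hom C x y" for x y z g f f'
    using homr[OF that(1-4)] that carr by (auto simp: hom_def)
  have addl: "Cmp C x y z (g \<otimes>\<^bsub>HomGrp C y z\<^esub> g') f = Cmp C x y z g f \<otimes>\<^bsub>HomGrp C x z\<^esub> Cmp C x y z g' f"
    if "x \<in> Ob C" "y \<in> Ob C" "z \<in> Ob C" "f \<in> Hom C x y" "g \<in> Hom C y z" "g' \<in> Hom C y z" for x y z g f g'
    using homl[OF that(1-4)] that carr by (auto simp: hom_def)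
  have grp': "group (HomGrp C x y)" if "x \<in> Ob C" "y \<in> Ob C" for x y
    using grp[OF that] by (simp add: comm_group.axioms)
  \<comment> \<open>Composition with a fixed arrow is a homomorphism of groups, so it kills zero;
    the cross terms disappear this way.\<close>
  have zr: "Cmp C x y z g \<one>\<^bsub>HomGrp C x y\<^esub> = \<one>\<^bsub>HomGrp C x z\<^esub>"
    if "x \<in> Ob C" "y \<in> Ob C" "z \<in> Ob C" "g \<in> Hom C y z" for x y z g
    using hom_one[OF homr[OF that] grp' grp'] that by simp
  have zl: "Cmp C x y z \<one>\<^bsub>HomGrp C y z\<^esub> f = \<one>\<^bsub>HomGrp C x z\<^esub>"
    if "x \<in> Ob C" "y \<in> Ob C" "z \<in> Ob C" "f \<in> Hom C x y" for x y z f
    using hom_one[OF homl[OF that] grp' grp'] that by simp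
  have mclosed: "f \<otimes>\<^bsub>HomGrp C x y\<^esub> g \<in> Hom C x y"
    if "x \<in> Ob C" "y \<in> Ob C" "f \<in> Hom C x y" "g \<in> Hom C x y" for x y f g
    using monoid.m_closed[OF group.is_monoid[OF grp'[OF that(1,2)]]] that carr by auto
  have one: "f \<otimes>\<^bsub>HomGrp C x y\<^esub> \<one>\<^bsub>HomGrp C x y\<^esub> = f" "\<one>\<^bsub>HomGrp C x y\<^esub> \<otimes>\<^bsub>HomGrp C x y\<^esub> f = f"
    if "x \<in> Ob C" "y \<in> Ob C" "f \<in> Hom C x y" for x y f
    using monoid.r_one[OF group.is_monoid[OF grp'[OF that(1,2)]]]
      monoid.l_one[OF group.is_monoid[OF grp'[OF that(1,2)]]] that carr by auto
  show "is_product C a b p r s"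
    unfolding is_product_def
  proof (intro conjI ballI)
    fix k f g assume k: "k \<in> Ob C" and fg: "f \<in> Hom C k a" "g \<in> Hom C k b"
    let ?h = "Cmp C k a p i f \<otimes>\<^bsub>HomGrp C k p\<^esub> Cmp C k b p j g"
    show "\<exists>!h. h \<in> Hom C k p \<and> Cmp C k p a r h = f \<and> Cmp C k p b s h = g"
    proof (rule ex1I[of _ ?h])
      show "?h \<in> Hom C k p \<and> Cmp C k p a r ?h = f \<and> Cmp C k p b s ?h = g"
        using k fg ob mor eqs by (simp add: addr ass closed mclosed idl zl one)
    next
      fix h assume "h \<in> Hom C k p \<and> Cmp C k p a r h = f \<and> Cmp C k p b s h = g"
      then have h: "h \<in> Hom C k p" and f: "f = Cmp C k p a r h" and g: "g = Cmp C k p b s h"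
        by auto
      have "?h = Cmp C k p p (Idn C p) h"
        unfolding f g eqs(5)[symmetric] using k h ob mor by (simp add: addl ass closed)
      then show "h = ?h"
        using idl k h ob by simp
    qed
  qed (use ob mor in auto)
  show "is_coproduct C a b p i j"
    unfolding is_coproduct_def
  proof (intro conjI ballI)
    fix k f g assume k: "k \<in> Ob C" and fg: "f \<in> Hom C a k" "g \<in> Hom C b k"
    let ?h = "Cmp C p a k f r \<otimes>\<^bsub>HomGrp C p k\<^esub> Cmp C p b k g s"
    show "\<exists>!h. h \<in> Hom C p k \<and> Cmp C a p k h i = f \<and> Cmp C b p k h j = g"
    proof (rule ex1I[of _ ?h])
      show "?h \<in> Hom C p k \<and> Cmp C a p k ?h i = f \<and> Cmp C b p k ?h j = g"
        using k fg ob mor eqs by (simp add: addl ass[symmetric] closed mclosed idr zr one)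
    next
      fix h assume "h \<in> Hom C p k \<and> Cmp C a p k h i = f \<and> Cmp C b p k h j = g"
      then have h: "h \<in> Hom C p k" and f: "f = Cmp C a p k h i" and g: "g = Cmp C b p k h j"
        by auto
      have "?h = Cmp C p p k h (Idn C p)"
        unfolding f g eqs(5)[symmetric] using k h ob mor by (simp add: addr ass[symmetric] closed)
      then show "h = ?h"
        using idr k h ob by simp
    qed
  qed (use ob mor in auto)
qed

text \<open>Since \<open>gc_of\<close> is additive, respects composition and sends units to
  identities, the equations in the monoids become those that \<open>preadditive_biproduct\<close>
  asks for.\<close>

lemma (in monoid_enriched) completion_biproduct:
  assumes ob: "a \<in> Obj" "b \<in> Obj" "p \<in> Obj"
    and mor: "i \<in> carrier (M a p)" "j \<in> carrier (M b p)" "r \<in> carrier (M p a)" "s \<in> carrier (M p b)"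
    and eqs: "T a p a r i = e a" "T b p b s j = e b" "T b p a r j = \<one>\<^bsub>M b a\<^esub>" "T a p b s i = \<one>\<^bsub>M a b\<^esub>"
      "T p a p i r \<otimes>\<^bsub>M p p\<^esub> T p b p j s = e p"
  shows "is_product completion a b p (gc_of (M p a) r) (gc_of (M p b) s)"
    and "is_coproduct completion a b p (gc_of (M a p) i) (gc_of (M b p) j)"
proof -
  have cmp: "bilinear_ext (M u w) (T u v w) (gc_of (M v w) y) (gc_of (M u v) x) = gc_of (M u w) (T u v w y x)"
    if "u \<in> Obj" "v \<in> Obj" "w \<in> Obj" "x \<in> carrier (M u v)" "y \<in> carrier (M v w)" for u v w x y
    using biadditive.bilinear_ext_gc_of[OF biadditive] that by blast
  have closed: "gc_of (M u v) x \<in> carrier (group_completion (M u v))"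
    if "u \<in> Obj" "v \<in> Obj" "x \<in> carrier (M u v)" for u v x
    using that by (simp add: gc_simps M_simps)
  have one: "gc_of (M u v) \<one>\<^bsub>M u v\<^esub> = \<one>\<^bsub>group_completion (M u v)\<^esub>"
    if "u \<in> Obj" "v \<in> Obj" for u v
    using that by (simp add: gc_simps M_simps)
  have sum: "gc_of (M p p) (T p a p i r) \<otimes>\<^bsub>group_completion (M p p)\<^esub> gc_of (M p p) (T p b p j s) =
      gc_of (M p p) (e p)"
    using ob mor by (simp add: gc_simps M_simps eqs(5)[symmetric])
  show "is_product completion a b p (gc_of (M p a) r) (gc_of (M p b) s)"
    by (rule preadditive_biproduct(1)[OF preadditive_completion,
          where i = "gc_of (M a p) i" and j = "gc_of (M b p) j"])
      (simp_all add: ob mor cmp eqs sum closed one M_simps)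
  show "is_coproduct completion a b p (gc_of (M a p) i) (gc_of (M b p) j)"
    by (rule preadditive_biproduct(2)[OF preadditive_completion,
          where r = "gc_of (M p a) r" and s = "gc_of (M p b) s"])
      (simp_all add: ob mor cmp eqs sum closed one M_simps)
qed

text \<open>Over a trivial monoid there is only one formal difference.\<close>

lemma (in monoid_enriched) zero_object_completion:
  assumes "z \<in> Obj"
    and "\<And>a. a \<in> Obj \<Longrightarrow> carrier (M z a) = {\<one>\<^bsub>M z a\<^esub>}" "\<And>a. a \<in> Obj \<Longrightarrow> carrier (M a z) = {\<one>\<^bsub>M a z\<^esub>}"
  shows "zero_object completion z"
  using assms
  by (auto simp: zero_object_def comm_monoid.carrier_group_completion[OF comm_monoid])

section \<open>Bi-sets\<close>

lemma bicat_simps [simp]: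
  "Ob (bicat H G) = Ob H \<times> Ob G"
  "Hom (bicat H G) (\<eta>, \<gamma>) (\<eta>', \<gamma>') = Hom H \<eta>' \<eta> \<times> Hom G \<gamma> \<gamma>'"
  "Cmp (bicat H G) (\<eta>, \<gamma>) (\<eta>', \<gamma>') (\<eta>'', \<gamma>'') (h', g') (h, g) =
    (Cmp H \<eta>'' \<eta>' \<eta> h h', Cmp G \<gamma> \<gamma>' \<gamma>'' g' g)"
  "Idn (bicat H G) (\<eta>, \<gamma>) = (Idn H \<eta>, Idn G \<gamma>)"
  by (simp_all add: prod_cat_def op_cat_def)

lemma groupoid_id: "groupoid G \<Longrightarrow> a \<in> Ob G \<Longrightarrow> Idn G a \<in> Hom G a a"
  by (simp add: groupoid_def category_def)

lemma groupoid_comp: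
  "groupoid G \<Longrightarrow> a \<in> Ob G \<Longrightarrow> b \<in> Ob G \<Longrightarrow> c \<in> Ob G \<Longrightarrow> f \<in> Hom G a b \<Longrightarrow> g \<in> Hom G b c \<Longrightarrow>
    Cmp G a b c g f \<in> Hom G a c"
  by (simp add: groupoid_def category_def)

lemma groupoid_id_right: "groupoid G \<Longrightarrow> a \<in> Ob G \<Longrightarrow> b \<in> Ob G \<Longrightarrow> f \<in> Hom G a b \<Longrightarrow> Cmp G a a b f (Idn G a) = f"
  and groupoid_id_left: "groupoid G \<Longrightarrow> a \<in> Ob G \<Longrightarrow> b \<in> Ob G \<Longrightarrow> f \<in> Hom G a b \<Longrightarrow> Cmp G a b b (Idn G b) f = f"
  by (simp_all add: groupoid_def category_def)

lemma groupoid_assoc: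
  "groupoid G \<Longrightarrow> a \<in> Ob G \<Longrightarrow> b \<in> Ob G \<Longrightarrow> c \<in> Ob G \<Longrightarrow> d \<in> Ob G \<Longrightarrow>
    f \<in> Hom G a b \<Longrightarrow> g \<in> Hom G b c \<Longrightarrow> h \<in> Hom G c d \<Longrightarrow>
    Cmp G a c d h (Cmp G a b c g f) = Cmp G a b d (Cmp G b c d h g) f"
  by (simp add: groupoid_def category_def)

lemma groupoid_inverse:
  assumes "groupoid G" "a \<in> Ob G" "b \<in> Ob G" "f \<in> Hom G a b"
  obtains g where "g \<in> Hom G b a" "Cmp G a b a g f = Idn G a" "Cmp G b a b f g = Idn G b"
  using assms unfolding groupoid_def by blast

lemmas groupoid_simps = groupoid_id groupoid_comp groupoid_id_right groupoid_id_left

section \<open>Natural isomorphisms of set-valued functors\<close>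

lemma nat_isoE:
  assumes "nat_iso C X Y"
  obtains t where "\<And>a. a \<in> Ob C \<Longrightarrow> bij_betw (t a) (FOb X a) (FOb Y a)"
    and "\<And>a b f x. a \<in> Ob C \<Longrightarrow> b \<in> Ob C \<Longrightarrow> f \<in> Hom C a b \<Longrightarrow> x \<in> FOb X a \<Longrightarrow>
      t b (FAr X a b f x) = FAr Y a b f (t a x)"
proof -
  from assms[unfolded nat_iso_def] obtain t where
    "(\<forall>a\<in>Ob C. bij_betw (t a) (FOb X a) (FOb Y a)) \<and>
     (\<forall>a\<in>Ob C. \<forall>b\<in>Ob C. \<forall>f\<in>Hom C a b. \<forall>x\<in>FOb X a. t b (FAr X a b f x) = FAr Y a b f (t a x))" ..
  then show thesis
    by (intro that[of t]) simp_all
qed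

text \<open>About the action on \<open>Y\<close> only naturality is known: each element of
  \<open>Y\<close> is some \<open>t a x\<close>, where naturality read backwards moves the inverse
  past the action. For this the action on \<open>X\<close> has to stay inside
  \<open>X\<close>.\<close>

lemma nat_iso_sym:
  assumes "nat_iso C X Y"
    and closed: "\<And>a b f x. a \<in> Ob C \<Longrightarrow> b \<in> Ob C \<Longrightarrow> f \<in> Hom C a b \<Longrightarrow> x \<in> FOb X a \<Longrightarrow> FAr X a b f x \<in> FOb X b"
  shows "nat_iso C Y X"
proof -
  from assms(1) obtain t where bij: "\<And>a. a \<in> Ob C \<Longrightarrow> bij_betw (t a) (FOb X a) (FOb Y a)"
    and nat: "\<And>a b f x. a \<in> Ob C \<Longrightarrow> b \<in> Ob C \<Longrightarrow> f \<in> Hom C a b \<Longrightarrow> x \<in> FOb X a \<Longrightarrow>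
      t b (FAr X a b f x) = FAr Y a b f (t a x)"
    by (rule nat_isoE) blast
  let ?s = "\<lambda>a. inv_into (FOb X a) (t a)"
  have "?s b (FAr Y a b f y) = FAr X a b f (?s a y)"
    if "a \<in> Ob C" "b \<in> Ob C" "f \<in> Hom C a b" "y \<in> FOb Y a" for a b f y
  proof -
    from bij[OF that(1)] that(4) have "y \<in> t a ` FOb X a"
      by (simp add: bij_betw_def)
    then obtain x where x: "x \<in> FOb X a" "y = t a x"
      by blast
    show ?thesis
      using that x bij[OF that(1)] bij[OF that(2)]
      by (simp add: nat[symmetric] bij_betw_def closed)
  qed
  with bij show ?thesis
    by (auto simp: nat_iso_def bij_betw_inv_into intro!: exI[of _ ?s])
qed

lemma nat_iso_trans:
  assumes "nat_iso C X Y" "nat_iso C Y Z"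
  shows "nat_iso C X Z"
proof -
  from assms(1) obtain s where s: "\<And>a. a \<in> Ob C \<Longrightarrow> bij_betw (s a) (FOb X a) (FOb Y a)"
    "\<And>a b f x. a \<in> Ob C \<Longrightarrow> b \<in> Ob C \<Longrightarrow> f \<in> Hom C a b \<Longrightarrow> x \<in> FOb X a \<Longrightarrow>
      s b (FAr X a b f x) = FAr Y a b f (s a x)"
    by (rule nat_isoE) blast
  from assms(2) obtain t where t: "\<And>a. a \<in> Ob C \<Longrightarrow> bij_betw (t a) (FOb Y a) (FOb Z a)"
    "\<And>a b f x. a \<in> Ob C \<Longrightarrow> b \<in> Ob C \<Longrightarrow> f \<in> Hom C a b \<Longrightarrow> x \<in> FOb Y a \<Longrightarrow>
      t b (FAr Y a b f x) = FAr Z a b f (t a x)"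
    by (rule nat_isoE) blast
  have "s a x \<in> FOb Y a" if "a \<in> Ob C" "x \<in> FOb X a" for a x
    using s(1) that by (auto simp: bij_betw_def)
  with s t show ?thesis
    unfolding nat_iso_def
    by (intro exI[of _ "\<lambda>a. t a \<circ> s a"]) (simp add: bij_betw_trans[OF s(1) t(1)])
qed

text \<open>Two quotients of one family \<open>S\<close> with the same kernel are isomorphic by
  \<open>p a s\<close> \<mapsto> \<open>q a s\<close>. The family carries no action of its own; it
  is enough that the results of acting on both sides have a common representative
  \<open>s'\<close>.\<close>

lemma nat_iso_span:
  assumes p: "\<And>a. a \<in> Ob C \<Longrightarrow> p a ` S a = FOb X a" and q: "\<And>a. a \<in> Ob C \<Longrightarrow> q a ` S a = FOb Y a"
    and ker: "\<And>a s t. a \<in> Ob C \<Longrightarrow> s \<in> S a \<Longrightarrow> t \<in> S a \<Longrightarrow> p a s = p a t \<longleftrightarrow> q a s = q a t"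
    and act: "\<And>a b f s. a \<in> Ob C \<Longrightarrow> b \<in> Ob C \<Longrightarrow> f \<in> Hom C a b \<Longrightarrow> s \<in> S a \<Longrightarrow>
      \<exists>s'\<in>S b. FAr X a b f (p a s) = p b s' \<and> FAr Y a b f (q a s) = q b s'"
  shows "nat_iso C X Y"
proof -
  \<comment> \<open>A preimage is chosen; since \<open>p\<close> and \<open>q\<close> have the same
    kernel, the value of \<open>q\<close> does not depend on the choice.\<close>
  define t where "t a x = q a (SOME s. s \<in> S a \<and> p a s = x)" for a x
  have t: "t a (p a s) = q a s" if "a \<in> Ob C" "s \<in> S a" for a s
  proof -
    have "(SOME s'. s' \<in> S a \<and> p a s' = p a s) \<in> S a \<and> p a (SOME s'. s' \<in> S a \<and> p a s' = p a s) = p a s"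
      using that by (intro someI[of "\<lambda>s'. s' \<in> S a \<and> p a s' = p a s" s]) simp
    with that ker[of a "SOME s'. s' \<in> S a \<and> p a s' = p a s" s] show ?thesis
      by (simp add: t_def)
  qed
  show ?thesis
    unfolding nat_iso_def
  proof (intro exI conjI ballI)
    fix a assume a: "a \<in> Ob C"
    have "inj_on (t a) (FOb X a)"
      using a t ker by (auto simp: p[OF a, symmetric] inj_on_def)
    moreover have "t a ` FOb X a = FOb Y a"
      using a t by (auto simp: p[OF a, symmetric] q[OF a, symmetric] image_iff)
    ultimately show "bij_betw (t a) (FOb X a) (FOb Y a)"
      by (simp add: bij_betw_def)
  next
    fix a b f x assume *: "a \<in> Ob C" "b \<in> Ob C" "f \<in> Hom C a b" "x \<in> FOb X a"
    then obtain s where s: "s \<in> S a" "x = p a s"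
      using p by blast
    from act[OF *(1-3) s(1)] show "t b (FAr X a b f x) = FAr Y a b f (t a x)"
      using * s t by auto
  qed
qed

text \<open>Colimits and tensor products are quotients by a generated equivalence. Over a groupoid
  the generating relation is already symmetric and transitive, so only the diagonal is
  added.\<close>

lemma rtrancl_Un_converse:
  assumes "sym r" "trans r"
  shows "(r \<union> r\<inverse>)\<^sup>* = r\<^sup>="
  using assms by (simp add: sym_conv_converse_eq trancl_id flip: reflcl_trancl)

section \<open>Orbits and finite generation\<close>

definition orbit_rel :: "('o, 'a) cat \<Rightarrow> ('o, 'a, 'x) set_fun \<Rightarrow> (('o \<times> 'x) \<times> ('o \<times> 'x)) set" where
  "orbit_rel G X = {((a, x), (b, FAr X a b f x)) | a b f x.
     a \<in> Ob G \<and> b \<in> Ob G \<and> f \<in> Hom G a b \<and> x \<in> FOb X a}"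

text \<open>Over a groupoid the colimit is the set of orbits. One element from each orbit gives
  generators, and conversely every orbit is the class of a generator. In this form finiteness passes
  to sums and tensor products and bounds the size of bi-sets.\<close>

lemma fin_gen_iff:
  assumes G: "groupoid G" and X: "set_functor G X"
  shows "fin_gen G X \<longleftrightarrow> (\<exists>F. finite F \<and> F \<subseteq> Sigma (Ob G) (FOb X) \<and>
    (\<forall>b\<in>Ob G. \<forall>y\<in>FOb X b. \<exists>(a, x)\<in>F. \<exists>g\<in>Hom G a b. y = FAr X a b g x))"
    (is "_ \<longleftrightarrow> ?R")
proof -
  have closed: "FAr X a b f x \<in> FOb X b" if "a \<in> Ob G" "b \<in> Ob G" "f \<in> Hom G a b" "x \<in> FOb X a" for a b f x
    using X that by (auto simp: set_functor_def)
  have comp: "FAr X a c (Cmp G a b c g f) x = FAr X b c g (FAr X a b f x)"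
    if "a \<in> Ob G" "b \<in> Ob G" "c \<in> Ob G" "f \<in> Hom G a b" "g \<in> Hom G b c" "x \<in> FOb X a" for a b c f g x
    using X that by (auto simp: set_functor_def)
  have idn: "FAr X a a (Idn G a) x = x" if "a \<in> Ob G" "x \<in> FOb X a" for a x
    using X that by (auto simp: set_functor_def)
  let ?r = "orbit_rel G X" and ?S = "Sigma (Ob G) (FOb X)"
  have sym: "sym ?r"
  proof (rule symI)
    fix u v assume "(u, v) \<in> ?r"
    then obtain a b f x where *: "u = (a, x)" "v = (b, FAr X a b f x)"
      "a \<in> Ob G" "b \<in> Ob G" "f \<in> Hom G a b" "x \<in> FOb X a"
      by (auto simp: orbit_rel_def)
    obtain g where g: "g \<in> Hom G b a" "Cmp G a b a g f = Idn G a"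
      using groupoid_inverse[OF G *(3-5)] .
    have "x = FAr X b a g (FAr X a b f x)"
      using * g by (simp add: comp[symmetric] idn)
    with * g show "(v, u) \<in> ?r"
      unfolding orbit_rel_def using closed by blast
  qed
  have trans: "trans ?r"
  proof (rule transI)
    fix u v w assume "(u, v) \<in> ?r" "(v, w) \<in> ?r"
    then obtain a b c f g x where *: "u = (a, x)" "w = (c, FAr X b c g (FAr X a b f x))"
      "a \<in> Ob G" "b \<in> Ob G" "c \<in> Ob G" "f \<in> Hom G a b" "g \<in> Hom G b c" "x \<in> FOb X a"
      by (auto simp: orbit_rel_def)
    then have "w = (c, FAr X a c (Cmp G a b c g f) x)" "Cmp G a b c g f \<in> Hom G a c"
      by (simp_all add: comp groupoid_comp[OF G])
    with * show "(u, w) \<in> ?r"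
      unfolding orbit_rel_def by blast
  qed
  have colim: "colim G X = ?S // ?r\<^sup>="
    using rtrancl_Un_converse[OF sym trans] by (simp add: colim_def orbit_rel_def Let_def)
  have eq: "?r\<^sup>= `` {u} = ?r\<^sup>= `` {v}" if "(u, v) \<in> ?r" for u v
    using sym trans that by (auto dest: symD transD)
  show ?thesis
  proof
    assume "fin_gen G X"
    then have fin: "finite (colim G X)"
      by (simp add: fin_gen_def)
    define F where "F = (\<lambda>c. SOME p. p \<in> c \<and> p \<in> ?S) ` colim G X"
    have mem: "(SOME p. p \<in> ?r\<^sup>= `` {u} \<and> p \<in> ?S) \<in> ?r\<^sup>= `` {u} \<inter> ?S" if "u \<in> ?S" for u
      using someI[of "\<lambda>p. p \<in> ?r\<^sup>= `` {u} \<and> p \<in> ?S" u] that by auto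
    have "F \<subseteq> ?S"
      using mem unfolding F_def colim quotient_def by blast
    moreover have "\<exists>(a, x)\<in>F. \<exists>g\<in>Hom G a b. y = FAr X a b g x" if b: "b \<in> Ob G" and y: "y \<in> FOb X b" for b y
    proof -
      define p where "p = (SOME p. p \<in> ?r\<^sup>= `` {(b, y)} \<and> p \<in> ?S)"
      have "p \<in> F"
        unfolding F_def p_def colim using b y by (intro imageI quotientI) auto
      moreover have "((b, y), p) \<in> ?r\<^sup>=" "p \<in> ?S"
        using mem[of "(b, y)"] b y by (auto simp: p_def)
      then have "(p, (b, y)) \<in> ?r \<or> p = (b, y)"
        using sym by (auto dest: symD)
      then have "\<exists>g\<in>Hom G (fst p) b. y = FAr X (fst p) b g (snd p)"
      proof
        assume "(p, (b, y)) \<in> ?r"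
        then show ?thesis
          by (auto simp: orbit_rel_def)
      next
        assume "p = (b, y)"
        with idn[OF b y] groupoid_id[OF G b] show ?thesis
          by (auto intro!: bexI[of _ "Idn G b"])
      qed
      ultimately show ?thesis
        by (auto intro!: bexI[of _ p] split: prod.splits)
    qed
    moreover have "finite F"
      by (simp add: F_def fin)
    ultimately show ?R
      by (intro exI[of _ F] conjI ballI)
  next
    assume ?R
    then obtain F where F: "finite F" "F \<subseteq> ?S"
      and gen: "\<forall>b\<in>Ob G. \<forall>y\<in>FOb X b. \<exists>(a, x)\<in>F. \<exists>g\<in>Hom G a b. y = FAr X a b g x"
      by (elim exE conjE)
    have "colim G X \<subseteq> (\<lambda>p. ?r\<^sup>= `` {p}) ` F"
    proof
      fix c assume "c \<in> colim G X"
      then obtain b y where *: "b \<in> Ob G" "y \<in> FOb X b" "c = ?r\<^sup>= `` {(b, y)}"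
        by (auto simp: colim elim!: quotientE)
      with gen obtain a x g where "(a, x) \<in> F" "g \<in> Hom G a b" "y = FAr X a b g x"
        by blast
      moreover from this * F have "((a, x), (b, y)) \<in> ?r"
        by (auto simp: orbit_rel_def)
      then have "c = ?r\<^sup>= `` {(a, x)}"
        using eq *(3) by simp
      ultimately show "c \<in> (\<lambda>p. ?r\<^sup>= `` {p}) ` F"
        by blast
    qed
    with F show "fin_gen G X"
      by (simp add: fin_gen_def finite_subset)
  qed
qed

text \<open>In \<open>ract G X \<gamma> \<eta> \<eta>' h x\<close> the arrow \<open>h\<close> runs from \<open>\<eta>'\<close> to \<open>\<eta>\<close>.\<close>

definition lact :: "('h, 'hm) cat \<Rightarrow> ('h, 'hm, 'g, 'gm, 'x) biset \<Rightarrow> 'h \<Rightarrow> 'g \<Rightarrow> 'g \<Rightarrow> 'gm \<Rightarrow> 'x \<Rightarrow> 'x" where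
  "lact H X \<eta> \<gamma> \<gamma>' g x = FAr X (\<eta>, \<gamma>) (\<eta>, \<gamma>') (Idn H \<eta>, g) x"

definition ract :: "('g, 'gm) cat \<Rightarrow> ('h, 'hm, 'g, 'gm, 'x) biset \<Rightarrow> 'g \<Rightarrow> 'h \<Rightarrow> 'h \<Rightarrow> 'hm \<Rightarrow> 'x \<Rightarrow> 'x" where
  "ract G X \<gamma> \<eta> \<eta>' h x = FAr X (\<eta>, \<gamma>) (\<eta>', \<gamma>) (h, Idn G \<gamma>) x"

section \<open>Bi-sets as sets with two commuting actions\<close>

locale biset =
  fixes H :: "('h, 'hm) cat" and G :: "('g, 'gm) cat" and X :: "('h, 'hm, 'g, 'gm, 'x) biset"
  assumes groupoid_source: "groupoid H" and groupoid_target: "groupoid G"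
    and set_functor: "set_functor (bicat H G) X"
begin

lemma FAr_closed:
  assumes "\<eta> \<in> Ob H" "\<eta>' \<in> Ob H" "\<gamma> \<in> Ob G" "\<gamma>' \<in> Ob G" "h \<in> Hom H \<eta>' \<eta>" "g \<in> Hom G \<gamma> \<gamma>'"
    "x \<in> FOb X (\<eta>, \<gamma>)"
  shows "FAr X (\<eta>, \<gamma>) (\<eta>', \<gamma>') (h, g) x \<in> FOb X (\<eta>', \<gamma>')"
proof -
  have "\<forall>a\<in>Ob (bicat H G). \<forall>b\<in>Ob (bicat H G). \<forall>f\<in>Hom (bicat H G) a b. FAr X a b f \<in> FOb X a \<rightarrow> FOb X b"
    using set_functor unfolding set_functor_def by (elim conjE)
  from this[rule_format, of "(\<eta>, \<gamma>)" "(\<eta>', \<gamma>')" "(h, g)"] assms show ?thesis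
    by auto
qed

lemma FAr_id: "\<eta> \<in> Ob H \<Longrightarrow> \<gamma> \<in> Ob G \<Longrightarrow> x \<in> FOb X (\<eta>, \<gamma>) \<Longrightarrow>
    FAr X (\<eta>, \<gamma>) (\<eta>, \<gamma>) (Idn H \<eta>, Idn G \<gamma>) x = x"
  using set_functor by (auto simp: set_functor_def)

lemma FAr_comp:
  assumes "\<eta> \<in> Ob H" "\<eta>' \<in> Ob H" "\<eta>'' \<in> Ob H" "\<gamma> \<in> Ob G" "\<gamma>' \<in> Ob G" "\<gamma>'' \<in> Ob G"
    "h \<in> Hom H \<eta>' \<eta>" "h' \<in> Hom H \<eta>'' \<eta>'" "g \<in> Hom G \<gamma> \<gamma>'" "g' \<in> Hom G \<gamma>' \<gamma>''" "x \<in> FOb X (\<eta>, \<gamma>)"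
  shows "FAr X (\<eta>', \<gamma>') (\<eta>'', \<gamma>'') (h', g') (FAr X (\<eta>, \<gamma>) (\<eta>', \<gamma>') (h, g) x) =
    FAr X (\<eta>, \<gamma>) (\<eta>'', \<gamma>'') (Cmp H \<eta>'' \<eta>' \<eta> h h', Cmp G \<gamma> \<gamma>' \<gamma>'' g' g) x"
proof -
  have "\<forall>a\<in>Ob (bicat H G). \<forall>b\<in>Ob (bicat H G). \<forall>c\<in>Ob (bicat H G).
      \<forall>f\<in>Hom (bicat H G) a b. \<forall>g\<in>Hom (bicat H G) b c. \<forall>x\<in>FOb X a.
       FAr X a c (Cmp (bicat H G) a b c g f) x = FAr X b c g (FAr X a b f x)"
    using set_functor unfolding set_functor_def by (elim conjE)
  from this[rule_format, of "(\<eta>, \<gamma>)" "(\<eta>', \<gamma>')" "(\<eta>'', \<gamma>'')" "(h, g)" "(h', g')" x] assms show ?thesis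
    by simp
qed

lemmas grpd_simps =
  groupoid_simps[OF groupoid_source] groupoid_simps[OF groupoid_target]

lemma lact_closed: "\<eta> \<in> Ob H \<Longrightarrow> \<gamma> \<in> Ob G \<Longrightarrow> \<gamma>' \<in> Ob G \<Longrightarrow> g \<in> Hom G \<gamma> \<gamma>' \<Longrightarrow> x \<in> FOb X (\<eta>, \<gamma>) \<Longrightarrow>
    lact H X \<eta> \<gamma> \<gamma>' g x \<in> FOb X (\<eta>, \<gamma>')"
  by (simp add: lact_def FAr_closed grpd_simps)

lemma ract_closed: "\<eta> \<in> Ob H \<Longrightarrow> \<eta>' \<in> Ob H \<Longrightarrow> \<gamma> \<in> Ob G \<Longrightarrow> h \<in> Hom H \<eta>' \<eta> \<Longrightarrow> x \<in> FOb X (\<eta>, \<gamma>) \<Longrightarrow>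
    ract G X \<gamma> \<eta> \<eta>' h x \<in> FOb X (\<eta>', \<gamma>)"
  by (simp add: ract_def FAr_closed grpd_simps)

lemma lact_id: "\<eta> \<in> Ob H \<Longrightarrow> \<gamma> \<in> Ob G \<Longrightarrow> x \<in> FOb X (\<eta>, \<gamma>) \<Longrightarrow> lact H X \<eta> \<gamma> \<gamma> (Idn G \<gamma>) x = x"
  and ract_id: "\<eta> \<in> Ob H \<Longrightarrow> \<gamma> \<in> Ob G \<Longrightarrow> x \<in> FOb X (\<eta>, \<gamma>) \<Longrightarrow> ract G X \<gamma> \<eta> \<eta> (Idn H \<eta>) x = x"
  by (simp_all add: lact_def ract_def FAr_id)

lemma lact_comp: "\<eta> \<in> Ob H \<Longrightarrow> \<gamma> \<in> Ob G \<Longrightarrow> \<gamma>' \<in> Ob G \<Longrightarrow> \<gamma>'' \<in> Ob G \<Longrightarrow> g \<in> Hom G \<gamma> \<gamma>' \<Longrightarrow>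
    g' \<in> Hom G \<gamma>' \<gamma>'' \<Longrightarrow> x \<in> FOb X (\<eta>, \<gamma>) \<Longrightarrow>
    lact H X \<eta> \<gamma>' \<gamma>'' g' (lact H X \<eta> \<gamma> \<gamma>' g x) = lact H X \<eta> \<gamma> \<gamma>'' (Cmp G \<gamma> \<gamma>' \<gamma>'' g' g) x"
  by (simp add: lact_def FAr_comp grpd_simps)

lemma ract_comp: "\<eta> \<in> Ob H \<Longrightarrow> \<eta>' \<in> Ob H \<Longrightarrow> \<eta>'' \<in> Ob H \<Longrightarrow> \<gamma> \<in> Ob G \<Longrightarrow> h \<in> Hom H \<eta>' \<eta> \<Longrightarrow>
    h' \<in> Hom H \<eta>'' \<eta>' \<Longrightarrow> x \<in> FOb X (\<eta>, \<gamma>) \<Longrightarrow>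
    ract G X \<gamma> \<eta>' \<eta>'' h' (ract G X \<gamma> \<eta> \<eta>' h x) = ract G X \<gamma> \<eta> \<eta>'' (Cmp H \<eta>'' \<eta>' \<eta> h h') x"
  by (simp add: ract_def FAr_comp grpd_simps)

text \<open>The arrow \<open>(h, g)\<close> of \<open>bicat H G\<close> is the composite of
  \<open>(h, 1)\<close> and \<open>(1, g)\<close>, so a bi-set amounts to its two one-sided actions,
  which commute by \<open>lact_ract\<close>.\<close>

lemma FAr_eq_lact_ract:
  "\<eta> \<in> Ob H \<Longrightarrow> \<eta>' \<in> Ob H \<Longrightarrow> \<gamma> \<in> Ob G \<Longrightarrow> \<gamma>' \<in> Ob G \<Longrightarrow> h \<in> Hom H \<eta>' \<eta> \<Longrightarrow> g \<in> Hom G \<gamma> \<gamma>' \<Longrightarrow>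
    x \<in> FOb X (\<eta>, \<gamma>) \<Longrightarrow> FAr X (\<eta>, \<gamma>) (\<eta>', \<gamma>') (h, g) x = lact H X \<eta>' \<gamma> \<gamma>' g (ract G X \<gamma> \<eta> \<eta>' h x)"
  by (simp add: lact_def ract_def FAr_comp grpd_simps)

lemma lact_ract:
  "\<eta> \<in> Ob H \<Longrightarrow> \<eta>' \<in> Ob H \<Longrightarrow> \<gamma> \<in> Ob G \<Longrightarrow> \<gamma>' \<in> Ob G \<Longrightarrow> h \<in> Hom H \<eta>' \<eta> \<Longrightarrow> g \<in> Hom G \<gamma> \<gamma>' \<Longrightarrow>
    x \<in> FOb X (\<eta>, \<gamma>) \<Longrightarrow>
    lact H X \<eta>' \<gamma> \<gamma>' g (ract G X \<gamma> \<eta> \<eta>' h x) = ract G X \<gamma>' \<eta> \<eta>' h (lact H X \<eta> \<gamma> \<gamma>' g x)"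
  by (simp add: lact_def ract_def FAr_comp grpd_simps)

lemmas act_closed = lact_closed ract_closed

lemma set_functor_left_part: "\<eta> \<in> Ob H \<Longrightarrow> set_functor G (left_part H X \<eta>)"
  by (auto simp: set_functor_def left_part_def FAr_closed FAr_id FAr_comp grpd_simps)

definition finitely_generated :: bool where
  "finitely_generated \<longleftrightarrow> (\<forall>\<eta>\<in>Ob H. \<exists>F. finite F \<and> F \<subseteq> (SIGMA \<gamma>:Ob G. FOb X (\<eta>, \<gamma>)) \<and>
    (\<forall>\<gamma>'\<in>Ob G. \<forall>y\<in>FOb X (\<eta>, \<gamma>'). \<exists>(\<gamma>, x)\<in>F. \<exists>g\<in>Hom G \<gamma> \<gamma>'. y = lact H X \<eta> \<gamma> \<gamma>' g x))"

definition free :: bool where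
  "free \<longleftrightarrow> (\<forall>\<eta>\<in>Ob H. \<forall>\<gamma>\<in>Ob G. \<forall>\<gamma>'\<in>Ob G. \<forall>x\<in>FOb X (\<eta>, \<gamma>).
    inj_on (\<lambda>g. lact H X \<eta> \<gamma> \<gamma>' g x) (Hom G \<gamma> \<gamma>'))"

text \<open>From here on admissibility is a statement about elements and \<open>lact\<close>, and
  colimits no longer appear.\<close>

lemma admissible_iff: "admissible H G X \<longleftrightarrow> free \<and> finitely_generated"
proof -
  have "free \<longleftrightarrow> (\<forall>\<eta>\<in>Ob H. free_set G (left_part H X \<eta>))"
    by (simp add: free_def free_set_def left_part_def lact_def)
  moreover have "finitely_generated \<longleftrightarrow> (\<forall>\<eta>\<in>Ob H. fin_gen G (left_part H X \<eta>))"
    unfolding finitely_generated_def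
    by (intro ball_cong refl) (simp add: fin_gen_iff[OF groupoid_target set_functor_left_part],
        simp add: left_part_def lact_def)
  ultimately show ?thesis
    using set_functor by (auto simp: admissible_def)
qed

end

lemma admissible_biset: "groupoid H \<Longrightarrow> groupoid G \<Longrightarrow> admissible H G X \<Longrightarrow> biset H G X"
  by (simp add: biset_def admissible_def)

section \<open>Tensor products\<close>

lemma bisetI:
  assumes "groupoid H" "groupoid G"
    and closed: "\<And>\<eta> \<eta>' \<gamma> \<gamma>' h g x. \<eta> \<in> Ob H \<Longrightarrow> \<eta>' \<in> Ob H \<Longrightarrow> \<gamma> \<in> Ob G \<Longrightarrow> \<gamma>' \<in> Ob G \<Longrightarrow>
      h \<in> Hom H \<eta>' \<eta> \<Longrightarrow> g \<in> Hom G \<gamma> \<gamma>' \<Longrightarrow> x \<in> FOb X (\<eta>, \<gamma>) \<Longrightarrow>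
      FAr X (\<eta>, \<gamma>) (\<eta>', \<gamma>') (h, g) x \<in> FOb X (\<eta>', \<gamma>')"
    and id: "\<And>\<eta> \<gamma> x. \<eta> \<in> Ob H \<Longrightarrow> \<gamma> \<in> Ob G \<Longrightarrow> x \<in> FOb X (\<eta>, \<gamma>) \<Longrightarrow>
      FAr X (\<eta>, \<gamma>) (\<eta>, \<gamma>) (Idn H \<eta>, Idn G \<gamma>) x = x"
    and comp: "\<And>\<eta> \<eta>' \<eta>'' \<gamma> \<gamma>' \<gamma>'' h h' g g' x. \<eta> \<in> Ob H \<Longrightarrow> \<eta>' \<in> Ob H \<Longrightarrow> \<eta>'' \<in> Ob H \<Longrightarrow>
      \<gamma> \<in> Ob G \<Longrightarrow> \<gamma>' \<in> Ob G \<Longrightarrow> \<gamma>'' \<in> Ob G \<Longrightarrow>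
      h \<in> Hom H \<eta>' \<eta> \<Longrightarrow> h' \<in> Hom H \<eta>'' \<eta>' \<Longrightarrow> g \<in> Hom G \<gamma> \<gamma>' \<Longrightarrow> g' \<in> Hom G \<gamma>' \<gamma>'' \<Longrightarrow> x \<in> FOb X (\<eta>, \<gamma>) \<Longrightarrow>
      FAr X (\<eta>, \<gamma>) (\<eta>'', \<gamma>'') (Cmp H \<eta>'' \<eta>' \<eta> h h', Cmp G \<gamma> \<gamma>' \<gamma>'' g' g) x =
      FAr X (\<eta>', \<gamma>') (\<eta>'', \<gamma>'') (h', g') (FAr X (\<eta>, \<gamma>) (\<eta>', \<gamma>') (h, g) x)"
  shows "biset H G X"
proof (rule biset.intro[OF assms(1,2)])
  show "set_functor (bicat H G) X"
    unfolding set_functor_def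
  proof (intro conjI ballI)
    fix a b f assume "a \<in> Ob (bicat H G)" "b \<in> Ob (bicat H G)" "f \<in> Hom (bicat H G) a b"
    then show "FAr X a b f \<in> FOb X a \<rightarrow> FOb X b"
      by (cases a; cases b; cases f) (simp add: closed)
  next
    fix a x assume "a \<in> Ob (bicat H G)" "x \<in> FOb X a"
    then show "FAr X a a (Idn (bicat H G) a) x = x"
      by (cases a) (simp add: id)
  next
    fix a b c f g x assume "a \<in> Ob (bicat H G)" "b \<in> Ob (bicat H G)" "c \<in> Ob (bicat H G)"
      "f \<in> Hom (bicat H G) a b" "g \<in> Hom (bicat H G) b c" "x \<in> FOb X a"
    then show "FAr X a c (Cmp (bicat H G) a b c g f) x = FAr X b c g (FAr X a b f x)"
      by (cases a; cases b; cases c; cases f; cases g) (simp add: comp)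
  qed
qed

lemma nat_iso_bicatI:
  assumes "\<And>\<eta> \<gamma>. \<eta> \<in> Ob H \<Longrightarrow> \<gamma> \<in> Ob G \<Longrightarrow> bij_betw (t \<eta> \<gamma>) (FOb X (\<eta>, \<gamma>)) (FOb Y (\<eta>, \<gamma>))"
    and "\<And>\<eta> \<eta>' \<gamma> \<gamma>' h g x. \<eta> \<in> Ob H \<Longrightarrow> \<eta>' \<in> Ob H \<Longrightarrow> \<gamma> \<in> Ob G \<Longrightarrow> \<gamma>' \<in> Ob G \<Longrightarrow>
      h \<in> Hom H \<eta>' \<eta> \<Longrightarrow> g \<in> Hom G \<gamma> \<gamma>' \<Longrightarrow> x \<in> FOb X (\<eta>, \<gamma>) \<Longrightarrow>
      t \<eta>' \<gamma>' (FAr X (\<eta>, \<gamma>) (\<eta>', \<gamma>') (h, g) x) = FAr Y (\<eta>, \<gamma>) (\<eta>', \<gamma>') (h, g) (t \<eta> \<gamma> x)"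
  shows "nat_iso (bicat H G) X Y"
  unfolding nat_iso_def using assms by (intro exI[of _ "\<lambda>(\<eta>, \<gamma>). t \<eta> \<gamma>"]) auto

lemma nat_iso_bicatE:
  assumes "nat_iso (bicat H G) X Y"
  obtains t where "\<And>\<eta> \<gamma>. \<eta> \<in> Ob H \<Longrightarrow> \<gamma> \<in> Ob G \<Longrightarrow> bij_betw (t \<eta> \<gamma>) (FOb X (\<eta>, \<gamma>)) (FOb Y (\<eta>, \<gamma>))"
    and "\<And>\<eta> \<eta>' \<gamma> \<gamma>' h g x. \<eta> \<in> Ob H \<Longrightarrow> \<eta>' \<in> Ob H \<Longrightarrow> \<gamma> \<in> Ob G \<Longrightarrow> \<gamma>' \<in> Ob G \<Longrightarrow>
      h \<in> Hom H \<eta>' \<eta> \<Longrightarrow> g \<in> Hom G \<gamma> \<gamma>' \<Longrightarrow> x \<in> FOb X (\<eta>, \<gamma>) \<Longrightarrow>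
      t \<eta>' \<gamma>' (FAr X (\<eta>, \<gamma>) (\<eta>', \<gamma>') (h, g) x) = FAr Y (\<eta>, \<gamma>) (\<eta>', \<gamma>') (h, g) (t \<eta> \<gamma> x)"
proof -
  from assms obtain t where *: "\<And>a. a \<in> Ob (bicat H G) \<Longrightarrow> bij_betw (t a) (FOb X a) (FOb Y a)"
    "\<And>a b f x. a \<in> Ob (bicat H G) \<Longrightarrow> b \<in> Ob (bicat H G) \<Longrightarrow> f \<in> Hom (bicat H G) a b \<Longrightarrow> x \<in> FOb X a \<Longrightarrow>
      t b (FAr X a b f x) = FAr Y a b f (t a x)"
    by (rule nat_isoE) blast
  show thesis
    by (rule that[of "\<lambda>\<eta> \<gamma>. t (\<eta>, \<gamma>)"]) (simp_all add: *)
qed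

lemma nat_iso_bicat_span:
  assumes "\<And>\<eta> \<gamma>. \<eta> \<in> Ob H \<Longrightarrow> \<gamma> \<in> Ob G \<Longrightarrow> p \<eta> \<gamma> ` S \<eta> \<gamma> = FOb X (\<eta>, \<gamma>)"
    and "\<And>\<eta> \<gamma>. \<eta> \<in> Ob H \<Longrightarrow> \<gamma> \<in> Ob G \<Longrightarrow> q \<eta> \<gamma> ` S \<eta> \<gamma> = FOb Y (\<eta>, \<gamma>)"
    and "\<And>\<eta> \<gamma> s t. \<eta> \<in> Ob H \<Longrightarrow> \<gamma> \<in> Ob G \<Longrightarrow> s \<in> S \<eta> \<gamma> \<Longrightarrow> t \<in> S \<eta> \<gamma> \<Longrightarrow>
      p \<eta> \<gamma> s = p \<eta> \<gamma> t \<longleftrightarrow> q \<eta> \<gamma> s = q \<eta> \<gamma> t"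
    and "\<And>\<eta> \<eta>' \<gamma> \<gamma>' h g s. \<eta> \<in> Ob H \<Longrightarrow> \<eta>' \<in> Ob H \<Longrightarrow> \<gamma> \<in> Ob G \<Longrightarrow> \<gamma>' \<in> Ob G \<Longrightarrow>
      h \<in> Hom H \<eta>' \<eta> \<Longrightarrow> g \<in> Hom G \<gamma> \<gamma>' \<Longrightarrow> s \<in> S \<eta> \<gamma> \<Longrightarrow>
      \<exists>s'\<in>S \<eta>' \<gamma>'. FAr X (\<eta>, \<gamma>) (\<eta>', \<gamma>') (h, g) (p \<eta> \<gamma> s) = p \<eta>' \<gamma>' s' \<and>
        FAr Y (\<eta>, \<gamma>) (\<eta>', \<gamma>') (h, g) (q \<eta> \<gamma> s) = q \<eta>' \<gamma>' s'"
  shows "nat_iso (bicat H G) X Y"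
  by (rule nat_iso_span[where S = "\<lambda>(\<eta>, \<gamma>). S \<eta> \<gamma>" and p = "\<lambda>(\<eta>, \<gamma>). p \<eta> \<gamma>" and q = "\<lambda>(\<eta>, \<gamma>). q \<eta> \<gamma>"])
    (auto simp: assms(3,4) simp flip: assms(1,2))

text \<open>The element type of \<open>W\<close> is free: the quotient itself, a hom bi-set with
  composition as \<open>m\<close>, \<open>Y\<close> with its action as \<open>m\<close>, or a
  disjoint union can be a model of the tensor product. That \<open>W\<close> is a bi-set is derived
  in \<open>biset_tensor\<close>, by computing on the elements
  \<open>m \<kappa> \<gamma> \<eta> x y\<close>.\<close>

locale tensor_product = X: biset H G X + Y: biset K H Y
  for K :: "('k, 'km) cat" and H :: "('h, 'hm) cat" and G :: "('g, 'gm) cat"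
    and X :: "('h, 'hm, 'g, 'gm, 'x) biset" and Y :: "('k, 'km, 'h, 'hm, 'y) biset" +
  fixes W :: "('k, 'km, 'g, 'gm, 'w) biset" and m :: "'k \<Rightarrow> 'g \<Rightarrow> 'h \<Rightarrow> 'x \<Rightarrow> 'y \<Rightarrow> 'w"
  assumes m_closed: "\<kappa> \<in> Ob K \<Longrightarrow> \<gamma> \<in> Ob G \<Longrightarrow> \<eta> \<in> Ob H \<Longrightarrow> x \<in> FOb X (\<eta>, \<gamma>) \<Longrightarrow> y \<in> FOb Y (\<kappa>, \<eta>) \<Longrightarrow>
      m \<kappa> \<gamma> \<eta> x y \<in> FOb W (\<kappa>, \<gamma>)"
    and surj: "\<kappa> \<in> Ob K \<Longrightarrow> \<gamma> \<in> Ob G \<Longrightarrow> w \<in> FOb W (\<kappa>, \<gamma>) \<Longrightarrow>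
      \<exists>\<eta>\<in>Ob H. \<exists>x\<in>FOb X (\<eta>, \<gamma>). \<exists>y\<in>FOb Y (\<kappa>, \<eta>). w = m \<kappa> \<gamma> \<eta> x y"
    and m_eq_iff: "\<kappa> \<in> Ob K \<Longrightarrow> \<gamma> \<in> Ob G \<Longrightarrow> \<eta> \<in> Ob H \<Longrightarrow> \<eta>' \<in> Ob H \<Longrightarrow> x \<in> FOb X (\<eta>, \<gamma>) \<Longrightarrow>
      y \<in> FOb Y (\<kappa>, \<eta>) \<Longrightarrow> x' \<in> FOb X (\<eta>', \<gamma>) \<Longrightarrow> y' \<in> FOb Y (\<kappa>, \<eta>') \<Longrightarrow>
      m \<kappa> \<gamma> \<eta> x y = m \<kappa> \<gamma> \<eta>' x' y' \<longleftrightarrow>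
      (\<exists>h\<in>Hom H \<eta> \<eta>'. x = ract G X \<gamma> \<eta>' \<eta> h x' \<and> y' = lact K Y \<kappa> \<eta> \<eta>' h y)"
    and FAr_m: "\<kappa> \<in> Ob K \<Longrightarrow> \<kappa>' \<in> Ob K \<Longrightarrow> \<gamma> \<in> Ob G \<Longrightarrow> \<gamma>' \<in> Ob G \<Longrightarrow> k \<in> Hom K \<kappa>' \<kappa> \<Longrightarrow> g \<in> Hom G \<gamma> \<gamma>' \<Longrightarrow>
      \<eta> \<in> Ob H \<Longrightarrow> x \<in> FOb X (\<eta>, \<gamma>) \<Longrightarrow> y \<in> FOb Y (\<kappa>, \<eta>) \<Longrightarrow>
      FAr W (\<kappa>, \<gamma>) (\<kappa>', \<gamma>') (k, g) (m \<kappa> \<gamma> \<eta> x y) =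
      m \<kappa>' \<gamma>' \<eta> (lact H X \<eta> \<gamma> \<gamma>' g x) (ract H Y \<eta> \<kappa> \<kappa>' k y)"
begin

lemma tensorE:
  assumes "\<kappa> \<in> Ob K" "\<gamma> \<in> Ob G" "w \<in> FOb W (\<kappa>, \<gamma>)"
  obtains \<eta> x y where "\<eta> \<in> Ob H" "x \<in> FOb X (\<eta>, \<gamma>)" "y \<in> FOb Y (\<kappa>, \<eta>)" "w = m \<kappa> \<gamma> \<eta> x y"
  using surj[OF assms] by blast

lemma biset_tensor: "biset K G W"
proof (rule bisetI[OF Y.groupoid_source X.groupoid_target])
  fix \<kappa> \<kappa>' \<gamma> \<gamma>' k g w assume *: "\<kappa> \<in> Ob K" "\<kappa>' \<in> Ob K" "\<gamma> \<in> Ob G" "\<gamma>' \<in> Ob G" "k \<in> Hom K \<kappa>' \<kappa>"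
    "g \<in> Hom G \<gamma> \<gamma>'" "w \<in> FOb W (\<kappa>, \<gamma>)"
  from *(1,3,7) obtain \<eta> x y where "\<eta> \<in> Ob H" "x \<in> FOb X (\<eta>, \<gamma>)" "y \<in> FOb Y (\<kappa>, \<eta>)" "w = m \<kappa> \<gamma> \<eta> x y"
    by (rule tensorE)
  with * show "FAr W (\<kappa>, \<gamma>) (\<kappa>', \<gamma>') (k, g) w \<in> FOb W (\<kappa>', \<gamma>')"
    by (simp add: FAr_m m_closed X.act_closed Y.act_closed)
next
  fix \<kappa> \<gamma> w assume *: "\<kappa> \<in> Ob K" "\<gamma> \<in> Ob G" "w \<in> FOb W (\<kappa>, \<gamma>)"
  then obtain \<eta> x y where "\<eta> \<in> Ob H" "x \<in> FOb X (\<eta>, \<gamma>)" "y \<in> FOb Y (\<kappa>, \<eta>)" "w = m \<kappa> \<gamma> \<eta> x y"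
    by (rule tensorE)
  with * show "FAr W (\<kappa>, \<gamma>) (\<kappa>, \<gamma>) (Idn K \<kappa>, Idn G \<gamma>) w = w"
    by (simp add: FAr_m X.lact_id Y.ract_id X.grpd_simps Y.grpd_simps)
next
  fix \<kappa> \<kappa>' \<kappa>'' \<gamma> \<gamma>' \<gamma>'' k k' g g' w
  assume *: "\<kappa> \<in> Ob K" "\<kappa>' \<in> Ob K" "\<kappa>'' \<in> Ob K" "\<gamma> \<in> Ob G" "\<gamma>' \<in> Ob G" "\<gamma>'' \<in> Ob G"
    "k \<in> Hom K \<kappa>' \<kappa>" "k' \<in> Hom K \<kappa>'' \<kappa>'" "g \<in> Hom G \<gamma> \<gamma>'" "g' \<in> Hom G \<gamma>' \<gamma>''" "w \<in> FOb W (\<kappa>, \<gamma>)"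
  from *(1,4,11) obtain \<eta> x y where "\<eta> \<in> Ob H" "x \<in> FOb X (\<eta>, \<gamma>)" "y \<in> FOb Y (\<kappa>, \<eta>)" "w = m \<kappa> \<gamma> \<eta> x y"
    by (rule tensorE)
  with * show "FAr W (\<kappa>, \<gamma>) (\<kappa>'', \<gamma>'') (Cmp K \<kappa>'' \<kappa>' \<kappa> k k', Cmp G \<gamma> \<gamma>' \<gamma>'' g' g) w =
      FAr W (\<kappa>', \<gamma>') (\<kappa>'', \<gamma>'') (k', g') (FAr W (\<kappa>, \<gamma>) (\<kappa>', \<gamma>') (k, g) w)"
    by (simp add: FAr_m X.lact_comp Y.ract_comp X.act_closed Y.act_closed X.grpd_simps Y.grpd_simps)
qed

sublocale W: biset K G W
  by (rule biset_tensor)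

lemma lact_m:
  "\<kappa> \<in> Ob K \<Longrightarrow> \<gamma> \<in> Ob G \<Longrightarrow> \<gamma>' \<in> Ob G \<Longrightarrow> g \<in> Hom G \<gamma> \<gamma>' \<Longrightarrow> \<eta> \<in> Ob H \<Longrightarrow> x \<in> FOb X (\<eta>, \<gamma>) \<Longrightarrow> y \<in> FOb Y (\<kappa>, \<eta>) \<Longrightarrow>
    lact K W \<kappa> \<gamma> \<gamma>' g (m \<kappa> \<gamma> \<eta> x y) = m \<kappa> \<gamma>' \<eta> (lact H X \<eta> \<gamma> \<gamma>' g x) y"
  by (simp add: lact_def[of K] FAr_m Y.ract_id Y.grpd_simps)

lemma ract_m:
  "\<kappa> \<in> Ob K \<Longrightarrow> \<kappa>' \<in> Ob K \<Longrightarrow> \<gamma> \<in> Ob G \<Longrightarrow> k \<in> Hom K \<kappa>' \<kappa> \<Longrightarrow> \<eta> \<in> Ob H \<Longrightarrow> x \<in> FOb X (\<eta>, \<gamma>) \<Longrightarrow> y \<in> FOb Y (\<kappa>, \<eta>) \<Longrightarrow>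
    ract G W \<gamma> \<kappa> \<kappa>' k (m \<kappa> \<gamma> \<eta> x y) = m \<kappa>' \<gamma> \<eta> x (ract H Y \<eta> \<kappa> \<kappa>' k y)"
  by (simp add: ract_def[of G] FAr_m X.lact_id X.grpd_simps)

text \<open>The kernel condition with \<open>h\<close> itself as the witness.\<close>

lemma balanced:
  "\<kappa> \<in> Ob K \<Longrightarrow> \<gamma> \<in> Ob G \<Longrightarrow> \<eta> \<in> Ob H \<Longrightarrow> \<eta>' \<in> Ob H \<Longrightarrow> h \<in> Hom H \<eta> \<eta>' \<Longrightarrow> x \<in> FOb X (\<eta>', \<gamma>) \<Longrightarrow> y \<in> FOb Y (\<kappa>, \<eta>) \<Longrightarrow>
    m \<kappa> \<gamma> \<eta> (ract G X \<gamma> \<eta>' \<eta> h x) y = m \<kappa> \<gamma> \<eta>' x (lact K Y \<kappa> \<eta> \<eta>' h y)"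
  by (subst m_eq_iff) (auto simp: X.act_closed Y.act_closed)

text \<open>If \<open>g (x \<otimes> y) = g' (x \<otimes> y)\<close>, the kernel gives
  \<open>h\<close> with \<open>y = h y\<close> and \<open>g x = (g' x) h\<close>. Freeness of
  \<open>Y\<close> forces \<open>h\<close> to be an identity, and then freeness of \<open>X\<close>
  gives \<open>g = g'\<close>.\<close>

lemma free_tensor:
  assumes "X.free" "Y.free"
  shows "W.free"
  unfolding W.free_def
proof (intro ballI inj_onI)
  fix \<kappa> \<gamma> \<gamma>' w g g' assume *: "\<kappa> \<in> Ob K" "\<gamma> \<in> Ob G" "\<gamma>' \<in> Ob G" "w \<in> FOb W (\<kappa>, \<gamma>)"
    "g \<in> Hom G \<gamma> \<gamma>'" "g' \<in> Hom G \<gamma> \<gamma>'" "lact K W \<kappa> \<gamma> \<gamma>' g w = lact K W \<kappa> \<gamma> \<gamma>' g' w"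
  from *(1,2,4) obtain \<eta> x y where w: "\<eta> \<in> Ob H" "x \<in> FOb X (\<eta>, \<gamma>)" "y \<in> FOb Y (\<kappa>, \<eta>)" "w = m \<kappa> \<gamma> \<eta> x y"
    by (rule tensorE)
  with * have "m \<kappa> \<gamma>' \<eta> (lact H X \<eta> \<gamma> \<gamma>' g x) y = m \<kappa> \<gamma>' \<eta> (lact H X \<eta> \<gamma> \<gamma>' g' x) y"
    by (simp add: lact_m)
  then obtain h where h: "h \<in> Hom H \<eta> \<eta>" "y = lact K Y \<kappa> \<eta> \<eta> h y"
      "lact H X \<eta> \<gamma> \<gamma>' g x = ract G X \<gamma>' \<eta> \<eta> h (lact H X \<eta> \<gamma> \<gamma>' g' x)"
    using * w by (subst (asm) m_eq_iff) (auto simp: X.act_closed)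
  have "h = Idn H \<eta>"
  proof -
    have "inj_on (\<lambda>h. lact K Y \<kappa> \<eta> \<eta> h y) (Hom H \<eta> \<eta>)"
      using \<open>Y.free\<close> * w by (simp add: Y.free_def)
    then show ?thesis
      by (rule inj_onD) (use h * w in \<open>simp_all add: Y.lact_id X.grpd_simps\<close>)
  qed
  with h * w have "lact H X \<eta> \<gamma> \<gamma>' g x = lact H X \<eta> \<gamma> \<gamma>' g' x"
    by (simp add: X.ract_id X.act_closed)
  moreover have "inj_on (\<lambda>g. lact H X \<eta> \<gamma> \<gamma>' g x) (Hom G \<gamma> \<gamma>')"
    using \<open>X.free\<close> * w by (simp add: X.free_def)
  ultimately show "g = g'"
    using * by (auto dest: inj_onD)
qed

text \<open>Let \<open>y'\<close> run through the generators of \<open>Y\<close> at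
  \<open>\<kappa>\<close>, and for \<open>y'\<close> at the object \<open>\<eta>'\<close> let
  \<open>x'\<close> run through the generators of \<open>X\<close> at \<open>\<eta>'\<close>. The
  elements \<open>x' \<otimes> y'\<close> generate, because
  \<open>x \<otimes> h y' = x h \<otimes> y'\<close> and \<open>x h = g x'\<close>. They are
  finitely many, as only the objects \<open>\<eta>'\<close> occurring in \<open>E\<close>
  contribute.\<close>

lemma finitely_generated_tensor:
  assumes "X.finitely_generated" "Y.finitely_generated"
  shows "W.finitely_generated"
  unfolding W.finitely_generated_def
proof (intro ballI)
  fix \<kappa> assume \<kappa>: "\<kappa> \<in> Ob K"
  from bspec[OF assms(2)[unfolded Y.finitely_generated_def] \<kappa>] obtain E where E: "finite E" "E \<subseteq> (SIGMA \<eta>:Ob H. FOb Y (\<kappa>, \<eta>))"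
    and genE: "\<forall>\<eta>\<in>Ob H. \<forall>y\<in>FOb Y (\<kappa>, \<eta>). \<exists>(\<eta>', y')\<in>E. \<exists>h\<in>Hom H \<eta>' \<eta>. y = lact K Y \<kappa> \<eta>' \<eta> h y'"
    by (elim exE conjE)
  from assms(1) obtain F where F: "\<forall>\<eta>\<in>Ob H. finite (F \<eta>) \<and> F \<eta> \<subseteq> (SIGMA \<gamma>:Ob G. FOb X (\<eta>, \<gamma>)) \<and>
    (\<forall>\<gamma>'\<in>Ob G. \<forall>x\<in>FOb X (\<eta>, \<gamma>'). \<exists>(\<gamma>, x')\<in>F \<eta>. \<exists>g\<in>Hom G \<gamma> \<gamma>'. x = lact H X \<eta> \<gamma> \<gamma>' g x')"
    unfolding X.finitely_generated_def by (auto dest!: bchoice)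
  let ?F = "(\<lambda>((\<eta>, y), (\<gamma>, x)). (\<gamma>, m \<kappa> \<gamma> \<eta> x y)) ` (SIGMA p:E. F (fst p))"
  show "\<exists>F. finite F \<and> F \<subseteq> (SIGMA \<gamma>:Ob G. FOb W (\<kappa>, \<gamma>)) \<and>
    (\<forall>\<gamma>'\<in>Ob G. \<forall>w\<in>FOb W (\<kappa>, \<gamma>'). \<exists>(\<gamma>, w')\<in>F. \<exists>g\<in>Hom G \<gamma> \<gamma>'. w = lact K W \<kappa> \<gamma> \<gamma>' g w')"
  proof (intro exI[of _ ?F] conjI ballI)
    show "finite ?F"
      using E F by (intro finite_imageI finite_SigmaI) auto
    show "?F \<subseteq> (SIGMA \<gamma>:Ob G. FOb W (\<kappa>, \<gamma>))"
    proof
      fix q assume "q \<in> ?F"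
      then obtain \<eta> y \<gamma> x where q: "q = (\<gamma>, m \<kappa> \<gamma> \<eta> x y)" "(\<eta>, y) \<in> E" "(\<gamma>, x) \<in> F \<eta>"
        by auto
      then have "\<eta> \<in> Ob H" "y \<in> FOb Y (\<kappa>, \<eta>)"
        using E by auto
      moreover from this have "\<gamma> \<in> Ob G" "x \<in> FOb X (\<eta>, \<gamma>)"
        using F q by auto
      ultimately show "q \<in> (SIGMA \<gamma>:Ob G. FOb W (\<kappa>, \<gamma>))"
        using q \<kappa> by (simp add: m_closed)
    qed
  next
    fix \<gamma>' w assume *: "\<gamma>' \<in> Ob G" "w \<in> FOb W (\<kappa>, \<gamma>')"
    with \<kappa> obtain \<eta> x y where w: "\<eta> \<in> Ob H" "x \<in> FOb X (\<eta>, \<gamma>')" "y \<in> FOb Y (\<kappa>, \<eta>)" "w = m \<kappa> \<gamma>' \<eta> x y"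
      using tensorE by metis
    from genE w obtain \<eta>' y' h where y: "(\<eta>', y') \<in> E" "h \<in> Hom H \<eta>' \<eta>" "y = lact K Y \<kappa> \<eta>' \<eta> h y'"
      by blast
    then have \<eta>': "\<eta>' \<in> Ob H" "y' \<in> FOb Y (\<kappa>, \<eta>')"
      using E by auto
    \<comment> \<open>Moving \<open>h\<close> to the other factor lands at \<open>\<eta>'\<close>,
      where generators of \<open>X\<close> have been collected.\<close>
    let ?x = "ract G X \<gamma>' \<eta> \<eta>' h x"
    have "?x \<in> FOb X (\<eta>', \<gamma>')"
      using * w y \<eta>' by (simp add: X.act_closed)
    with F \<eta>' * obtain \<gamma> x' g where x: "(\<gamma>, x') \<in> F \<eta>'" "g \<in> Hom G \<gamma> \<gamma>'" "?x = lact H X \<eta>' \<gamma> \<gamma>' g x'"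
      by blast
    then have \<gamma>: "\<gamma> \<in> Ob G" "x' \<in> FOb X (\<eta>', \<gamma>)"
      using F \<eta>' by auto
    have "w = m \<kappa> \<gamma>' \<eta>' ?x y'"
      using \<kappa> * w y \<eta>' by (simp add: balanced)
    also have "\<dots> = lact K W \<kappa> \<gamma> \<gamma>' g (m \<kappa> \<gamma> \<eta>' x' y')"
      using \<kappa> * \<gamma> x \<eta>' by (simp add: lact_m)
    finally show "\<exists>(\<gamma>, w')\<in>?F. \<exists>g\<in>Hom G \<gamma> \<gamma>'. w = lact K W \<kappa> \<gamma> \<gamma>' g w'"
      using x y by (intro bexI[of _ "(\<gamma>, m \<kappa> \<gamma> \<eta>' x' y')"]) (auto intro!: image_eqI[of _ _ "((\<eta>', y'), (\<gamma>, x'))"])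
  qed
qed

lemma admissible_tensor: "admissible H G X \<Longrightarrow> admissible K H Y \<Longrightarrow> admissible K G W"
  by (simp add: X.admissible_iff Y.admissible_iff W.admissible_iff free_tensor finitely_generated_tensor)

end

text \<open>Gives uniqueness of the tensor product, when both isomorphisms are identities, and its
  invariance under isomorphism. \<open>W\<close> and \<open>W'\<close> are quotients of the same
  triples \<open>(\<eta>, x, y)\<close>, the second after applying \<open>s\<close> and
  \<open>t\<close>; as these are bijective and equivariant, the same arrow \<open>h\<close>
  witnesses both kernels.\<close>

lemma tensor_product_cong:
  assumes "tensor_product K H G X Y W m" "tensor_product K H G X' Y' W' m'"
    and "nat_iso (bicat H G) X X'" "nat_iso (bicat K H) Y Y'"
  shows "nat_iso (bicat K G) W W'"
proof -
  interpret T: tensor_product K H G X Y W m by fact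
  interpret T': tensor_product K H G X' Y' W' m' by fact
  from assms(3) obtain s where s: "\<And>\<eta> \<gamma>. \<eta> \<in> Ob H \<Longrightarrow> \<gamma> \<in> Ob G \<Longrightarrow> bij_betw (s \<eta> \<gamma>) (FOb X (\<eta>, \<gamma>)) (FOb X' (\<eta>, \<gamma>))"
    and s_nat: "\<And>\<eta> \<eta>' \<gamma> \<gamma>' h g x. \<eta> \<in> Ob H \<Longrightarrow> \<eta>' \<in> Ob H \<Longrightarrow> \<gamma> \<in> Ob G \<Longrightarrow> \<gamma>' \<in> Ob G \<Longrightarrow>
      h \<in> Hom H \<eta>' \<eta> \<Longrightarrow> g \<in> Hom G \<gamma> \<gamma>' \<Longrightarrow> x \<in> FOb X (\<eta>, \<gamma>) \<Longrightarrow>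
      s \<eta>' \<gamma>' (FAr X (\<eta>, \<gamma>) (\<eta>', \<gamma>') (h, g) x) = FAr X' (\<eta>, \<gamma>) (\<eta>', \<gamma>') (h, g) (s \<eta> \<gamma> x)"
    by (rule nat_iso_bicatE) blast
  from assms(4) obtain t where t: "\<And>\<kappa> \<eta>. \<kappa> \<in> Ob K \<Longrightarrow> \<eta> \<in> Ob H \<Longrightarrow> bij_betw (t \<kappa> \<eta>) (FOb Y (\<kappa>, \<eta>)) (FOb Y' (\<kappa>, \<eta>))"
    and t_nat: "\<And>\<kappa> \<kappa>' \<eta> \<eta>' k h y. \<kappa> \<in> Ob K \<Longrightarrow> \<kappa>' \<in> Ob K \<Longrightarrow> \<eta> \<in> Ob H \<Longrightarrow> \<eta>' \<in> Ob H \<Longrightarrow>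
      k \<in> Hom K \<kappa>' \<kappa> \<Longrightarrow> h \<in> Hom H \<eta> \<eta>' \<Longrightarrow> y \<in> FOb Y (\<kappa>, \<eta>) \<Longrightarrow>
      t \<kappa>' \<eta>' (FAr Y (\<kappa>, \<eta>) (\<kappa>', \<eta>') (k, h) y) = FAr Y' (\<kappa>, \<eta>) (\<kappa>', \<eta>') (k, h) (t \<kappa> \<eta> y)"
    by (rule nat_iso_bicatE) blast
  have s_mem: "s \<eta> \<gamma> x \<in> FOb X' (\<eta>, \<gamma>)" if "\<eta> \<in> Ob H" "\<gamma> \<in> Ob G" "x \<in> FOb X (\<eta>, \<gamma>)" for \<eta> \<gamma> x
    using s that by (auto simp: bij_betw_def)
  have t_mem: "t \<kappa> \<eta> y \<in> FOb Y' (\<kappa>, \<eta>)" if "\<kappa> \<in> Ob K" "\<eta> \<in> Ob H" "y \<in> FOb Y (\<kappa>, \<eta>)" for \<kappa> \<eta> y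
    using t that by (auto simp: bij_betw_def)
  have s_eq: "s \<eta> \<gamma> x = s \<eta> \<gamma> x' \<longleftrightarrow> x = x'"
    if "\<eta> \<in> Ob H" "\<gamma> \<in> Ob G" "x \<in> FOb X (\<eta>, \<gamma>)" "x' \<in> FOb X (\<eta>, \<gamma>)" for \<eta> \<gamma> x x'
    using s that by (auto simp: bij_betw_def dest: inj_onD)
  have t_eq: "t \<kappa> \<eta> y = t \<kappa> \<eta> y' \<longleftrightarrow> y = y'"
    if "\<kappa> \<in> Ob K" "\<eta> \<in> Ob H" "y \<in> FOb Y (\<kappa>, \<eta>)" "y' \<in> FOb Y (\<kappa>, \<eta>)" for \<kappa> \<eta> y y'
    using t that by (auto simp: bij_betw_def dest: inj_onD)
  have s_lact: "lact H X' \<eta> \<gamma> \<gamma>' g (s \<eta> \<gamma> x) = s \<eta> \<gamma>' (lact H X \<eta> \<gamma> \<gamma>' g x)"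
    if "\<eta> \<in> Ob H" "\<gamma> \<in> Ob G" "\<gamma>' \<in> Ob G" "g \<in> Hom G \<gamma> \<gamma>'" "x \<in> FOb X (\<eta>, \<gamma>)" for \<eta> \<gamma> \<gamma>' g x
    using that by (simp add: lact_def s_nat T.X.grpd_simps)
  have s_ract: "ract G X' \<gamma> \<eta> \<eta>' h (s \<eta> \<gamma> x) = s \<eta>' \<gamma> (ract G X \<gamma> \<eta> \<eta>' h x)"
    if "\<eta> \<in> Ob H" "\<eta>' \<in> Ob H" "\<gamma> \<in> Ob G" "h \<in> Hom H \<eta>' \<eta>" "x \<in> FOb X (\<eta>, \<gamma>)" for \<eta> \<eta>' \<gamma> h x
    using that by (simp add: ract_def s_nat T.X.grpd_simps)
  have t_lact: "lact K Y' \<kappa> \<eta> \<eta>' h (t \<kappa> \<eta> y) = t \<kappa> \<eta>' (lact K Y \<kappa> \<eta> \<eta>' h y)"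
    if "\<kappa> \<in> Ob K" "\<eta> \<in> Ob H" "\<eta>' \<in> Ob H" "h \<in> Hom H \<eta> \<eta>'" "y \<in> FOb Y (\<kappa>, \<eta>)" for \<kappa> \<eta> \<eta>' h y
    using that by (simp add: lact_def t_nat T.Y.grpd_simps)
  have t_ract: "ract H Y' \<eta> \<kappa> \<kappa>' k (t \<kappa> \<eta> y) = t \<kappa>' \<eta> (ract H Y \<eta> \<kappa> \<kappa>' k y)"
    if "\<kappa> \<in> Ob K" "\<kappa>' \<in> Ob K" "\<eta> \<in> Ob H" "k \<in> Hom K \<kappa>' \<kappa>" "y \<in> FOb Y (\<kappa>, \<eta>)" for \<kappa> \<kappa>' \<eta> k y
    using that by (simp add: ract_def t_nat T.Y.grpd_simps)
  let ?S = "\<lambda>\<kappa> \<gamma>. SIGMA \<eta>:Ob H. FOb X (\<eta>, \<gamma>) \<times> FOb Y (\<kappa>, \<eta>)"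
  let ?p = "\<lambda>\<kappa> \<gamma> (\<eta>, x, y). m \<kappa> \<gamma> \<eta> x y"
  let ?q = "\<lambda>\<kappa> \<gamma> (\<eta>, x, y). m' \<kappa> \<gamma> \<eta> (s \<eta> \<gamma> x) (t \<kappa> \<eta> y)"
  show ?thesis
  proof (rule nat_iso_bicat_span[where S = ?S and p = ?p and q = ?q])
    fix \<kappa> \<gamma> assume *: "\<kappa> \<in> Ob K" "\<gamma> \<in> Ob G"
    show "?p \<kappa> \<gamma> ` ?S \<kappa> \<gamma> = FOb W (\<kappa>, \<gamma>)"
      using * by (force simp: T.m_closed elim: T.tensorE)
    show "?q \<kappa> \<gamma> ` ?S \<kappa> \<gamma> = FOb W' (\<kappa>, \<gamma>)"
    proof (intro equalityI subsetI)
      fix w assume "w \<in> FOb W' (\<kappa>, \<gamma>)"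
      with * obtain \<eta> x y where w: "\<eta> \<in> Ob H" "x \<in> FOb X' (\<eta>, \<gamma>)" "y \<in> FOb Y' (\<kappa>, \<eta>)" "w = m' \<kappa> \<gamma> \<eta> x y"
        using T'.tensorE by metis
      moreover from w * have "x \<in> s \<eta> \<gamma> ` FOb X (\<eta>, \<gamma>)" "y \<in> t \<kappa> \<eta> ` FOb Y (\<kappa>, \<eta>)"
        using s t by (simp_all add: bij_betw_def)
      ultimately show "w \<in> ?q \<kappa> \<gamma> ` ?S \<kappa> \<gamma>"
        by force
    qed (use * in \<open>auto simp: T'.m_closed s_mem t_mem\<close>)
  next
    fix \<kappa> \<gamma> u v
    assume *: "\<kappa> \<in> Ob K" "\<gamma> \<in> Ob G" "u \<in> ?S \<kappa> \<gamma>" "v \<in> ?S \<kappa> \<gamma>"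
    obtain \<eta> x y \<eta>' x' y' where "u = (\<eta>, x, y)" "v = (\<eta>', x', y')"
      by (cases u; cases v)
    with * show "?p \<kappa> \<gamma> u = ?p \<kappa> \<gamma> v \<longleftrightarrow> ?q \<kappa> \<gamma> u = ?q \<kappa> \<gamma> v"
      by (simp add: T.m_eq_iff T'.m_eq_iff s_mem t_mem s_ract t_lact s_eq t_eq T.X.act_closed T.Y.act_closed
          cong: bex_cong)
  next
    fix \<kappa> \<kappa>' \<gamma> \<gamma>' k g u
    assume *: "\<kappa> \<in> Ob K" "\<kappa>' \<in> Ob K" "\<gamma> \<in> Ob G" "\<gamma>' \<in> Ob G" "k \<in> Hom K \<kappa>' \<kappa>" "g \<in> Hom G \<gamma> \<gamma>'" "u \<in> ?S \<kappa> \<gamma>"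
    obtain \<eta> x y where "u = (\<eta>, x, y)"
      by (cases u)
    with * show "\<exists>u'\<in>?S \<kappa>' \<gamma>'. FAr W (\<kappa>, \<gamma>) (\<kappa>', \<gamma>') (k, g) (?p \<kappa> \<gamma> u) = ?p \<kappa>' \<gamma>' u' \<and>
        FAr W' (\<kappa>, \<gamma>) (\<kappa>', \<gamma>') (k, g) (?q \<kappa> \<gamma> u) = ?q \<kappa>' \<gamma>' u'"
      by (intro bexI[of _ "(\<eta>, lact H X \<eta> \<gamma> \<gamma>' g x, ract H Y \<eta> \<kappa> \<kappa>' k y)"])
        (simp_all add: T.FAr_m T'.FAr_m s_mem t_mem s_lact t_ract T.X.act_closed T.Y.act_closed)
  qed
qed

text \<open>Both bracketings are quotients of the quintuples
  \<open>(\<eta>, \<kappa>, x, y, z)\<close>, and in either of them two quintuples agree iff there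
  are arrows \<open>h\<close> and \<open>k\<close> with \<open>x = x' h\<close>,
  \<open>h y = y' k\<close> and \<open>z' = k z\<close>.\<close>

lemma tensor_product_assoc:
  assumes "tensor_product K H G X Y W m" "tensor_product J K H Y Z V n"
    and "tensor_product J K G W Z U u" "tensor_product J H G X V U' u'"
  shows "nat_iso (bicat J G) U' U"
proof -
  interpret W: tensor_product K H G X Y W m by fact
  interpret V: tensor_product J K H Y Z V n by fact
  interpret U: tensor_product J K G W Z U u by fact
  interpret U': tensor_product J H G X V U' u' by fact
  let ?S = "\<lambda>\<iota> \<gamma>. {(\<eta>, \<kappa>, x, y, z). \<eta> \<in> Ob H \<and> \<kappa> \<in> Ob K \<and>
    x \<in> FOb X (\<eta>, \<gamma>) \<and> y \<in> FOb Y (\<kappa>, \<eta>) \<and> z \<in> FOb Z (\<iota>, \<kappa>)}"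
  let ?p = "\<lambda>\<iota> \<gamma> (\<eta>, \<kappa>, x, y, z). u' \<iota> \<gamma> \<eta> x (n \<iota> \<eta> \<kappa> y z)"
  let ?q = "\<lambda>\<iota> \<gamma> (\<eta>, \<kappa>, x, y, z). u \<iota> \<gamma> \<kappa> (m \<kappa> \<gamma> \<eta> x y) z"
  show ?thesis
  proof (rule nat_iso_bicat_span[where S = ?S and p = ?p and q = ?q])
    fix \<iota> \<gamma> assume *: "\<iota> \<in> Ob J" "\<gamma> \<in> Ob G"
    show "?p \<iota> \<gamma> ` ?S \<iota> \<gamma> = FOb U' (\<iota>, \<gamma>)"
    proof (intro equalityI subsetI)
      fix w assume "w \<in> FOb U' (\<iota>, \<gamma>)"
      with * obtain \<eta> x v where w: "\<eta> \<in> Ob H" "x \<in> FOb X (\<eta>, \<gamma>)" "v \<in> FOb V (\<iota>, \<eta>)" "w = u' \<iota> \<gamma> \<eta> x v"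
        using U'.tensorE by metis
      with * obtain \<kappa> y z where v: "\<kappa> \<in> Ob K" "y \<in> FOb Y (\<kappa>, \<eta>)" "z \<in> FOb Z (\<iota>, \<kappa>)" "v = n \<iota> \<eta> \<kappa> y z"
        using V.tensorE by metis
      with w show "w \<in> ?p \<iota> \<gamma> ` ?S \<iota> \<gamma>"
        by (intro image_eqI[of _ _ "(\<eta>, \<kappa>, x, y, z)"]) simp_all
    qed (use * in \<open>auto simp: U'.m_closed V.m_closed\<close>)
    show "?q \<iota> \<gamma> ` ?S \<iota> \<gamma> = FOb U (\<iota>, \<gamma>)"
    proof (intro equalityI subsetI)
      fix v assume "v \<in> FOb U (\<iota>, \<gamma>)"
      with * obtain \<kappa> w z where v: "\<kappa> \<in> Ob K" "w \<in> FOb W (\<kappa>, \<gamma>)" "z \<in> FOb Z (\<iota>, \<kappa>)" "v = u \<iota> \<gamma> \<kappa> w z"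
        using U.tensorE by metis
      with * obtain \<eta> x y where w: "\<eta> \<in> Ob H" "x \<in> FOb X (\<eta>, \<gamma>)" "y \<in> FOb Y (\<kappa>, \<eta>)" "w = m \<kappa> \<gamma> \<eta> x y"
        using W.tensorE by metis
      with v show "v \<in> ?q \<iota> \<gamma> ` ?S \<iota> \<gamma>"
        by (intro image_eqI[of _ _ "(\<eta>, \<kappa>, x, y, z)"]) simp_all
    qed (use * in \<open>auto simp: U.m_closed W.m_closed\<close>)
  next
    fix \<iota> \<gamma> s t
    assume st: "\<iota> \<in> Ob J" "\<gamma> \<in> Ob G" "s \<in> ?S \<iota> \<gamma>" "t \<in> ?S \<iota> \<gamma>"
    obtain \<eta> \<kappa> x y z \<eta>' \<kappa>' x' y' z' where eqs: "s = (\<eta>, \<kappa>, x, y, z)" "t = (\<eta>', \<kappa>', x', y', z')"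
      by (cases s; cases t)
    with st have *: "\<iota> \<in> Ob J" "\<gamma> \<in> Ob G" "\<eta> \<in> Ob H" "\<kappa> \<in> Ob K" "x \<in> FOb X (\<eta>, \<gamma>)" "y \<in> FOb Y (\<kappa>, \<eta>)" "z \<in> FOb Z (\<iota>, \<kappa>)"
      "\<eta>' \<in> Ob H" "\<kappa>' \<in> Ob K" "x' \<in> FOb X (\<eta>', \<gamma>)" "y' \<in> FOb Y (\<kappa>', \<eta>')" "z' \<in> FOb Z (\<iota>, \<kappa>')"
      by simp_all
    have "u' \<iota> \<gamma> \<eta> x (n \<iota> \<eta> \<kappa> y z) = u' \<iota> \<gamma> \<eta>' x' (n \<iota> \<eta>' \<kappa>' y' z') \<longleftrightarrow>
        (\<exists>h\<in>Hom H \<eta> \<eta>'. x = ract G X \<gamma> \<eta>' \<eta> h x' \<and>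
           n \<iota> \<eta>' \<kappa> (lact K Y \<kappa> \<eta> \<eta>' h y) z = n \<iota> \<eta>' \<kappa>' y' z')"
      using * by (subst U'.m_eq_iff) (simp_all add: V.m_closed V.lact_m eq_commute[of "n \<iota> \<eta>' \<kappa>' y' z'"] cong: bex_cong)
    also have "\<dots> \<longleftrightarrow> (\<exists>h\<in>Hom H \<eta> \<eta>'. x = ract G X \<gamma> \<eta>' \<eta> h x' \<and> (\<exists>k\<in>Hom K \<kappa> \<kappa>'.
        lact K Y \<kappa> \<eta> \<eta>' h y = ract H Y \<eta>' \<kappa>' \<kappa> k y' \<and> z' = lact J Z \<iota> \<kappa> \<kappa>' k z))"
      using * by (simp add: V.m_eq_iff W.Y.act_closed cong: bex_cong)
    \<comment> \<open>Exchanging the two quantifiers is the passage from one bracketing to the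
      other.\<close>
    also have "\<dots> \<longleftrightarrow> (\<exists>k\<in>Hom K \<kappa> \<kappa>'. (\<exists>h\<in>Hom H \<eta> \<eta>'. x = ract G X \<gamma> \<eta>' \<eta> h x' \<and>
        ract H Y \<eta>' \<kappa>' \<kappa> k y' = lact K Y \<kappa> \<eta> \<eta>' h y) \<and> z' = lact J Z \<iota> \<kappa> \<kappa>' k z)"
      by (simp only: eq_commute[of "lact K Y _ _ _ _ _"]) blast
    also have "\<dots> \<longleftrightarrow> (\<exists>k\<in>Hom K \<kappa> \<kappa>'. m \<kappa> \<gamma> \<eta> x y = m \<kappa> \<gamma> \<eta>' x' (ract H Y \<eta>' \<kappa>' \<kappa> k y') \<and>
        z' = lact J Z \<iota> \<kappa> \<kappa>' k z)"
      using * by (simp add: W.m_eq_iff W.Y.act_closed cong: bex_cong)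
    also have "\<dots> \<longleftrightarrow> u \<iota> \<gamma> \<kappa> (m \<kappa> \<gamma> \<eta> x y) z = u \<iota> \<gamma> \<kappa>' (m \<kappa>' \<gamma> \<eta>' x' y') z'"
      using * by (simp add: U.m_eq_iff W.m_closed W.ract_m cong: bex_cong)
    finally show "?p \<iota> \<gamma> s = ?p \<iota> \<gamma> t \<longleftrightarrow> ?q \<iota> \<gamma> s = ?q \<iota> \<gamma> t"
      by (simp add: eqs)
  next
    fix \<iota> \<iota>' \<gamma> \<gamma>' j g s
    assume *: "\<iota> \<in> Ob J" "\<iota>' \<in> Ob J" "\<gamma> \<in> Ob G" "\<gamma>' \<in> Ob G" "j \<in> Hom J \<iota>' \<iota>" "g \<in> Hom G \<gamma> \<gamma>'" "s \<in> ?S \<iota> \<gamma>"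
    obtain \<eta> \<kappa> x y z where "s = (\<eta>, \<kappa>, x, y, z)"
      by (cases s)
    with * show "\<exists>s'\<in>?S \<iota>' \<gamma>'. FAr U' (\<iota>, \<gamma>) (\<iota>', \<gamma>') (j, g) (?p \<iota> \<gamma> s) = ?p \<iota>' \<gamma>' s' \<and>
        FAr U (\<iota>, \<gamma>) (\<iota>', \<gamma>') (j, g) (?q \<iota> \<gamma> s) = ?q \<iota>' \<gamma>' s'"
      by (intro bexI[of _ "(\<eta>, \<kappa>, lact H X \<eta> \<gamma> \<gamma>' g x, y, ract K Z \<kappa> \<iota> \<iota>' j z)"])
        (simp_all add: U.FAr_m U'.FAr_m V.m_closed W.m_closed V.ract_m W.lact_m W.X.act_closed V.Y.act_closed)
  qed
qed

section \<open>The tensor product as a quotient\<close>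

definition balance_rel ::
    "('k, 'km) cat \<Rightarrow> ('h, 'hm) cat \<Rightarrow> ('g, 'gm) cat \<Rightarrow> ('h, 'hm, 'g, 'gm, 'x) biset \<Rightarrow>
     ('k, 'km, 'h, 'hm, 'y) biset \<Rightarrow> 'k \<Rightarrow> 'g \<Rightarrow> (('h \<times> 'x \<times> 'y) \<times> ('h \<times> 'x \<times> 'y)) set" where
  "balance_rel K H G X Y \<kappa> \<gamma> = {((\<eta>', ract G X \<gamma> \<eta> \<eta>' h x, y), (\<eta>, x, lact K Y \<kappa> \<eta>' \<eta> h y)) | \<eta> \<eta>' h x y.
     \<eta> \<in> Ob H \<and> \<eta>' \<in> Ob H \<and> h \<in> Hom H \<eta>' \<eta> \<and> x \<in> FOb X (\<eta>, \<gamma>) \<and> y \<in> FOb Y (\<kappa>, \<eta>')}"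

lemma balance_relI:
  "\<eta> \<in> Ob H \<Longrightarrow> \<eta>' \<in> Ob H \<Longrightarrow> h \<in> Hom H \<eta>' \<eta> \<Longrightarrow> x \<in> FOb X (\<eta>, \<gamma>) \<Longrightarrow> y \<in> FOb Y (\<kappa>, \<eta>') \<Longrightarrow>
    x' = ract G X \<gamma> \<eta> \<eta>' h x \<Longrightarrow> y' = lact K Y \<kappa> \<eta>' \<eta> h y \<Longrightarrow>
    ((\<eta>', x', y), (\<eta>, x, y')) \<in> balance_rel K H G X Y \<kappa> \<gamma>"
  unfolding balance_rel_def by blast

lemma balance_relE:
  assumes "(s, t) \<in> balance_rel K H G X Y \<kappa> \<gamma>"
  obtains \<eta> \<eta>' h x y where "s = (\<eta>', ract G X \<gamma> \<eta> \<eta>' h x, y)" "t = (\<eta>, x, lact K Y \<kappa> \<eta>' \<eta> h y)"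
    "\<eta> \<in> Ob H" "\<eta>' \<in> Ob H" "h \<in> Hom H \<eta>' \<eta>" "x \<in> FOb X (\<eta>, \<gamma>)" "y \<in> FOb Y (\<kappa>, \<eta>')"
  using assms unfolding balance_rel_def by blast

context
  fixes K :: "('k, 'km) cat" and H :: "('h, 'hm) cat" and G :: "('g, 'gm) cat"
    and X :: "('h, 'hm, 'g, 'gm, 'x) biset" and Y :: "('k, 'km, 'h, 'hm, 'y) biset"
  assumes X: "biset H G X" and Y: "biset K H Y"
begin

interpretation X: biset H G X by (rule X)
interpretation Y: biset K H Y by (rule Y)

text \<open>Inverse arrows make the balancing relation symmetric and composite arrows make it
  transitive, so the generated equivalence adds only the diagonal.\<close>

lemma tensor_rel_eq:
  assumes \<kappa>: "\<kappa> \<in> Ob K" and \<gamma>: "\<gamma> \<in> Ob G"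
  shows "tensor_rel H (right_part G X \<gamma>) (left_part K Y \<kappa>) = (balance_rel K H G X Y \<kappa> \<gamma>)\<^sup>="
proof -
  let ?r = "balance_rel K H G X Y \<kappa> \<gamma>"
  have "sym ?r"
  proof (rule symI)
    fix s t assume "(s, t) \<in> ?r"
    then obtain \<eta> \<eta>' h x y where *: "s = (\<eta>', ract G X \<gamma> \<eta> \<eta>' h x, y)" "t = (\<eta>, x, lact K Y \<kappa> \<eta>' \<eta> h y)"
      "\<eta> \<in> Ob H" "\<eta>' \<in> Ob H" "h \<in> Hom H \<eta>' \<eta>" "x \<in> FOb X (\<eta>, \<gamma>)" "y \<in> FOb Y (\<kappa>, \<eta>')"
      by (rule balance_relE)
    obtain h' where h': "h' \<in> Hom H \<eta> \<eta>'" "Cmp H \<eta>' \<eta> \<eta>' h' h = Idn H \<eta>'" "Cmp H \<eta> \<eta>' \<eta> h h' = Idn H \<eta>"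
      using groupoid_inverse[OF X.groupoid_source *(4,3,5)] .
    show "(t, s) \<in> ?r"
      unfolding *(1,2) using * h' \<kappa> \<gamma>
      by (intro balance_relI[where h = h'])
        (simp_all add: X.act_closed Y.act_closed X.ract_comp Y.lact_comp X.ract_id Y.lact_id)
  qed
  moreover have "trans ?r"
  proof (rule transI)
    fix s t u assume "(s, t) \<in> ?r" "(t, u) \<in> ?r"
    from this(1) obtain \<eta> \<eta>' h x y where *: "s = (\<eta>', ract G X \<gamma> \<eta> \<eta>' h x, y)" "t = (\<eta>, x, lact K Y \<kappa> \<eta>' \<eta> h y)"
      "\<eta> \<in> Ob H" "\<eta>' \<in> Ob H" "h \<in> Hom H \<eta>' \<eta>" "x \<in> FOb X (\<eta>, \<gamma>)" "y \<in> FOb Y (\<kappa>, \<eta>')"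
      by (rule balance_relE)
    from \<open>(t, u) \<in> ?r\<close> obtain \<theta> \<theta>' k z w where **: "t = (\<theta>', ract G X \<gamma> \<theta> \<theta>' k z, w)" "u = (\<theta>, z, lact K Y \<kappa> \<theta>' \<theta> k w)"
      "\<theta> \<in> Ob H" "\<theta>' \<in> Ob H" "k \<in> Hom H \<theta>' \<theta>" "z \<in> FOb X (\<theta>, \<gamma>)" "w \<in> FOb Y (\<kappa>, \<theta>')"
      by (rule balance_relE)
    \<comment> \<open>The middle triple \<open>t\<close> is written in two ways; comparing them
      makes \<open>h\<close> and \<open>k\<close> composable.\<close>
    have eqs: "\<theta>' = \<eta>" "w = lact K Y \<kappa> \<eta>' \<eta> h y" "x = ract G X \<gamma> \<theta> \<eta> k z"
      using *(2) **(1) by auto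
    show "(s, u) \<in> ?r"
      unfolding *(1) **(2) eqs using *(3-7) **(3-7) \<kappa> \<gamma> unfolding eqs
      by (intro balance_relI[where h = "Cmp H \<eta>' \<eta> \<theta> k h"])
        (simp_all add: X.act_closed Y.act_closed X.ract_comp Y.lact_comp X.grpd_simps)
  qed
  moreover have "tensor_rel H (right_part G X \<gamma>) (left_part K Y \<kappa>) = (?r \<union> ?r\<inverse>)\<^sup>*"
    by (simp only: tensor_rel_def balance_rel_def Let_def right_part_def left_part_def lact_def ract_def set_fun.simps)
  ultimately show ?thesis
    by (simp add: rtrancl_Un_converse)
qed

text \<open>The diagonal pairs added by the reflexive closure are witnessed by identity
  arrows.\<close>

lemma tensor_rel_iff:
  assumes "\<kappa> \<in> Ob K" "\<gamma> \<in> Ob G" "\<eta> \<in> Ob H" "\<eta>' \<in> Ob H" "x \<in> FOb X (\<eta>, \<gamma>)" "y \<in> FOb Y (\<kappa>, \<eta>)"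
    "x' \<in> FOb X (\<eta>', \<gamma>)" "y' \<in> FOb Y (\<kappa>, \<eta>')"
  shows "((\<eta>, x, y), (\<eta>', x', y')) \<in> tensor_rel H (right_part G X \<gamma>) (left_part K Y \<kappa>) \<longleftrightarrow>
    (\<exists>h\<in>Hom H \<eta> \<eta>'. x = ract G X \<gamma> \<eta>' \<eta> h x' \<and> y' = lact K Y \<kappa> \<eta> \<eta>' h y)"
    (is "_ \<longleftrightarrow> ?R")
proof -
  have "((\<eta>, x, y), (\<eta>', x', y')) \<in> balance_rel K H G X Y \<kappa> \<gamma> \<longleftrightarrow> ?R"
    using assms by (auto elim!: balance_relE intro!: balance_relI)
  moreover have ?R if "(\<eta>, x, y) = (\<eta>', x', y')"
    using assms that by (intro bexI[of _ "Idn H \<eta>"]) (simp_all add: X.ract_id Y.lact_id X.grpd_simps)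
  ultimately show ?thesis
    unfolding tensor_rel_eq[OF assms(1,2)] by blast
qed

text \<open>A reflexive transitive closure is reflexive on the whole type, so the classes can be
  compared over \<open>UNIV\<close>.\<close>

lemma equiv_tensor_rel: "equiv UNIV (tensor_rel H (right_part G X \<gamma>) (left_part K Y \<kappa>))"
  unfolding tensor_rel_def Let_def
  by (rule equivI) (simp_all add: refl_rtrancl trans_rtrancl sym_rtrancl sym_Un_converse)

text \<open>The arrow \<open>h\<close> that relates two triples also relates their images, since the
  actions of \<open>g\<close> and \<open>k\<close> commute with that of \<open>h\<close>.\<close>

lemma tensor_rel_act:
  assumes "\<kappa> \<in> Ob K" "\<kappa>' \<in> Ob K" "\<gamma> \<in> Ob G" "\<gamma>' \<in> Ob G" "k \<in> Hom K \<kappa>' \<kappa>" "g \<in> Hom G \<gamma> \<gamma>'"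
    and "((\<eta>, x, y), (\<eta>', x', y')) \<in> tensor_rel H (right_part G X \<gamma>) (left_part K Y \<kappa>)"
  shows "((\<eta>, lact H X \<eta> \<gamma> \<gamma>' g x, ract H Y \<eta> \<kappa> \<kappa>' k y), (\<eta>', lact H X \<eta>' \<gamma> \<gamma>' g x', ract H Y \<eta>' \<kappa> \<kappa>' k y'))
    \<in> tensor_rel H (right_part G X \<gamma>') (left_part K Y \<kappa>')"
  using assms(7) unfolding tensor_rel_eq[OF assms(1,3)] tensor_rel_eq[OF assms(2,4)] Un_iff
proof (elim disjE)
  assume "((\<eta>, x, y), (\<eta>', x', y')) \<in> balance_rel K H G X Y \<kappa> \<gamma>"
  then obtain h where *: "\<eta> \<in> Ob H" "\<eta>' \<in> Ob H" "h \<in> Hom H \<eta> \<eta>'" "x' \<in> FOb X (\<eta>', \<gamma>)" "y \<in> FOb Y (\<kappa>, \<eta>)"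
    "x = ract G X \<gamma> \<eta>' \<eta> h x'" "y' = lact K Y \<kappa> \<eta> \<eta>' h y"
    by (auto elim!: balance_relE)
  with assms(1-6) have "((\<eta>, lact H X \<eta> \<gamma> \<gamma>' g x, ract H Y \<eta> \<kappa> \<kappa>' k y), (\<eta>', lact H X \<eta>' \<gamma> \<gamma>' g x', ract H Y \<eta>' \<kappa> \<kappa>' k y'))
    \<in> balance_rel K H G X Y \<kappa>' \<gamma>'"
    by (intro balance_relI[where h = h]) (simp_all add: X.act_closed Y.act_closed X.lact_ract Y.lact_ract)
  then show "((\<eta>, lact H X \<eta> \<gamma> \<gamma>' g x, ract H Y \<eta> \<kappa> \<kappa>' k y), (\<eta>', lact H X \<eta>' \<gamma> \<gamma>' g x', ract H Y \<eta>' \<kappa> \<kappa>' k y'))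
    \<in> balance_rel K H G X Y \<kappa>' \<gamma>' \<or> ((\<eta>, lact H X \<eta> \<gamma> \<gamma>' g x, ract H Y \<eta> \<kappa> \<kappa>' k y), (\<eta>', lact H X \<eta>' \<gamma> \<gamma>' g x', ract H Y \<eta>' \<kappa> \<kappa>' k y')) \<in> Id" ..
qed simp

text \<open>The quotient is a model of the tensor product; from here on its equivalence classes are
  no longer opened.\<close>

lemma tensor_product_tensor_biset:
  "tensor_product K H G X Y (tensor_biset K H G X Y)
    (\<lambda>\<kappa> \<gamma> \<eta> x y. tensor_rel H (right_part G X \<gamma>) (left_part K Y \<kappa>) `` {(\<eta>, x, y)})"
proof (intro tensor_product.intro X Y tensor_product_axioms.intro)
  fix \<kappa> \<gamma> \<eta> x y assume *: "\<kappa> \<in> Ob K" "\<gamma> \<in> Ob G" "\<eta> \<in> Ob H" "x \<in> FOb X (\<eta>, \<gamma>)" "y \<in> FOb Y (\<kappa>, \<eta>)"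
  then show "tensor_rel H (right_part G X \<gamma>) (left_part K Y \<kappa>) `` {(\<eta>, x, y)} \<in> FOb (tensor_biset K H G X Y) (\<kappa>, \<gamma>)"
    by (auto simp: tensor_biset_def tensor_def right_part_def left_part_def intro!: quotientI)
next
  fix \<kappa> \<gamma> w assume "\<kappa> \<in> Ob K" "\<gamma> \<in> Ob G" "w \<in> FOb (tensor_biset K H G X Y) (\<kappa>, \<gamma>)"
  then obtain s where "s \<in> (SIGMA \<eta>:Ob H. FOb X (\<eta>, \<gamma>) \<times> FOb Y (\<kappa>, \<eta>))"
    "w = tensor_rel H (right_part G X \<gamma>) (left_part K Y \<kappa>) `` {s}"
    by (auto simp: tensor_biset_def tensor_def right_part_def left_part_def elim!: quotientE)
  then show "\<exists>\<eta>\<in>Ob H. \<exists>x\<in>FOb X (\<eta>, \<gamma>). \<exists>y\<in>FOb Y (\<kappa>, \<eta>).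
      w = tensor_rel H (right_part G X \<gamma>) (left_part K Y \<kappa>) `` {(\<eta>, x, y)}"
    by blast
next
  fix \<kappa> \<gamma> \<eta> \<eta>' x y x' y' assume "\<kappa> \<in> Ob K" "\<gamma> \<in> Ob G" "\<eta> \<in> Ob H" "\<eta>' \<in> Ob H" "x \<in> FOb X (\<eta>, \<gamma>)"
    "y \<in> FOb Y (\<kappa>, \<eta>)" "x' \<in> FOb X (\<eta>', \<gamma>)" "y' \<in> FOb Y (\<kappa>, \<eta>')"
  then show "tensor_rel H (right_part G X \<gamma>) (left_part K Y \<kappa>) `` {(\<eta>, x, y)} =
      tensor_rel H (right_part G X \<gamma>) (left_part K Y \<kappa>) `` {(\<eta>', x', y')} \<longleftrightarrow>
      (\<exists>h\<in>Hom H \<eta> \<eta>'. x = ract G X \<gamma> \<eta>' \<eta> h x' \<and> y' = lact K Y \<kappa> \<eta> \<eta>' h y)"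
    by (simp add: eq_equiv_class_iff[OF equiv_tensor_rel] tensor_rel_iff)
next
  fix \<kappa> \<kappa>' \<gamma> \<gamma>' k g \<eta> x y
  assume *: "\<kappa> \<in> Ob K" "\<kappa>' \<in> Ob K" "\<gamma> \<in> Ob G" "\<gamma>' \<in> Ob G" "k \<in> Hom K \<kappa>' \<kappa>" "g \<in> Hom G \<gamma> \<gamma>'"
    "\<eta> \<in> Ob H" "x \<in> FOb X (\<eta>, \<gamma>)" "y \<in> FOb Y (\<kappa>, \<eta>)"
  let ?R = "tensor_rel H (right_part G X \<gamma>) (left_part K Y \<kappa>)"
  let ?R' = "tensor_rel H (right_part G X \<gamma>') (left_part K Y \<kappa>')"
  let ?a = "\<lambda>(\<eta>, x, y). (\<eta>, lact H X \<eta> \<gamma> \<gamma>' g x, ract H Y \<eta> \<kappa> \<kappa>' k y)"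
  \<comment> \<open>The action is defined by acting on all triples of a class and saturating the
    result. By \<open>tensor_rel_act\<close> this is the class of the image of any one of
    them.\<close>
  have "?R' `` (?a ` (?R `` {(\<eta>, x, y)})) = ?R' `` {?a (\<eta>, x, y)}"
  proof (intro equalityI subsetI)
    fix v assume "v \<in> ?R' `` (?a ` (?R `` {(\<eta>, x, y)}))"
    then obtain \<eta>' x' y' where v: "((\<eta>, x, y), (\<eta>', x', y')) \<in> ?R" "(?a (\<eta>', x', y'), v) \<in> ?R'"
      by auto
    from tensor_rel_act[OF *(1-6) v(1)] have "(?a (\<eta>, x, y), ?a (\<eta>', x', y')) \<in> ?R'"
      by simp
    with v(2) show "v \<in> ?R' `` {?a (\<eta>, x, y)}"
      using equivE[OF equiv_tensor_rel] by (blast dest: transD)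
  next
    fix v assume "v \<in> ?R' `` {?a (\<eta>, x, y)}"
    moreover have "(\<eta>, x, y) \<in> ?R `` {(\<eta>, x, y)}"
      using equiv_class_self[OF equiv_tensor_rel] by blast
    ultimately show "v \<in> ?R' `` (?a ` (?R `` {(\<eta>, x, y)}))"
      by blast
  qed
  then show "FAr (tensor_biset K H G X Y) (\<kappa>, \<gamma>) (\<kappa>', \<gamma>') (k, g) (?R `` {(\<eta>, x, y)}) =
      ?R' `` {(\<eta>, lact H X \<eta> \<gamma> \<gamma>' g x, ract H Y \<eta> \<kappa> \<kappa>' k y)}"
    by (simp add: tensor_biset_def lact_def ract_def) (simp add: left_part_def right_part_def)
qed

end

section \<open>Sums and units\<close>

lemma sum_biset_simps [simp]:
  "FOb (sum_biset X Y) p = FOb X p <+> FOb Y p"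
  "FAr (sum_biset X Y) p q f = map_sum (FAr X p q f) (FAr Y p q f)"
  by (simp_all add: sum_biset_def)

lemma act_sum_biset [simp]:
  "lact H (sum_biset X Y) \<eta> \<gamma> \<gamma>' g = map_sum (lact H X \<eta> \<gamma> \<gamma>' g) (lact H Y \<eta> \<gamma> \<gamma>' g)"
  "ract G (sum_biset X Y) \<gamma> \<eta> \<eta>' h = map_sum (ract G X \<gamma> \<eta> \<eta>' h) (ract G Y \<gamma> \<eta> \<eta>' h)"
  by (simp_all add: lact_def ract_def fun_eq_iff split_sum_all)

lemma biset_sum:
  assumes "biset H G X" "biset H G Y"
  shows "biset H G (sum_biset X Y)"
proof -
  interpret X: biset H G X by fact
  interpret Y: biset H G Y by fact
  show ?thesis
    by (rule bisetI[OF X.groupoid_source X.groupoid_target])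
      (auto simp: X.FAr_closed Y.FAr_closed X.FAr_id Y.FAr_id X.FAr_comp Y.FAr_comp)
qed

lemma admissible_sum:
  assumes "groupoid H" "groupoid G" "admissible H G X" "admissible H G Y"
  shows "admissible H G (sum_biset X Y)"
proof -
  interpret X: biset H G X by (rule admissible_biset[OF assms(1-3)])
  interpret Y: biset H G Y by (rule admissible_biset[OF assms(1,2,4)])
  interpret S: biset H G "sum_biset X Y"
    by (rule biset_sum) unfold_locales
  have "S.free"
    using assms(3,4) unfolding X.admissible_iff Y.admissible_iff S.free_def X.free_def Y.free_def
    by (auto simp: inj_on_def)
  moreover have "S.finitely_generated"
    unfolding S.finitely_generated_def
  proof (intro ballI)
    fix \<eta> assume \<eta>: "\<eta> \<in> Ob H"
    have "X.finitely_generated" "Y.finitely_generated"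
      using assms(3,4) by (simp_all add: X.admissible_iff Y.admissible_iff)
    then obtain E F where E: "finite E" "E \<subseteq> (SIGMA \<gamma>:Ob G. FOb X (\<eta>, \<gamma>))"
        "\<forall>\<gamma>'\<in>Ob G. \<forall>y\<in>FOb X (\<eta>, \<gamma>'). \<exists>(\<gamma>, x)\<in>E. \<exists>g\<in>Hom G \<gamma> \<gamma>'. y = lact H X \<eta> \<gamma> \<gamma>' g x"
      and F: "finite F" "F \<subseteq> (SIGMA \<gamma>:Ob G. FOb Y (\<eta>, \<gamma>))"
        "\<forall>\<gamma>'\<in>Ob G. \<forall>y\<in>FOb Y (\<eta>, \<gamma>'). \<exists>(\<gamma>, x)\<in>F. \<exists>g\<in>Hom G \<gamma> \<gamma>'. y = lact H Y \<eta> \<gamma> \<gamma>' g x"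
      unfolding X.finitely_generated_def Y.finitely_generated_def by (elim ballE[of _ _ \<eta>] exE conjE) (use \<eta> in auto)
    let ?F = "apsnd Inl ` E \<union> apsnd Inr ` F"
    show "\<exists>F. finite F \<and> F \<subseteq> (SIGMA \<gamma>:Ob G. FOb (sum_biset X Y) (\<eta>, \<gamma>)) \<and>
      (\<forall>\<gamma>'\<in>Ob G. \<forall>y\<in>FOb (sum_biset X Y) (\<eta>, \<gamma>'). \<exists>(\<gamma>, x)\<in>F. \<exists>g\<in>Hom G \<gamma> \<gamma>'.
        y = lact H (sum_biset X Y) \<eta> \<gamma> \<gamma>' g x)"
    proof (intro exI[of _ ?F] conjI ballI)
      fix \<gamma>' z assume \<gamma>': "\<gamma>' \<in> Ob G" and "z \<in> FOb (sum_biset X Y) (\<eta>, \<gamma>')"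
      then consider x where "z = Inl x" "x \<in> FOb X (\<eta>, \<gamma>')" | y where "z = Inr y" "y \<in> FOb Y (\<eta>, \<gamma>')"
        by auto
      then show "\<exists>(\<gamma>, x)\<in>?F. \<exists>g\<in>Hom G \<gamma> \<gamma>'. z = lact H (sum_biset X Y) \<eta> \<gamma> \<gamma>' g x"
      proof cases
        case 1
        with E(3) \<gamma>' obtain \<gamma> x' g where "(\<gamma>, x') \<in> E" "g \<in> Hom G \<gamma> \<gamma>'" "x = lact H X \<eta> \<gamma> \<gamma>' g x'"
          by blast
        with 1 show ?thesis
          by (intro bexI[of _ "(\<gamma>, Inl x')"]) (auto intro!: image_eqI[of _ _ "(\<gamma>, x')"])
      next
        case 2
        with F(3) \<gamma>' obtain \<gamma> y' g where "(\<gamma>, y') \<in> F" "g \<in> Hom G \<gamma> \<gamma>'" "y = lact H Y \<eta> \<gamma> \<gamma>' g y'"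
          by blast
        with 2 show ?thesis
          by (intro bexI[of _ "(\<gamma>, Inr y')"]) (auto intro!: image_eqI[of _ _ "(\<gamma>, y')"])
      qed
    qed (use E(1,2) F(1,2) in auto)
  qed
  ultimately show ?thesis
    by (simp add: S.admissible_iff)
qed

lemma bij_betw_map_sum:
  assumes "bij_betw f A B" "bij_betw g C D"
  shows "bij_betw (map_sum f g) (A <+> C) (B <+> D)"
proof -
  have *: "inj_on f A" "inj_on g C" "f ` A = B" "g ` C = D"
    using assms by (simp_all add: bij_betw_def)
  have "inj_on (map_sum f g) (A <+> C)"
    by (rule inj_onI) (elim PlusE; simp add: *(1,2)[THEN inj_on_eq_iff])
  moreover have "map_sum f g ` (A <+> C) = B <+> D"
    by (simp add: Plus_def image_Un image_image flip: *(3,4))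
  ultimately show ?thesis
    by (simp add: bij_betw_def)
qed

lemma nat_iso_sum_cong:
  assumes "nat_iso C X X'" "nat_iso C Y Y'"
  shows "nat_iso C (sum_biset X Y) (sum_biset X' Y')"
proof -
  from assms(1) obtain s where s: "\<And>a. a \<in> Ob C \<Longrightarrow> bij_betw (s a) (FOb X a) (FOb X' a)"
    "\<And>a b f x. a \<in> Ob C \<Longrightarrow> b \<in> Ob C \<Longrightarrow> f \<in> Hom C a b \<Longrightarrow> x \<in> FOb X a \<Longrightarrow>
      s b (FAr X a b f x) = FAr X' a b f (s a x)"
    by (rule nat_isoE) blast
  from assms(2) obtain t where t: "\<And>a. a \<in> Ob C \<Longrightarrow> bij_betw (t a) (FOb Y a) (FOb Y' a)"
    "\<And>a b f x. a \<in> Ob C \<Longrightarrow> b \<in> Ob C \<Longrightarrow> f \<in> Hom C a b \<Longrightarrow> x \<in> FOb Y a \<Longrightarrow>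
      t b (FAr Y a b f x) = FAr Y' a b f (t a x)"
    by (rule nat_isoE) blast
  show ?thesis
    unfolding nat_iso_def
    by (intro exI[of _ "\<lambda>a. map_sum (s a) (t a)"]) (auto simp: s t intro: bij_betw_map_sum)
qed

lemma nat_iso_sum_assoc:
  "nat_iso C (sum_biset (sum_biset X Y) Z) (sum_biset X (sum_biset Y Z))"
  unfolding nat_iso_def
  by (intro exI[of _ "\<lambda>_. case_sum (map_sum id Inl) (Inr \<circ> Inr)"])
    (auto simp: bij_betw_def inj_on_def image_Un image_image Plus_def)

lemma nat_iso_sum_comm: "nat_iso C (sum_biset X Y) (sum_biset Y X)"
  unfolding nat_iso_def
  by (intro exI[of _ "\<lambda>_. case_sum Inr Inl"])
    (auto simp: bij_betw_def inj_on_def image_Un image_image Plus_def)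

lemma FOb_empty_biset [simp]: "FOb empty_biset p = {}"
  by (simp add: empty_biset_def)

lemma nat_iso_sum_empty: "nat_iso C (sum_biset empty_biset X) X"
  unfolding nat_iso_def
  \<comment> \<open>The left summand is empty, so the value \<open>undefined\<close> is never
    taken.\<close>
  by (intro exI[of _ "\<lambda>_. case_sum undefined id"])
    (auto simp: bij_betw_def inj_on_def image_Un image_image Plus_def)

lemma nat_iso_empty:
  assumes "\<And>p. p \<in> Ob C \<Longrightarrow> FOb X p = {}" "\<And>p. p \<in> Ob C \<Longrightarrow> FOb Y p = {}"
  shows "nat_iso C X Y"
  using assms by (auto simp: nat_iso_def bij_betw_def)

lemma biset_empty: "groupoid H \<Longrightarrow> groupoid G \<Longrightarrow> biset H G empty_biset"
  by (rule bisetI) simp_all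

lemma admissible_empty:
  assumes "groupoid H" "groupoid G"
  shows "admissible H G empty_biset"
proof -
  interpret biset H G empty_biset
    by (rule biset_empty[OF assms])
  show ?thesis
    unfolding admissible_iff free_def finitely_generated_def
    by auto
qed

text \<open>Distributivity: \<open>m\<close> and \<open>m'\<close> act on the summands separately
  and the actions respect the tags \<open>Inl\<close> and \<open>Inr\<close>, so elements of
  different summands are never identified.\<close>

lemma tensor_product_sum_left:
  assumes "tensor_product K H G X Y W m" "tensor_product K H G X' Y W' m'"
  shows "tensor_product K H G (sum_biset X X') Y (sum_biset W W')
    (\<lambda>\<kappa> \<gamma> \<eta> x y. map_sum (\<lambda>a. m \<kappa> \<gamma> \<eta> a y) (\<lambda>a. m' \<kappa> \<gamma> \<eta> a y) x)"
proof -
  interpret T: tensor_product K H G X Y W m by fact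
  interpret T': tensor_product K H G X' Y W' m' by fact
  show ?thesis
  proof (intro tensor_product.intro biset_sum T.X.biset_axioms T'.X.biset_axioms T.Y.biset_axioms
      tensor_product_axioms.intro)
    fix \<kappa> \<gamma> w assume *: "\<kappa> \<in> Ob K" "\<gamma> \<in> Ob G" "w \<in> FOb (sum_biset W W') (\<kappa>, \<gamma>)"
    show "\<exists>\<eta>\<in>Ob H. \<exists>x\<in>FOb (sum_biset X X') (\<eta>, \<gamma>). \<exists>y\<in>FOb Y (\<kappa>, \<eta>).
        w = map_sum (\<lambda>a. m \<kappa> \<gamma> \<eta> a y) (\<lambda>a. m' \<kappa> \<gamma> \<eta> a y) x"
    proof (cases w)
      case (Inl a)
      with *(3) have "a \<in> FOb W (\<kappa>, \<gamma>)"
        by auto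
      then obtain \<eta> x y where "\<eta> \<in> Ob H" "x \<in> FOb X (\<eta>, \<gamma>)" "y \<in> FOb Y (\<kappa>, \<eta>)" "a = m \<kappa> \<gamma> \<eta> x y"
        by (rule T.tensorE[OF *(1,2)])
      with Inl show ?thesis
        by (intro bexI[of _ \<eta>] bexI[of _ "Inl x"] bexI[of _ "y"]) auto
    next
      case (Inr a)
      with *(3) have "a \<in> FOb W' (\<kappa>, \<gamma>)"
        by auto
      then obtain \<eta> x y where "\<eta> \<in> Ob H" "x \<in> FOb X' (\<eta>, \<gamma>)" "y \<in> FOb Y (\<kappa>, \<eta>)" "a = m' \<kappa> \<gamma> \<eta> x y"
        by (rule T'.tensorE[OF *(1,2)])
      with Inr show ?thesis
        by (intro bexI[of _ \<eta>] bexI[of _ "Inr x"] bexI[of _ "y"]) auto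
    qed
  qed (auto simp: T.m_closed T'.m_closed T.m_eq_iff T'.m_eq_iff T.FAr_m T'.FAr_m)
qed

lemma tensor_product_sum_right:
  assumes "tensor_product K H G X Y W m" "tensor_product K H G X Y' W' m'"
  shows "tensor_product K H G X (sum_biset Y Y') (sum_biset W W')
    (\<lambda>\<kappa> \<gamma> \<eta> x y. map_sum (m \<kappa> \<gamma> \<eta> x) (m' \<kappa> \<gamma> \<eta> x) y)"
proof -
  interpret T: tensor_product K H G X Y W m by fact
  interpret T': tensor_product K H G X Y' W' m' by fact
  show ?thesis
  proof (intro tensor_product.intro biset_sum T.X.biset_axioms T.Y.biset_axioms T'.Y.biset_axioms
      tensor_product_axioms.intro)
    fix \<kappa> \<gamma> w assume *: "\<kappa> \<in> Ob K" "\<gamma> \<in> Ob G" "w \<in> FOb (sum_biset W W') (\<kappa>, \<gamma>)"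
    show "\<exists>\<eta>\<in>Ob H. \<exists>x\<in>FOb X (\<eta>, \<gamma>). \<exists>y\<in>FOb (sum_biset Y Y') (\<kappa>, \<eta>).
        w = map_sum (m \<kappa> \<gamma> \<eta> x) (m' \<kappa> \<gamma> \<eta> x) y"
    proof (cases w)
      case (Inl a)
      with *(3) have "a \<in> FOb W (\<kappa>, \<gamma>)"
        by auto
      then obtain \<eta> x y where "\<eta> \<in> Ob H" "x \<in> FOb X (\<eta>, \<gamma>)" "y \<in> FOb Y (\<kappa>, \<eta>)" "a = m \<kappa> \<gamma> \<eta> x y"
        by (rule T.tensorE[OF *(1,2)])
      with Inl show ?thesis
        by (intro bexI[of _ \<eta>] bexI[of _ "x"] bexI[of _ "Inl y"]) auto
    next
      case (Inr a)
      with *(3) have "a \<in> FOb W' (\<kappa>, \<gamma>)"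
        by auto
      then obtain \<eta> x y where "\<eta> \<in> Ob H" "x \<in> FOb X (\<eta>, \<gamma>)" "y \<in> FOb Y' (\<kappa>, \<eta>)" "a = m' \<kappa> \<gamma> \<eta> x y"
        by (rule T'.tensorE[OF *(1,2)])
      with Inr show ?thesis
        by (intro bexI[of _ \<eta>] bexI[of _ "x"] bexI[of _ "Inr y"]) auto
    qed
  qed (auto simp: T.m_closed T'.m_closed T.m_eq_iff T'.m_eq_iff T.FAr_m T'.FAr_m)
qed

text \<open>Any \<open>m\<close> will do: there is no pair \<open>(x, y)\<close> for it to be
  evaluated at, and no element to be reached.\<close>

lemma tensor_product_empty_left:
  assumes "groupoid G" "biset K H Y"
  shows "tensor_product K H G empty_biset Y empty_biset m"
  using assms by (intro tensor_product.intro biset_empty tensor_product_axioms.intro)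
    (auto intro: biset.groupoid_target)

lemma tensor_product_empty_right:
  assumes "biset H G X" "groupoid K"
  shows "tensor_product K H G X empty_biset empty_biset m"
  using assms by (intro tensor_product.intro biset_empty tensor_product_axioms.intro)
    (auto intro: biset.groupoid_source)

section \<open>Functors of groupoids and their hom bi-sets\<close>

locale groupoid_functor =
  fixes C :: "('c, 'cm) cat" and D :: "('d, 'dm) cat" and F\<^sub>0 :: "'c \<Rightarrow> 'd" and F\<^sub>1 :: "'cm \<Rightarrow> 'dm"
  assumes groupoid_dom: "groupoid C" and groupoid_cod: "groupoid D"
    and ob: "a \<in> Ob C \<Longrightarrow> F\<^sub>0 a \<in> Ob D"
    and ar: "a \<in> Ob C \<Longrightarrow> b \<in> Ob C \<Longrightarrow> f \<in> Hom C a b \<Longrightarrow> F\<^sub>1 f \<in> Hom D (F\<^sub>0 a) (F\<^sub>0 b)"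
    and idn: "a \<in> Ob C \<Longrightarrow> F\<^sub>1 (Idn C a) = Idn D (F\<^sub>0 a)"
    and cmp: "a \<in> Ob C \<Longrightarrow> b \<in> Ob C \<Longrightarrow> c \<in> Ob C \<Longrightarrow> f \<in> Hom C a b \<Longrightarrow> g \<in> Hom C b c \<Longrightarrow>
      F\<^sub>1 (Cmp C a b c g f) = Cmp D (F\<^sub>0 a) (F\<^sub>0 b) (F\<^sub>0 c) (F\<^sub>1 g) (F\<^sub>1 f)"

lemma groupoid_functor_id: "groupoid P \<Longrightarrow> groupoid_functor P P id id"
  by unfold_locales simp_all

lemma hom_biset_simps [simp]:
  "FOb (hom_biset P F\<^sub>0 F\<^sub>1 E\<^sub>0 E\<^sub>1) (a, b) = Hom P (F\<^sub>0 a) (E\<^sub>0 b)"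
  "FAr (hom_biset P F\<^sub>0 F\<^sub>1 E\<^sub>0 E\<^sub>1) (a, b) (a', b') (h, g) x =
    Cmp P (F\<^sub>0 a') (E\<^sub>0 b) (E\<^sub>0 b') (E\<^sub>1 g) (Cmp P (F\<^sub>0 a') (F\<^sub>0 a) (E\<^sub>0 b) x (F\<^sub>1 h))"
  by (simp_all add: hom_biset_def)

locale hom_functors =
  F: groupoid_functor H P F\<^sub>0 F\<^sub>1 + E: groupoid_functor G P E\<^sub>0 E\<^sub>1
  for P :: "('p, 'pm) cat" and H :: "('h, 'hm) cat" and F\<^sub>0 F\<^sub>1
    and G :: "('g, 'gm) cat" and E\<^sub>0 E\<^sub>1
begin

lemmas P_simps = groupoid_simps[OF F.groupoid_cod]
lemmas P_assoc = groupoid_assoc[OF F.groupoid_cod, symmetric]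

lemma biset_hom_biset: "biset H G (hom_biset P F\<^sub>0 F\<^sub>1 E\<^sub>0 E\<^sub>1)"
  by (rule bisetI[OF F.groupoid_dom E.groupoid_dom])
    (simp_all add: P_simps F.ob F.ar F.idn F.cmp E.ob E.ar E.idn E.cmp P_assoc)

lemma lact_hom_biset:
  "\<eta> \<in> Ob H \<Longrightarrow> \<gamma> \<in> Ob G \<Longrightarrow> \<gamma>' \<in> Ob G \<Longrightarrow> g \<in> Hom G \<gamma> \<gamma>' \<Longrightarrow> x \<in> Hom P (F\<^sub>0 \<eta>) (E\<^sub>0 \<gamma>) \<Longrightarrow>
    lact H (hom_biset P F\<^sub>0 F\<^sub>1 E\<^sub>0 E\<^sub>1) \<eta> \<gamma> \<gamma>' g x = Cmp P (F\<^sub>0 \<eta>) (E\<^sub>0 \<gamma>) (E\<^sub>0 \<gamma>') (E\<^sub>1 g) x"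
  by (simp add: lact_def F.idn F.ob E.ob P_simps)

lemma ract_hom_biset:
  "\<eta> \<in> Ob H \<Longrightarrow> \<eta>' \<in> Ob H \<Longrightarrow> \<gamma> \<in> Ob G \<Longrightarrow> h \<in> Hom H \<eta>' \<eta> \<Longrightarrow> x \<in> Hom P (F\<^sub>0 \<eta>) (E\<^sub>0 \<gamma>) \<Longrightarrow>
    ract G (hom_biset P F\<^sub>0 F\<^sub>1 E\<^sub>0 E\<^sub>1) \<gamma> \<eta> \<eta>' h x = Cmp P (F\<^sub>0 \<eta>') (F\<^sub>0 \<eta>) (E\<^sub>0 \<gamma>) x (F\<^sub>1 h)"
  by (simp add: ract_def E.idn F.ob F.ar E.ob P_simps)

text \<open>Arrows of \<open>P\<close> are invertible, so \<open>x\<close> can be cancelled from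
  \<open>E\<^sub>1 g x = E\<^sub>1 g' x\<close> and freeness reduces to faithfulness. For finite
  generation, either all values at \<open>\<eta>\<close> are empty or, as in the Yoneda lemma, the
  single element \<open>Idn P (F\<^sub>0 \<eta>)\<close> generates by fullness.\<close>

lemma admissible_hom_biset:
  assumes faithful: "\<And>\<gamma> \<gamma>'. \<gamma> \<in> Ob G \<Longrightarrow> \<gamma>' \<in> Ob G \<Longrightarrow> inj_on E\<^sub>1 (Hom G \<gamma> \<gamma>')"
    and gen: "\<And>\<eta>. \<eta> \<in> Ob H \<Longrightarrow> (\<forall>\<gamma>\<in>Ob G. Hom P (F\<^sub>0 \<eta>) (E\<^sub>0 \<gamma>) = {}) \<or>
      (\<exists>\<gamma>\<in>Ob G. E\<^sub>0 \<gamma> = F\<^sub>0 \<eta> \<and> (\<forall>\<gamma>'\<in>Ob G. Hom P (E\<^sub>0 \<gamma>) (E\<^sub>0 \<gamma>') \<subseteq> E\<^sub>1 ` Hom G \<gamma> \<gamma>'))"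
  shows "admissible H G (hom_biset P F\<^sub>0 F\<^sub>1 E\<^sub>0 E\<^sub>1)"
proof -
  interpret X: biset H G "hom_biset P F\<^sub>0 F\<^sub>1 E\<^sub>0 E\<^sub>1"
    by (rule biset_hom_biset)
  have "X.free"
    unfolding X.free_def
  proof (intro ballI inj_onI)
    fix \<eta> \<gamma> \<gamma>' x g g'
    assume *: "\<eta> \<in> Ob H" "\<gamma> \<in> Ob G" "\<gamma>' \<in> Ob G" "x \<in> FOb (hom_biset P F\<^sub>0 F\<^sub>1 E\<^sub>0 E\<^sub>1) (\<eta>, \<gamma>)"
      "g \<in> Hom G \<gamma> \<gamma>'" "g' \<in> Hom G \<gamma> \<gamma>'"
      "lact H (hom_biset P F\<^sub>0 F\<^sub>1 E\<^sub>0 E\<^sub>1) \<eta> \<gamma> \<gamma>' g x = lact H (hom_biset P F\<^sub>0 F\<^sub>1 E\<^sub>0 E\<^sub>1) \<eta> \<gamma> \<gamma>' g' x"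
    then have x: "x \<in> Hom P (F\<^sub>0 \<eta>) (E\<^sub>0 \<gamma>)"
      by simp
    with * have eq: "Cmp P (F\<^sub>0 \<eta>) (E\<^sub>0 \<gamma>) (E\<^sub>0 \<gamma>') (E\<^sub>1 g) x = Cmp P (F\<^sub>0 \<eta>) (E\<^sub>0 \<gamma>) (E\<^sub>0 \<gamma>') (E\<^sub>1 g') x"
      by (simp add: lact_hom_biset)
    obtain y where y: "y \<in> Hom P (E\<^sub>0 \<gamma>) (F\<^sub>0 \<eta>)" "Cmp P (E\<^sub>0 \<gamma>) (F\<^sub>0 \<eta>) (E\<^sub>0 \<gamma>) x y = Idn P (E\<^sub>0 \<gamma>)"
      using groupoid_inverse[OF F.groupoid_cod F.ob[OF *(1)] E.ob[OF *(2)] x] .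
    have "Cmp P (E\<^sub>0 \<gamma>) (F\<^sub>0 \<eta>) (E\<^sub>0 \<gamma>') (Cmp P (F\<^sub>0 \<eta>) (E\<^sub>0 \<gamma>) (E\<^sub>0 \<gamma>') (E\<^sub>1 a) x) y = E\<^sub>1 a"
      if "a \<in> Hom G \<gamma> \<gamma>'" for a
      using that * x y by (simp add: P_assoc P_simps F.ob E.ob E.ar)
    with eq * have "E\<^sub>1 g = E\<^sub>1 g'"
      by metis
    with faithful[OF *(2,3)] * show "g = g'"
      by (auto dest: inj_onD)
  qed
  moreover have "X.finitely_generated"
    unfolding X.finitely_generated_def
  proof (intro ballI)
    fix \<eta> assume \<eta>: "\<eta> \<in> Ob H"
    let ?Q = "\<lambda>F. finite F \<and> F \<subseteq> (SIGMA \<gamma>:Ob G. FOb (hom_biset P F\<^sub>0 F\<^sub>1 E\<^sub>0 E\<^sub>1) (\<eta>, \<gamma>)) \<and>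
      (\<forall>\<gamma>'\<in>Ob G. \<forall>y\<in>FOb (hom_biset P F\<^sub>0 F\<^sub>1 E\<^sub>0 E\<^sub>1) (\<eta>, \<gamma>'). \<exists>(\<gamma>, x)\<in>F. \<exists>g\<in>Hom G \<gamma> \<gamma>'.
        y = lact H (hom_biset P F\<^sub>0 F\<^sub>1 E\<^sub>0 E\<^sub>1) \<eta> \<gamma> \<gamma>' g x)"
    from gen[OF \<eta>] show "\<exists>F. ?Q F"
    proof
      assume "\<forall>\<gamma>\<in>Ob G. Hom P (F\<^sub>0 \<eta>) (E\<^sub>0 \<gamma>) = {}"
      then show ?thesis
        by (intro exI[of _ "{}"]) simp
    next
      assume "\<exists>\<gamma>\<in>Ob G. E\<^sub>0 \<gamma> = F\<^sub>0 \<eta> \<and> (\<forall>\<gamma>'\<in>Ob G. Hom P (E\<^sub>0 \<gamma>) (E\<^sub>0 \<gamma>') \<subseteq> E\<^sub>1 ` Hom G \<gamma> \<gamma>')"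
      then obtain \<gamma> where \<gamma>: "\<gamma> \<in> Ob G" "E\<^sub>0 \<gamma> = F\<^sub>0 \<eta>"
        and full: "\<And>\<gamma>'. \<gamma>' \<in> Ob G \<Longrightarrow> Hom P (E\<^sub>0 \<gamma>) (E\<^sub>0 \<gamma>') \<subseteq> E\<^sub>1 ` Hom G \<gamma> \<gamma>'"
        by blast
      have "\<exists>g\<in>Hom G \<gamma> \<gamma>'. y = lact H (hom_biset P F\<^sub>0 F\<^sub>1 E\<^sub>0 E\<^sub>1) \<eta> \<gamma> \<gamma>' g (Idn P (F\<^sub>0 \<eta>))"
        if \<gamma>': "\<gamma>' \<in> Ob G" and y: "y \<in> Hom P (F\<^sub>0 \<eta>) (E\<^sub>0 \<gamma>')" for \<gamma>' y
      proof -
        obtain g where "g \<in> Hom G \<gamma> \<gamma>'" "y = E\<^sub>1 g"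
          using full[OF \<gamma>'] y \<gamma> by auto
        with y \<gamma> \<gamma>' \<eta> show ?thesis
          by (intro bexI[of _ g]) (simp_all add: lact_hom_biset F.ob E.ob P_simps)
      qed
      then show ?thesis
        using \<gamma> \<eta> by (intro exI[of _ "{(\<gamma>, Idn P (F\<^sub>0 \<eta>))}"]) (simp add: P_simps F.ob)
    qed
  qed
  ultimately show ?thesis
    by (simp add: X.admissible_iff)
qed

end

lemma hom_functors_id: "groupoid G \<Longrightarrow> hom_functors G G id id G id id"
  by (simp add: hom_functors_def groupoid_functor_id)

lemma admissible_id_biset:
  assumes "groupoid G"
  shows "admissible G G (id_biset G)"
  by (rule hom_functors.admissible_hom_biset[OF hom_functors_id[OF assms]]) auto

text \<open>The kernel condition for the models in which \<open>m\<close> is composition. The arrow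
  \<open>h\<close> between the middle objects is the inverse of \<open>x'\<close> composed with
  \<open>x\<close>.\<close>

lemma groupoid_factor_right:
  assumes "groupoid P" "a \<in> Ob P" "b \<in> Ob P" "c \<in> Ob P" "d \<in> Ob P"
    "x \<in> Hom P a b" "y \<in> Hom P c a" "x' \<in> Hom P d b" "y' \<in> Hom P c d"
  shows "Cmp P c a b x y = Cmp P c d b x' y' \<longleftrightarrow>
    (\<exists>h\<in>Hom P a d. x = Cmp P a d b x' h \<and> y' = Cmp P c a d h y)"
proof
  assume eq: "Cmp P c a b x y = Cmp P c d b x' y'"
  obtain z where z: "z \<in> Hom P b d" "Cmp P d b d z x' = Idn P d" "Cmp P b d b x' z = Idn P b"
    using groupoid_inverse[OF assms(1,5,3,8)] .
  have "Cmp P c a d (Cmp P a b d z x) y = Cmp P c b d z (Cmp P c a b x y)"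
    using assms z by (simp add: groupoid_assoc)
  also have "\<dots> = y'"
    unfolding eq using assms z by (simp add: groupoid_assoc groupoid_simps)
  finally show "\<exists>h\<in>Hom P a d. x = Cmp P a d b x' h \<and> y' = Cmp P c a d h y"
    using assms z by (intro bexI[of _ "Cmp P a b d z x"]) (simp_all add: groupoid_assoc groupoid_simps)
next
  assume "\<exists>h\<in>Hom P a d. x = Cmp P a d b x' h \<and> y' = Cmp P c a d h y"
  with assms show "Cmp P c a b x y = Cmp P c d b x' y'"
    by (auto simp: groupoid_assoc)
qed

text \<open>The model is \<open>Y\<close> itself, with its action as \<open>m\<close>. If
  \<open>x y = x' y'\<close>, the arrow between the middle objects is the inverse of
  \<open>x'\<close> composed with \<open>x\<close>.\<close>

lemma tensor_product_id_left:
  assumes "biset K G Y"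
  shows "tensor_product K G G (id_biset G) Y Y (\<lambda>\<kappa> \<gamma> \<eta> g y. lact K Y \<kappa> \<eta> \<gamma> g y)"
proof -
  interpret Y: biset K G Y by fact
  interpret I: hom_functors G G id id G id id
    by (rule hom_functors_id[OF Y.groupoid_target])
  show ?thesis
  proof (intro tensor_product.intro I.biset_hom_biset assms tensor_product_axioms.intro)
    fix \<kappa> \<gamma> w assume "\<kappa> \<in> Ob K" "\<gamma> \<in> Ob G" "w \<in> FOb Y (\<kappa>, \<gamma>)"
    then show "\<exists>\<eta>\<in>Ob G. \<exists>x\<in>FOb (id_biset G) (\<eta>, \<gamma>). \<exists>y\<in>FOb Y (\<kappa>, \<eta>). w = lact K Y \<kappa> \<eta> \<gamma> x y"
      by (intro bexI[of _ \<gamma>] bexI[of _ "Idn G \<gamma>"] bexI[of _ w]) (simp_all add: Y.lact_id Y.grpd_simps)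
  next
    fix \<kappa> \<gamma> \<eta> \<eta>' x y x' y'
    assume *: "\<kappa> \<in> Ob K" "\<gamma> \<in> Ob G" "\<eta> \<in> Ob G" "\<eta>' \<in> Ob G" "x \<in> FOb (id_biset G) (\<eta>, \<gamma>)" "y \<in> FOb Y (\<kappa>, \<eta>)"
      "x' \<in> FOb (id_biset G) (\<eta>', \<gamma>)" "y' \<in> FOb Y (\<kappa>, \<eta>')"
    obtain z where z: "z \<in> Hom G \<gamma> \<eta>'" "Cmp G \<eta>' \<gamma> \<eta>' z x' = Idn G \<eta>'" "Cmp G \<gamma> \<eta>' \<gamma> x' z = Idn G \<gamma>"
      using groupoid_inverse[OF Y.groupoid_target *(4,2)] * by auto
    show "lact K Y \<kappa> \<eta> \<gamma> x y = lact K Y \<kappa> \<eta>' \<gamma> x' y' \<longleftrightarrow>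
      (\<exists>h\<in>Hom G \<eta> \<eta>'. x = ract G (id_biset G) \<gamma> \<eta>' \<eta> h x' \<and> y' = lact K Y \<kappa> \<eta> \<eta>' h y)"
    proof
      assume eq: "lact K Y \<kappa> \<eta> \<gamma> x y = lact K Y \<kappa> \<eta>' \<gamma> x' y'"
      have "lact K Y \<kappa> \<eta> \<eta>' (Cmp G \<eta> \<gamma> \<eta>' z x) y = lact K Y \<kappa> \<gamma> \<eta>' z (lact K Y \<kappa> \<eta> \<gamma> x y)"
        using * z by (simp add: Y.lact_comp)
      also have "\<dots> = y'"
        unfolding eq using * z by (simp add: Y.lact_comp Y.lact_id)
      finally show "\<exists>h\<in>Hom G \<eta> \<eta>'. x = ract G (id_biset G) \<gamma> \<eta>' \<eta> h x' \<and> y' = lact K Y \<kappa> \<eta> \<eta>' h y"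
        using * z by (intro bexI[of _ "Cmp G \<eta> \<gamma> \<eta>' z x"])
          (simp_all add: I.ract_hom_biset groupoid_assoc[OF Y.groupoid_target] Y.grpd_simps)
    next
      assume "\<exists>h\<in>Hom G \<eta> \<eta>'. x = ract G (id_biset G) \<gamma> \<eta>' \<eta> h x' \<and> y' = lact K Y \<kappa> \<eta> \<eta>' h y"
      then obtain h where h: "h \<in> Hom G \<eta> \<eta>'" "x = ract G (id_biset G) \<gamma> \<eta>' \<eta> h x'" "y' = lact K Y \<kappa> \<eta> \<eta>' h y"
        by blast
      with * have "x = Cmp G \<eta> \<eta>' \<gamma> x' h"
        by (simp add: I.ract_hom_biset)
      with * h show "lact K Y \<kappa> \<eta> \<gamma> x y = lact K Y \<kappa> \<eta>' \<gamma> x' y'"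
        by (simp add: Y.lact_comp)
    qed
  qed (simp_all add: Y.act_closed I.lact_hom_biset Y.FAr_eq_lact_ract Y.lact_comp flip: Y.lact_ract)
qed

lemma tensor_product_id_right:
  assumes "biset H G X"
  shows "tensor_product H H G X (id_biset H) X (\<lambda>\<kappa> \<gamma> \<eta> x h. ract G X \<gamma> \<eta> \<kappa> h x)"
proof -
  interpret X: biset H G X by fact
  interpret I: hom_functors H H id id H id id
    by (rule hom_functors_id[OF X.groupoid_source])
  show ?thesis
  proof (intro tensor_product.intro I.biset_hom_biset assms tensor_product_axioms.intro)
    fix \<kappa> \<gamma> w assume "\<kappa> \<in> Ob H" "\<gamma> \<in> Ob G" "w \<in> FOb X (\<kappa>, \<gamma>)"
    then show "\<exists>\<eta>\<in>Ob H. \<exists>x\<in>FOb X (\<eta>, \<gamma>). \<exists>y\<in>FOb (id_biset H) (\<kappa>, \<eta>). w = ract G X \<gamma> \<eta> \<kappa> y x"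
      by (intro bexI[of _ \<kappa>] bexI[of _ w] bexI[of _ "Idn H \<kappa>"]) (simp_all add: X.ract_id X.grpd_simps)
  next
    fix \<kappa> \<gamma> \<eta> \<eta>' x y x' y'
    assume *: "\<kappa> \<in> Ob H" "\<gamma> \<in> Ob G" "\<eta> \<in> Ob H" "\<eta>' \<in> Ob H" "x \<in> FOb X (\<eta>, \<gamma>)" "y \<in> FOb (id_biset H) (\<kappa>, \<eta>)"
      "x' \<in> FOb X (\<eta>', \<gamma>)" "y' \<in> FOb (id_biset H) (\<kappa>, \<eta>')"
    \<comment> \<open>Here the second factor is the arrow, so \<open>y\<close> is inverted and the
      witness is \<open>y'\<close> after the inverse of \<open>y\<close>.\<close>
    obtain z where z: "z \<in> Hom H \<eta> \<kappa>" "Cmp H \<kappa> \<eta> \<kappa> z y = Idn H \<kappa>" "Cmp H \<eta> \<kappa> \<eta> y z = Idn H \<eta>"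
      using groupoid_inverse[OF X.groupoid_source *(1,3)] * by auto
    show "ract G X \<gamma> \<eta> \<kappa> y x = ract G X \<gamma> \<eta>' \<kappa> y' x' \<longleftrightarrow>
      (\<exists>h\<in>Hom H \<eta> \<eta>'. x = ract G X \<gamma> \<eta>' \<eta> h x' \<and> y' = lact H (id_biset H) \<kappa> \<eta> \<eta>' h y)"
    proof
      assume eq: "ract G X \<gamma> \<eta> \<kappa> y x = ract G X \<gamma> \<eta>' \<kappa> y' x'"
      have "ract G X \<gamma> \<eta>' \<eta> (Cmp H \<eta> \<kappa> \<eta>' y' z) x' = ract G X \<gamma> \<kappa> \<eta> z (ract G X \<gamma> \<eta>' \<kappa> y' x')"
        using * z by (simp add: X.ract_comp)
      also have "\<dots> = x"
        unfolding eq[symmetric] using * z by (simp add: X.ract_comp X.ract_id)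
      finally show "\<exists>h\<in>Hom H \<eta> \<eta>'. x = ract G X \<gamma> \<eta>' \<eta> h x' \<and> y' = lact H (id_biset H) \<kappa> \<eta> \<eta>' h y"
        using * z by (intro bexI[of _ "Cmp H \<eta> \<kappa> \<eta>' y' z"])
          (simp_all add: I.lact_hom_biset groupoid_assoc[OF X.groupoid_source, symmetric] X.grpd_simps)
    next
      assume "\<exists>h\<in>Hom H \<eta> \<eta>'. x = ract G X \<gamma> \<eta>' \<eta> h x' \<and> y' = lact H (id_biset H) \<kappa> \<eta> \<eta>' h y"
      then obtain h where h: "h \<in> Hom H \<eta> \<eta>'" "x = ract G X \<gamma> \<eta>' \<eta> h x'" "y' = lact H (id_biset H) \<kappa> \<eta> \<eta>' h y"
        by blast
      with * have "y' = Cmp H \<kappa> \<eta> \<eta>' h y"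
        by (simp add: I.lact_hom_biset)
      with * h show "ract G X \<gamma> \<eta> \<kappa> y x = ract G X \<gamma> \<eta>' \<kappa> y' x'"
        by (simp add: X.ract_comp)
    qed
  qed (simp_all add: X.act_closed I.ract_hom_biset X.FAr_eq_lact_ract X.ract_comp X.lact_ract X.grpd_simps)
qed

section \<open>Disjoint unions of groupoids\<close>

text \<open>An equivalence onto a union of connected components of \<open>P\<close>. Forbidding
  arrows from outside into the image also forbids the opposite ones, since arrows of
  \<open>P\<close> are invertible. The notion treats both summands of a disjoint union
  alike.\<close>

locale groupoid_summand = groupoid_functor G P i\<^sub>0 i\<^sub>1
  for G :: "('g, 'gm) cat" and P :: "('p, 'pm) cat" and i\<^sub>0 i\<^sub>1 +
  assumes full_faithful: "a \<in> Ob G \<Longrightarrow> b \<in> Ob G \<Longrightarrow> bij_betw i\<^sub>1 (Hom G a b) (Hom P (i\<^sub>0 a) (i\<^sub>0 b))"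
    and isolated: "a \<in> Ob G \<Longrightarrow> \<pi> \<in> Ob P \<Longrightarrow> \<pi> \<notin> i\<^sub>0 ` Ob G \<Longrightarrow> Hom P \<pi> (i\<^sub>0 a) = {}"
begin

sublocale incl: hom_functors P G i\<^sub>0 i\<^sub>1 P id id
  by (intro hom_functors.intro groupoid_functor_id groupoid_cod groupoid_functor_axioms)

sublocale proj: hom_functors P P id id G i\<^sub>0 i\<^sub>1
  by (intro hom_functors.intro groupoid_functor_id groupoid_cod groupoid_functor_axioms)

lemma admissible_incl: "admissible G P (hom_biset P i\<^sub>0 i\<^sub>1 id id)"
  by (rule incl.admissible_hom_biset) (auto simp: ob)

text \<open>The \<open>G\<close>-set \<open>P(\<pi>, i -)\<close> is empty if \<open>\<pi>\<close>
  lies outside the image, by isolation, and representable if \<open>\<pi>\<close> is in the image,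
  by full faithfulness.\<close>

lemma admissible_proj: "admissible P G (hom_biset P id id i\<^sub>0 i\<^sub>1)"
proof (rule proj.admissible_hom_biset)
  fix \<gamma> \<gamma>' assume "\<gamma> \<in> Ob G" "\<gamma>' \<in> Ob G"
  then show "inj_on i\<^sub>1 (Hom G \<gamma> \<gamma>')"
    using full_faithful by (auto simp: bij_betw_def)
next
  fix \<pi> assume \<pi>: "\<pi> \<in> Ob P"
  have full: "i\<^sub>1 ` Hom G a b = Hom P (i\<^sub>0 a) (i\<^sub>0 b)" if "a \<in> Ob G" "b \<in> Ob G" for a b
    using full_faithful[OF that] by (simp add: bij_betw_def)
  show "(\<forall>\<gamma>\<in>Ob G. Hom P (id \<pi>) (i\<^sub>0 \<gamma>) = {}) \<or>
      (\<exists>\<gamma>\<in>Ob G. i\<^sub>0 \<gamma> = id \<pi> \<and> (\<forall>\<gamma>'\<in>Ob G. Hom P (i\<^sub>0 \<gamma>) (i\<^sub>0 \<gamma>') \<subseteq> i\<^sub>1 ` Hom G \<gamma> \<gamma>'))"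
  proof (cases "\<pi> \<in> i\<^sub>0 ` Ob G")
    case True
    then show ?thesis
      by (auto simp: full)
  next
    case False
    then show ?thesis
      using isolated \<pi> by simp
  qed
qed

text \<open>Full faithfulness of the inclusion; it becomes the equation
  \<open>r i = 1\<close>.\<close>

lemma nat_iso_id_biset: "nat_iso (bicat G G) (id_biset G) (hom_biset P i\<^sub>0 i\<^sub>1 i\<^sub>0 i\<^sub>1)"
  by (rule nat_iso_bicatI[where t = "\<lambda>_ _. i\<^sub>1"])
    (simp_all add: full_faithful cmp groupoid_comp[OF groupoid_dom])

end

text \<open>Only the source is restricted. For a union \<open>S\<close> of components the action
  stays inside, because an arrow into an object of \<open>S\<close> also starts in
  \<open>S\<close>.\<close>

definition component_biset :: "('p, 'pm) cat \<Rightarrow> 'p set \<Rightarrow> ('p, 'pm, 'p, 'pm, 'pm) biset" where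
  "component_biset P S = \<lparr> FOb = (\<lambda>(\<pi>', \<pi>). if \<pi>' \<in> S then Hom P \<pi>' \<pi> else {}), FAr = FAr (id_biset P) \<rparr>"

lemma component_biset_simps [simp]:
  "FOb (component_biset P S) (\<pi>', \<pi>) = (if \<pi>' \<in> S then Hom P \<pi>' \<pi> else {})"
  "FAr (component_biset P S) = FAr (id_biset P)"
  by (simp_all add: component_biset_def)

text \<open>Forgetting the tag is bijective because each object of \<open>P\<close> lies in exactly
  one of \<open>S\<close> and \<open>T\<close>. This becomes the equation
  \<open>i r + j s = 1\<close>.\<close>

lemma nat_iso_sum_components:
  assumes "S \<inter> T = {}" "Ob P \<subseteq> S \<union> T"
  shows "nat_iso (bicat P P) (sum_biset (component_biset P S) (component_biset P T)) (id_biset P)"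
proof (rule nat_iso_bicatI[where t = "\<lambda>_ _. case_sum id id"])
  fix \<pi>' \<pi> assume "\<pi>' \<in> Ob P"
  with assms consider "\<pi>' \<in> S" "\<pi>' \<notin> T" | "\<pi>' \<notin> S" "\<pi>' \<in> T"
    by auto
  then show "bij_betw (case_sum id id) (FOb (sum_biset (component_biset P S) (component_biset P T)) (\<pi>', \<pi>))
      (FOb (id_biset P) (\<pi>', \<pi>))"
    by cases (auto simp: bij_betw_def inj_on_def image_Un image_image Plus_def)
qed (auto split: if_splits)

text \<open>Composition in \<open>P\<close> is the model; an arrow factors through an identity, and
  the kernel is \<open>groupoid_factor_right\<close>. Equal summands give the composites
  \<open>r i\<close> and \<open>s j\<close>, different ones give the cross terms.\<close>

lemma tensor_product_proj_incl:
  assumes "groupoid_functor G P i\<^sub>0 i\<^sub>1" "groupoid_functor H P j\<^sub>0 j\<^sub>1"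
  shows "tensor_product H P G (hom_biset P id id i\<^sub>0 i\<^sub>1) (hom_biset P j\<^sub>0 j\<^sub>1 id id) (hom_biset P j\<^sub>0 j\<^sub>1 i\<^sub>0 i\<^sub>1)
    (\<lambda>\<kappa> \<gamma> \<pi> x y. Cmp P (j\<^sub>0 \<kappa>) \<pi> (i\<^sub>0 \<gamma>) x y)"
proof -
  interpret i: groupoid_functor G P i\<^sub>0 i\<^sub>1 by fact
  interpret j: groupoid_functor H P j\<^sub>0 j\<^sub>1 by fact
  note functors = hom_functors.intro groupoid_functor_id i.groupoid_cod i.groupoid_functor_axioms j.groupoid_functor_axioms
  interpret X: hom_functors P P id id G i\<^sub>0 i\<^sub>1
    by (intro functors)
  interpret Y: hom_functors P H j\<^sub>0 j\<^sub>1 P id id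
    by (intro functors)
  interpret W: hom_functors P H j\<^sub>0 j\<^sub>1 G i\<^sub>0 i\<^sub>1
    by (intro functors)
  show ?thesis
  proof (intro tensor_product.intro X.biset_hom_biset Y.biset_hom_biset tensor_product_axioms.intro)
    fix \<kappa> \<gamma> w assume "\<kappa> \<in> Ob H" "\<gamma> \<in> Ob G" "w \<in> FOb (hom_biset P j\<^sub>0 j\<^sub>1 i\<^sub>0 i\<^sub>1) (\<kappa>, \<gamma>)"
    then show "\<exists>\<pi>\<in>Ob P. \<exists>x\<in>FOb (hom_biset P id id i\<^sub>0 i\<^sub>1) (\<pi>, \<gamma>). \<exists>y\<in>FOb (hom_biset P j\<^sub>0 j\<^sub>1 id id) (\<kappa>, \<pi>).
        w = Cmp P (j\<^sub>0 \<kappa>) \<pi> (i\<^sub>0 \<gamma>) x y"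
      by (intro bexI[of _ "i\<^sub>0 \<gamma>"] bexI[of _ "Idn P (i\<^sub>0 \<gamma>)"] bexI[of _ w])
        (simp_all add: i.ob j.ob X.P_simps)
  next
    fix \<kappa> \<gamma> \<pi> \<pi>' x y x' y'
    assume "\<kappa> \<in> Ob H" "\<gamma> \<in> Ob G" "\<pi> \<in> Ob P" "\<pi>' \<in> Ob P" "x \<in> FOb (hom_biset P id id i\<^sub>0 i\<^sub>1) (\<pi>, \<gamma>)"
      "y \<in> FOb (hom_biset P j\<^sub>0 j\<^sub>1 id id) (\<kappa>, \<pi>)" "x' \<in> FOb (hom_biset P id id i\<^sub>0 i\<^sub>1) (\<pi>', \<gamma>)"
      "y' \<in> FOb (hom_biset P j\<^sub>0 j\<^sub>1 id id) (\<kappa>, \<pi>')"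
    then show "Cmp P (j\<^sub>0 \<kappa>) \<pi> (i\<^sub>0 \<gamma>) x y = Cmp P (j\<^sub>0 \<kappa>) \<pi>' (i\<^sub>0 \<gamma>) x' y' \<longleftrightarrow>
      (\<exists>h\<in>Hom P \<pi> \<pi>'. x = ract G (hom_biset P id id i\<^sub>0 i\<^sub>1) \<gamma> \<pi>' \<pi> h x' \<and>
        y' = lact H (hom_biset P j\<^sub>0 j\<^sub>1 id id) \<kappa> \<pi> \<pi>' h y)"
      by (subst groupoid_factor_right)
        (simp_all add: i.groupoid_cod i.ob j.ob X.ract_hom_biset Y.lact_hom_biset cong: bex_cong)
  qed (simp_all add: i.ob i.ar j.ob j.ar X.lact_hom_biset Y.ract_hom_biset X.P_simps X.P_assoc)
qed

context groupoid_summand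
begin

text \<open>The tensor product is now taken over \<open>G\<close>, whereas
  \<open>groupoid_factor_right\<close> yields an arrow of \<open>P\<close> between
  \<open>i\<^sub>0 \<gamma>\<close> and \<open>i\<^sub>0 \<gamma>'\<close>; fullness brings it back
  to \<open>G\<close>.\<close>

lemma tensor_product_incl_proj:
  "tensor_product P G P (hom_biset P i\<^sub>0 i\<^sub>1 id id) (hom_biset P id id i\<^sub>0 i\<^sub>1) (component_biset P (i\<^sub>0 ` Ob G))
    (\<lambda>\<pi>' \<pi> \<gamma> x y. Cmp P \<pi>' (i\<^sub>0 \<gamma>) \<pi> x y)"
proof (intro tensor_product.intro incl.biset_hom_biset proj.biset_hom_biset tensor_product_axioms.intro)
  fix \<pi>' \<pi> \<gamma> x y
  assume *: "\<pi>' \<in> Ob P" "\<pi> \<in> Ob P" "\<gamma> \<in> Ob G" "x \<in> FOb (hom_biset P i\<^sub>0 i\<^sub>1 id id) (\<gamma>, \<pi>)"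
    "y \<in> FOb (hom_biset P id id i\<^sub>0 i\<^sub>1) (\<pi>', \<gamma>)"
  \<comment> \<open>The arrow \<open>y\<close> runs from \<open>\<pi>'\<close> into the image of
    \<open>G\<close>, which is possible only for \<open>\<pi>'\<close> in that image.\<close>
  then have "\<pi>' \<in> i\<^sub>0 ` Ob G"
    using isolated[OF *(3,1)] by auto
  with * show "Cmp P \<pi>' (i\<^sub>0 \<gamma>) \<pi> x y \<in> FOb (component_biset P (i\<^sub>0 ` Ob G)) (\<pi>', \<pi>)"
    by (simp add: groupoid_comp[OF groupoid_cod] ob)
next
  fix \<pi>' \<pi> w assume *: "\<pi>' \<in> Ob P" "\<pi> \<in> Ob P" "w \<in> FOb (component_biset P (i\<^sub>0 ` Ob G)) (\<pi>', \<pi>)"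
  then obtain \<gamma> where "\<gamma> \<in> Ob G" "\<pi>' = i\<^sub>0 \<gamma>" "w \<in> Hom P \<pi>' \<pi>"
    by (auto split: if_splits)
  with * show "\<exists>\<gamma>\<in>Ob G. \<exists>x\<in>FOb (hom_biset P i\<^sub>0 i\<^sub>1 id id) (\<gamma>, \<pi>). \<exists>y\<in>FOb (hom_biset P id id i\<^sub>0 i\<^sub>1) (\<pi>', \<gamma>).
      w = Cmp P \<pi>' (i\<^sub>0 \<gamma>) \<pi> x y"
    by (intro bexI[of _ \<gamma>] bexI[of _ w] bexI[of _ "Idn P \<pi>'"]) (simp_all add: incl.P_simps)
next
  fix \<pi>' \<pi> \<gamma> \<gamma>' x y x' y'
  assume *: "\<pi>' \<in> Ob P" "\<pi> \<in> Ob P" "\<gamma> \<in> Ob G" "\<gamma>' \<in> Ob G" "x \<in> FOb (hom_biset P i\<^sub>0 i\<^sub>1 id id) (\<gamma>, \<pi>)"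
    "y \<in> FOb (hom_biset P id id i\<^sub>0 i\<^sub>1) (\<pi>', \<gamma>)" "x' \<in> FOb (hom_biset P i\<^sub>0 i\<^sub>1 id id) (\<gamma>', \<pi>)"
    "y' \<in> FOb (hom_biset P id id i\<^sub>0 i\<^sub>1) (\<pi>', \<gamma>')"
  have full: "Hom P (i\<^sub>0 \<gamma>) (i\<^sub>0 \<gamma>') = i\<^sub>1 ` Hom G \<gamma> \<gamma>'"
    using full_faithful[OF *(3,4)] by (simp add: bij_betw_def)
  from * show "Cmp P \<pi>' (i\<^sub>0 \<gamma>) \<pi> x y = Cmp P \<pi>' (i\<^sub>0 \<gamma>') \<pi> x' y' \<longleftrightarrow>
      (\<exists>h\<in>Hom G \<gamma> \<gamma>'. x = ract P (hom_biset P i\<^sub>0 i\<^sub>1 id id) \<pi> \<gamma>' \<gamma> h x' \<and>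
        y' = lact P (hom_biset P id id i\<^sub>0 i\<^sub>1) \<pi>' \<gamma> \<gamma>' h y)"
    by (subst groupoid_factor_right)
      (simp_all add: groupoid_cod ob full incl.ract_hom_biset proj.lact_hom_biset cong: bex_cong)
qed (simp_all add: ob ar incl.lact_hom_biset proj.ract_hom_biset incl.P_simps incl.P_assoc)

end

section \<open>The disjoint union of groupoids inside \<open>'u\<close>\<close>

context
  fixes c :: "'u + 'u \<Rightarrow> 'u"
  assumes c: "inj c"
begin

text \<open>The relabelled operations first invert \<open>c\<close> on their arguments; injectivity
  of \<open>c\<close> cancels this and leaves the operations of the summands.\<close>

lemma disjoint_union_simps:
  "Ob (disjoint_union c G H) = (c \<circ> Inl) ` Ob G \<union> (c \<circ> Inr) ` Ob H"
  "Hom (disjoint_union c G H) (c (Inl a)) (c (Inl b)) = (c \<circ> Inl) ` Hom G a b"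
  "Hom (disjoint_union c G H) (c (Inr a')) (c (Inr b')) = (c \<circ> Inr) ` Hom H a' b'"
  "Hom (disjoint_union c G H) (c (Inl a)) (c (Inr b')) = {}"
  "Hom (disjoint_union c G H) (c (Inr a')) (c (Inl b)) = {}"
  "Idn (disjoint_union c G H) (c (Inl a)) = c (Inl (Idn G a))"
  "Idn (disjoint_union c G H) (c (Inr a')) = c (Inr (Idn H a'))"
  "Cmp (disjoint_union c G H) (c (Inl a)) (c (Inl b)) (c (Inl d)) (c (Inl g)) (c (Inl f)) = c (Inl (Cmp G a b d g f))"
  "Cmp (disjoint_union c G H) (c (Inr a')) (c (Inr b')) (c (Inr d')) (c (Inr g')) (c (Inr f')) = c (Inr (Cmp H a' b' d' g' f'))"
  by (auto simp: disjoint_union_def relabel_def sum_cat_def Let_def inv_f_f[OF c] Plus_def image_image image_Un)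

lemma category_disjoint_union:
  assumes "category G" "category H"
  shows "category (disjoint_union c G H)"
  using assms unfolding category_def disjoint_union_simps(1)
  by (auto simp: disjoint_union_simps)

lemma groupoid_disjoint_union:
  assumes "groupoid G" "groupoid H"
  shows "groupoid (disjoint_union c G H)"
  unfolding groupoid_def
proof (intro conjI ballI)
  show "category (disjoint_union c G H)"
    using assms by (simp add: groupoid_def category_disjoint_union)
  fix p q f assume "p \<in> Ob (disjoint_union c G H)" "q \<in> Ob (disjoint_union c G H)"
    "f \<in> Hom (disjoint_union c G H) p q"
  then consider a b f' where "p = c (Inl a)" "q = c (Inl b)" "f = c (Inl f')" "a \<in> Ob G" "b \<in> Ob G" "f' \<in> Hom G a b"
    | a b f' where "p = c (Inr a)" "q = c (Inr b)" "f = c (Inr f')" "a \<in> Ob H" "b \<in> Ob H" "f' \<in> Hom H a b"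
    by (auto simp: disjoint_union_simps)
  then show "\<exists>g\<in>Hom (disjoint_union c G H) q p. Cmp (disjoint_union c G H) p q p g f = Idn (disjoint_union c G H) p \<and>
      Cmp (disjoint_union c G H) q p q f g = Idn (disjoint_union c G H) q"
  proof cases
    case 1
    obtain g where "g \<in> Hom G b a" "Cmp G a b a g f' = Idn G a" "Cmp G b a b f' g = Idn G b"
      using groupoid_inverse[OF assms(1) 1(4-6)] .
    with 1 show ?thesis
      by (intro bexI[of _ "c (Inl g)"]) (simp_all add: disjoint_union_simps)
  next
    case 2
    obtain g where "g \<in> Hom H b a" "Cmp H a b a g f' = Idn H a" "Cmp H b a b f' g = Idn H b"
      using groupoid_inverse[OF assms(2) 2(4-6)] .
    with 2 show ?thesis
      by (intro bexI[of _ "c (Inr g)"]) (simp_all add: disjoint_union_simps)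
  qed
qed

lemma disjoint_union_summands:
  assumes "groupoid G" "groupoid H"
  shows "groupoid_summand G (disjoint_union c G H) (c \<circ> Inl) (c \<circ> Inl)"
    and "groupoid_summand H (disjoint_union c G H) (c \<circ> Inr) (c \<circ> Inr)"
  using assms
  by (unfold_locales; auto simp: groupoid_disjoint_union disjoint_union_simps bij_betw_def inj_on_def dest!: injD[OF c])+

end

section \<open>The Burnside category\<close>

lemma biset_nat_iso:
  assumes "biset H G X" "nat_iso (bicat H G) X Y"
  shows "biset H G Y"
proof -
  interpret X: biset H G X by fact
  from assms(2) obtain t where t: "\<And>\<eta> \<gamma>. \<eta> \<in> Ob H \<Longrightarrow> \<gamma> \<in> Ob G \<Longrightarrow> bij_betw (t \<eta> \<gamma>) (FOb X (\<eta>, \<gamma>)) (FOb Y (\<eta>, \<gamma>))"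
    and nat: "\<And>\<eta> \<eta>' \<gamma> \<gamma>' h g x. \<eta> \<in> Ob H \<Longrightarrow> \<eta>' \<in> Ob H \<Longrightarrow> \<gamma> \<in> Ob G \<Longrightarrow> \<gamma>' \<in> Ob G \<Longrightarrow>
      h \<in> Hom H \<eta>' \<eta> \<Longrightarrow> g \<in> Hom G \<gamma> \<gamma>' \<Longrightarrow> x \<in> FOb X (\<eta>, \<gamma>) \<Longrightarrow>
      t \<eta>' \<gamma>' (FAr X (\<eta>, \<gamma>) (\<eta>', \<gamma>') (h, g) x) = FAr Y (\<eta>, \<gamma>) (\<eta>', \<gamma>') (h, g) (t \<eta> \<gamma> x)"
    by (rule nat_iso_bicatE) blast
  have FOb: "FOb Y (\<eta>, \<gamma>) = t \<eta> \<gamma> ` FOb X (\<eta>, \<gamma>)" if "\<eta> \<in> Ob H" "\<gamma> \<in> Ob G" for \<eta> \<gamma>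
    using t[OF that] by (simp add: bij_betw_def)
  show ?thesis
    by (rule bisetI[OF X.groupoid_source X.groupoid_target])
      (auto simp: FOb X.FAr_closed X.FAr_id X.FAr_comp X.grpd_simps simp flip: nat)
qed

text \<open>Used to recognize a transported copy of an admissible bi-set as a member of its class.
  Freeness and generators are carried along \<open>t\<close>, which commutes with the
  action.\<close>

lemma admissible_nat_iso:
  assumes "groupoid H" "groupoid G" "admissible H G X" "nat_iso (bicat H G) X Y"
  shows "admissible H G Y"
proof -
  interpret X: biset H G X
    by (rule admissible_biset[OF assms(1-3)])
  interpret Y: biset H G Y
    by (rule biset_nat_iso[OF X.biset_axioms assms(4)])
  from assms(4) obtain t where t: "\<And>\<eta> \<gamma>. \<eta> \<in> Ob H \<Longrightarrow> \<gamma> \<in> Ob G \<Longrightarrow> bij_betw (t \<eta> \<gamma>) (FOb X (\<eta>, \<gamma>)) (FOb Y (\<eta>, \<gamma>))"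
    and nat: "\<And>\<eta> \<eta>' \<gamma> \<gamma>' h g x. \<eta> \<in> Ob H \<Longrightarrow> \<eta>' \<in> Ob H \<Longrightarrow> \<gamma> \<in> Ob G \<Longrightarrow> \<gamma>' \<in> Ob G \<Longrightarrow>
      h \<in> Hom H \<eta>' \<eta> \<Longrightarrow> g \<in> Hom G \<gamma> \<gamma>' \<Longrightarrow> x \<in> FOb X (\<eta>, \<gamma>) \<Longrightarrow>
      t \<eta>' \<gamma>' (FAr X (\<eta>, \<gamma>) (\<eta>', \<gamma>') (h, g) x) = FAr Y (\<eta>, \<gamma>) (\<eta>', \<gamma>') (h, g) (t \<eta> \<gamma> x)"
    by (rule nat_iso_bicatE) blast
  have lact: "lact H Y \<eta> \<gamma> \<gamma>' g (t \<eta> \<gamma> x) = t \<eta> \<gamma>' (lact H X \<eta> \<gamma> \<gamma>' g x)"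
    if "\<eta> \<in> Ob H" "\<gamma> \<in> Ob G" "\<gamma>' \<in> Ob G" "g \<in> Hom G \<gamma> \<gamma>'" "x \<in> FOb X (\<eta>, \<gamma>)" for \<eta> \<gamma> \<gamma>' g x
    using that by (simp add: lact_def nat X.grpd_simps)
  have FOb: "FOb Y (\<eta>, \<gamma>) = t \<eta> \<gamma> ` FOb X (\<eta>, \<gamma>)" if "\<eta> \<in> Ob H" "\<gamma> \<in> Ob G" for \<eta> \<gamma>
    using t[OF that] by (simp add: bij_betw_def)
  have "Y.free"
    unfolding Y.free_def
  proof (intro ballI inj_onI)
    fix \<eta> \<gamma> \<gamma>' y g g' assume *: "\<eta> \<in> Ob H" "\<gamma> \<in> Ob G" "\<gamma>' \<in> Ob G" "y \<in> FOb Y (\<eta>, \<gamma>)"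
      "g \<in> Hom G \<gamma> \<gamma>'" "g' \<in> Hom G \<gamma> \<gamma>'" "lact H Y \<eta> \<gamma> \<gamma>' g y = lact H Y \<eta> \<gamma> \<gamma>' g' y"
    then obtain x where x: "x \<in> FOb X (\<eta>, \<gamma>)" "y = t \<eta> \<gamma> x"
      by (auto simp: FOb)
    have "lact H X \<eta> \<gamma> \<gamma>' g x = lact H X \<eta> \<gamma> \<gamma>' g' x"
      by (rule inj_onD[OF bij_betw_imp_inj_on[OF t[OF *(1,3)]]])
        (use * x in \<open>simp_all add: lact X.act_closed\<close>)
    moreover have "inj_on (\<lambda>g. lact H X \<eta> \<gamma> \<gamma>' g x) (Hom G \<gamma> \<gamma>')"
      using assms(3) * x by (simp add: X.admissible_iff X.free_def)
    ultimately show "g = g'"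
      using * by (auto dest: inj_onD)
  qed
  moreover have "Y.finitely_generated"
    unfolding Y.finitely_generated_def
  proof (intro ballI)
    fix \<eta> assume \<eta>: "\<eta> \<in> Ob H"
    have "X.finitely_generated"
      using assms(3) by (simp add: X.admissible_iff)
    from bspec[OF this[unfolded X.finitely_generated_def] \<eta>]
    obtain F where F: "finite F" "F \<subseteq> (SIGMA \<gamma>:Ob G. FOb X (\<eta>, \<gamma>))"
      and gen: "\<forall>\<gamma>'\<in>Ob G. \<forall>y\<in>FOb X (\<eta>, \<gamma>'). \<exists>(\<gamma>, x)\<in>F. \<exists>g\<in>Hom G \<gamma> \<gamma>'. y = lact H X \<eta> \<gamma> \<gamma>' g x"
      by (elim exE conjE)
    let ?F = "(\<lambda>(\<gamma>, x). (\<gamma>, t \<eta> \<gamma> x)) ` F"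
    show "\<exists>F. finite F \<and> F \<subseteq> (SIGMA \<gamma>:Ob G. FOb Y (\<eta>, \<gamma>)) \<and>
      (\<forall>\<gamma>'\<in>Ob G. \<forall>y\<in>FOb Y (\<eta>, \<gamma>'). \<exists>(\<gamma>, x)\<in>F. \<exists>g\<in>Hom G \<gamma> \<gamma>'. y = lact H Y \<eta> \<gamma> \<gamma>' g x)"
    proof (intro exI[of _ ?F] conjI ballI)
      show "finite ?F"
        using F(1) by simp
      show "?F \<subseteq> (SIGMA \<gamma>:Ob G. FOb Y (\<eta>, \<gamma>))"
        using F(2) \<eta> by (auto simp: FOb)
      fix \<gamma>' y assume \<gamma>': "\<gamma>' \<in> Ob G" "y \<in> FOb Y (\<eta>, \<gamma>')"
      then obtain x where x: "x \<in> FOb X (\<eta>, \<gamma>')" "y = t \<eta> \<gamma>' x"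
        using FOb[OF \<eta>] by auto
      with gen \<gamma>' obtain \<gamma> x' g where "(\<gamma>, x') \<in> F" "g \<in> Hom G \<gamma> \<gamma>'" "x = lact H X \<eta> \<gamma> \<gamma>' g x'"
        by blast
      moreover from this F have "\<gamma> \<in> Ob G" "x' \<in> FOb X (\<eta>, \<gamma>)"
        by auto
      ultimately show "\<exists>(\<gamma>, x)\<in>?F. \<exists>g\<in>Hom G \<gamma> \<gamma>'. y = lact H Y \<eta> \<gamma> \<gamma>' g x"
        using \<eta> \<gamma>' x by (intro bexI[of _ "(\<gamma>, t \<eta> \<gamma> x')"]) (auto simp: lact intro!: bexI[of _ g])
    qed
  qed
  ultimately show ?thesis
    by (simp add: Y.admissible_iff)
qed

text \<open>Transport of structure along injections into another type: an element is brought back by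
  the inverse of \<open>f p\<close> before \<open>X\<close> acts.\<close>

lemma nat_iso_transport:
  assumes "\<And>p. p \<in> Ob C \<Longrightarrow> inj_on (f p) (FOb X p)"
    and closed: "\<And>a b f x. a \<in> Ob C \<Longrightarrow> b \<in> Ob C \<Longrightarrow> f \<in> Hom C a b \<Longrightarrow> x \<in> FOb X a \<Longrightarrow> FAr X a b f x \<in> FOb X b"
  shows "nat_iso C X \<lparr> FOb = (\<lambda>p. f p ` FOb X p),
    FAr = (\<lambda>p q a y. f q (FAr X p q a (inv_into (FOb X p) (f p) y))) \<rparr>"
  unfolding nat_iso_def using assms by (intro exI[of _ f]) (simp add: bij_betw_def inv_into_f_f)

text \<open>Each image has at most as many elements as \<open>'u\<close>, and then so has a finite
  union of them, because \<open>'u\<close> is infinite.\<close>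

lemma inj_on_into_infinite:
  includes cardinal_syntax
  assumes "infinite (UNIV :: 'u set)" "finite F" "A \<subseteq> (\<Union>x\<in>F. f x ` (B x :: 'u set))"
  shows "\<exists>h :: 'a \<Rightarrow> 'u. inj_on h A"
proof -
  have le: "|f x ` B x| \<le>o |UNIV :: 'u set|" for x
    using card_of_image[of f "B x" for f] card_of_mono1[of "B x" UNIV] ordLeq_transitive by blast
  have "|F| \<le>o |UNIV :: 'u set|"
    using ordLeq_total[OF card_of_Well_order card_of_Well_order] card_of_ordLeq_finite assms(1,2) by blast
  with le have "|\<Union>x\<in>F. f x ` B x| \<le>o |UNIV :: 'u set|"
    by (intro card_of_UNION_ordLeq_infinite[OF assms(1)]) auto
  then have "|A| \<le>o |UNIV :: 'u set|"
    using card_of_mono1[OF assms(3)] ordLeq_transitive by blast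
  then show ?thesis
    by (auto simp: card_of_ordLeq[symmetric])
qed

section \<open>Classes of bi-sets over an infinite universe\<close>

context
  assumes inf: "infinite (UNIV :: 'u set)"
begin

text \<open>Each generator covers the image of a hom-set, which is a set of elements of
  \<open>'u\<close>. A value of \<open>X\<close> is covered by finitely many such images, so it
  injects into \<open>'u\<close>, and the structure of \<open>X\<close> is transported along these
  injections.\<close>

lemma iso_class_nonempty:
  fixes H G :: "'u grpd"
  assumes "groupoid H" "groupoid G" "admissible H G X"
  shows "\<exists>Y. Y \<in> iso_class H G X"
proof -
  interpret biset H G X
    by (rule admissible_biset[OF assms])
  have "\<exists>f :: _ \<Rightarrow> 'u. inj_on f (FOb X p)" if p_Ob: "p \<in> Ob (bicat H G)" for p
  proof -
    obtain \<eta> \<gamma>' where p: "p = (\<eta>, \<gamma>')" "\<eta> \<in> Ob H" "\<gamma>' \<in> Ob G"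
      using p_Ob by auto
    have "finitely_generated"
      using assms(3) by (simp add: admissible_iff)
    from bspec[OF this[unfolded finitely_generated_def] p(2)]
    obtain F where F: "finite F"
      and gen: "\<forall>\<gamma>'\<in>Ob G. \<forall>y\<in>FOb X (\<eta>, \<gamma>'). \<exists>(\<gamma>, x)\<in>F. \<exists>g\<in>Hom G \<gamma> \<gamma>'. y = lact H X \<eta> \<gamma> \<gamma>' g x"
      by (elim exE conjE)
    have "FOb X p \<subseteq> (\<Union>q\<in>F. (\<lambda>g. lact H X \<eta> (fst q) \<gamma>' g (snd q)) ` Hom G (fst q) \<gamma>')"
      using gen p by fastforce
    then show ?thesis
      by (rule inj_on_into_infinite[OF inf F])
  qed
  then obtain f :: "_ \<Rightarrow> _ \<Rightarrow> 'u" where f: "\<And>p. p \<in> Ob (bicat H G) \<Longrightarrow> inj_on (f p) (FOb X p)"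
    by metis
  let ?Y = "\<lparr> FOb = (\<lambda>p. f p ` FOb X p), FAr = (\<lambda>p q a y. f q (FAr X p q a (inv_into (FOb X p) (f p) y))) \<rparr>"
  have "nat_iso (bicat H G) X ?Y"
    by (rule nat_iso_transport[OF f]) (auto simp: FAr_closed)
  then show ?thesis
    using admissible_nat_iso[OF assms] by (auto simp: iso_class_def)
qed

lemma iso_classD: "Y \<in> iso_class H G X \<Longrightarrow> admissible H G Y" "Y \<in> iso_class H G X \<Longrightarrow> nat_iso (bicat H G) X Y"
  by (simp_all add: iso_class_def)

lemma nat_iso_sym_biset: "biset H G X \<Longrightarrow> nat_iso (bicat H G) X Y \<Longrightarrow> nat_iso (bicat H G) Y X"
  by (rule nat_iso_sym) (auto simp: biset.FAr_closed)

text \<open>\<open>X\<close> and \<open>Y\<close> may take values in different types; they are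
  compared through the \<open>'u\<close>-valued bi-sets isomorphic to them.\<close>

lemma iso_class_eqI:
  fixes H G :: "'u grpd"
  assumes "biset H G X" "nat_iso (bicat H G) X Y"
  shows "iso_class H G X = iso_class H G Y"
proof -
  have "nat_iso (bicat H G) X Z \<longleftrightarrow> nat_iso (bicat H G) Y Z" for Z :: "'u ubiset"
    using nat_iso_trans[OF nat_iso_sym_biset[OF assms]] nat_iso_trans[OF assms(2)] by blast
  then show ?thesis
    by (simp add: iso_class_def)
qed

text \<open>The carrier is described by \<open>'u\<close>-valued bi-sets, so a member of the class
  takes the place of \<open>X\<close>.\<close>

lemma iso_class_in_carrier:
  fixes H G :: "'u grpd"
  assumes "groupoid H" "groupoid G" "admissible H G X"
  shows "iso_class H G X \<in> carrier (biset_monoid H G)"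
proof -
  obtain Y where Y: "Y \<in> iso_class H G X"
    using iso_class_nonempty[OF assms] ..
  then have "iso_class H G X = iso_class H G Y"
    by (intro iso_class_eqI admissible_biset[OF assms] iso_classD)
  with Y show ?thesis
    by (auto simp: biset_monoid_def dest: iso_classD)
qed

lemma biset_monoidE:
  fixes H G :: "'u grpd"
  assumes "C \<in> carrier (biset_monoid H G)"
  obtains X :: "'u ubiset" where "admissible H G X" "C = iso_class H G X"
  using assms by (auto simp: biset_monoid_def)

text \<open>All terms of the union over members that defines the product are the same class, and
  \<open>iso_class_nonempty\<close> ensures that there is a term.\<close>

lemma mult_iso_class:
  fixes H G :: "'u grpd"
  assumes "groupoid H" "groupoid G" "admissible H G X" "admissible H G Y"
  shows "iso_class H G X \<otimes>\<^bsub>biset_monoid H G\<^esub> iso_class H G Y = iso_class H G (sum_biset X Y)"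
proof -
  have "iso_class H G (sum_biset X' Y') = iso_class H G (sum_biset X Y)"
    if "X' \<in> iso_class H G X" "Y' \<in> iso_class H G Y" for X' Y'
    using assms that
    by (intro iso_class_eqI[symmetric] biset_sum nat_iso_sum_cong) (auto intro: admissible_biset iso_classD)
  with iso_class_nonempty[OF assms(1-3)] iso_class_nonempty[OF assms(1,2,4)] show ?thesis
    by (auto simp: biset_monoid_def)
qed

lemma iso_class_empty_eq_one:
  fixes H G :: "'u grpd"
  assumes "biset H G X" "\<And>\<eta> \<gamma>. \<eta> \<in> Ob H \<Longrightarrow> \<gamma> \<in> Ob G \<Longrightarrow> FOb X (\<eta>, \<gamma>) = {}"
  shows "iso_class H G X = \<one>\<^bsub>biset_monoid H G\<^esub>"
  using assms by (auto simp: biset_monoid_def intro!: iso_class_eqI nat_iso_empty)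

text \<open>Any model computes the composite, whatever its type: by
  \<open>tensor_product_cong\<close> every tensor product of members of the two classes is
  isomorphic to \<open>W\<close>. Composites are therefore computed by choosing a convenient
  model.\<close>

lemma tensor_class_iso_class:
  fixes K H G :: "'u grpd"
  assumes "tensor_product K H G X Y W m" "admissible H G X" "admissible K H Y"
  shows "tensor_class K H G (iso_class H G X) (iso_class K H Y) = iso_class K G W"
proof -
  interpret T: tensor_product K H G X Y W m by fact
  have "iso_class K G (tensor_biset K H G X' Y') = iso_class K G W"
    if "X' \<in> iso_class H G X" "Y' \<in> iso_class K H Y" for X' Y'
  proof -
    have "tensor_product K H G X' Y' (tensor_biset K H G X' Y')
      (\<lambda>\<kappa> \<gamma> \<eta> x y. tensor_rel H (right_part G X' \<gamma>) (left_part K Y' \<kappa>) `` {(\<eta>, x, y)})"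
      using that T.X.groupoid_target T.Y.groupoid_source T.X.groupoid_source
      by (intro tensor_product_tensor_biset) (auto intro: admissible_biset iso_classD)
    from tensor_product_cong[OF assms(1) this] that show ?thesis
      by (intro iso_class_eqI[symmetric] T.W.biset_axioms) (auto dest: iso_classD)
  qed
  moreover obtain X' where "X' \<in> iso_class H G X"
    using iso_class_nonempty[OF T.X.groupoid_source T.X.groupoid_target assms(2)] ..
  moreover obtain Y' where "Y' \<in> iso_class K H Y"
    using iso_class_nonempty[OF T.Y.groupoid_source T.Y.groupoid_target assms(3)] ..
  ultimately show ?thesis
    unfolding tensor_class_def by blast
qed

lemma comm_monoid_biset_monoid:
  fixes H G :: "'u grpd"
  assumes H: "groupoid H" and G: "groupoid G"
  shows "comm_monoid (biset_monoid H G)"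
proof (rule comm_monoidI)
  note rules = H G admissible_sum[OF H G] admissible_empty[OF H G] mult_iso_class[OF H G]
    iso_class_in_carrier[OF H G] admissible_biset[OF H G]
  have one: "\<one>\<^bsub>biset_monoid H G\<^esub> = iso_class H G (empty_biset :: 'u ubiset)"
    by (simp add: biset_monoid_def)
  show "\<one>\<^bsub>biset_monoid H G\<^esub> \<in> carrier (biset_monoid H G)"
    by (simp add: one rules)
  fix x y assume "x \<in> carrier (biset_monoid H G)" "y \<in> carrier (biset_monoid H G)"
  then obtain X Y :: "'u ubiset" where XY: "admissible H G X" "admissible H G Y"
      and xy: "x = iso_class H G X" "y = iso_class H G Y"
    by (elim biset_monoidE)
  show "x \<otimes>\<^bsub>biset_monoid H G\<^esub> y \<in> carrier (biset_monoid H G)"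
    unfolding xy by (simp add: rules XY)
  show "x \<otimes>\<^bsub>biset_monoid H G\<^esub> y = y \<otimes>\<^bsub>biset_monoid H G\<^esub> x"
    unfolding xy by (simp add: rules XY) (rule iso_class_eqI[OF _ nat_iso_sum_comm], simp add: rules XY)
  show "\<one>\<^bsub>biset_monoid H G\<^esub> \<otimes>\<^bsub>biset_monoid H G\<^esub> x = x"
    unfolding xy one by (simp add: rules XY) (rule iso_class_eqI[OF _ nat_iso_sum_empty], simp add: rules XY)
  fix z assume "z \<in> carrier (biset_monoid H G)"
  then obtain Z :: "'u ubiset" where Z: "admissible H G Z" "z = iso_class H G Z"
    by (elim biset_monoidE)
  show "x \<otimes>\<^bsub>biset_monoid H G\<^esub> y \<otimes>\<^bsub>biset_monoid H G\<^esub> z = x \<otimes>\<^bsub>biset_monoid H G\<^esub> (y \<otimes>\<^bsub>biset_monoid H G\<^esub> z)"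
    unfolding xy Z(2) by (simp add: rules XY Z) (rule iso_class_eqI[OF _ nat_iso_sum_assoc], simp add: rules XY Z)
qed

text \<open>Both distributive laws and annihilation by zero are read off from the models for sums
  and for the empty bi-set.\<close>

lemma biadditive_tensor_class:
  fixes K H G :: "'u grpd"
  assumes K: "groupoid K" and H: "groupoid H" and G: "groupoid G"
  shows "biadditive (biset_monoid H G) (biset_monoid K H) (biset_monoid K G) (tensor_class K H G)"
proof (intro biadditive.intro comm_monoid_biset_monoid K H G biadditive_axioms.intro)
  have one: "\<one>\<^bsub>biset_monoid A B\<^esub> = iso_class A B (empty_biset :: 'u ubiset)" for A B :: "'u grpd"
    by (simp add: biset_monoid_def)
  have tensor: "\<exists>m. tensor_product K H G X Y (tensor_biset K H G X Y) m"
    if "admissible H G X" "admissible K H Y" for X Y :: "'u ubiset"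
    using tensor_product_tensor_biset[OF admissible_biset[OF H G] admissible_biset[OF K H]] that by blast
  {
    fix y assume "y \<in> carrier (biset_monoid K H)"
    then obtain Y :: "'u ubiset" where Y: "admissible K H Y" "y = iso_class K H Y"
      by (elim biset_monoidE)
    show "tensor_class K H G \<one>\<^bsub>biset_monoid H G\<^esub> y = \<one>\<^bsub>biset_monoid K G\<^esub>"
      unfolding Y(2) one
      by (rule tensor_class_iso_class[OF tensor_product_empty_left[OF G admissible_biset[OF K H Y(1)]]
            admissible_empty[OF H G] Y(1)])
  }
  {
    fix x assume "x \<in> carrier (biset_monoid H G)"
    then obtain X :: "'u ubiset" where X: "admissible H G X" "x = iso_class H G X"
      by (elim biset_monoidE)
    show "tensor_class K H G x \<one>\<^bsub>biset_monoid K H\<^esub> = \<one>\<^bsub>biset_monoid K G\<^esub>"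
      unfolding X(2) one
      by (rule tensor_class_iso_class[OF tensor_product_empty_right[OF admissible_biset[OF H G X(1)] K]
            X(1) admissible_empty[OF K H]])
  }
  fix x y assume "x \<in> carrier (biset_monoid H G)" "y \<in> carrier (biset_monoid K H)"
  then obtain X Y :: "'u ubiset" where XY: "admissible H G X" "admissible K H Y"
      and xy: "x = iso_class H G X" "y = iso_class K H Y"
    by (elim biset_monoidE)
  obtain m where m: "tensor_product K H G X Y (tensor_biset K H G X Y) m"
    using tensor[OF XY] ..
  show "tensor_class K H G x y \<in> carrier (biset_monoid K G)"
    unfolding xy by (simp add: tensor_class_iso_class[OF m XY] iso_class_in_carrier[OF K G] tensor_product.admissible_tensor[OF m XY])
  {
    fix x' assume "x' \<in> carrier (biset_monoid H G)"
    then obtain X' :: "'u ubiset" where X': "admissible H G X'" "x' = iso_class H G X'"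
      by (elim biset_monoidE)
    obtain m' where m': "tensor_product K H G X' Y (tensor_biset K H G X' Y) m'"
      using tensor[OF X'(1) XY(2)] ..
    show "tensor_class K H G (x \<otimes>\<^bsub>biset_monoid H G\<^esub> x') y =
        tensor_class K H G x y \<otimes>\<^bsub>biset_monoid K G\<^esub> tensor_class K H G x' y"
      unfolding xy X'(2)
      by (simp add: mult_iso_class[OF H G] mult_iso_class[OF K G] admissible_sum[OF H G] XY X'
          tensor_class_iso_class[OF m] tensor_class_iso_class[OF m'] tensor_class_iso_class[OF tensor_product_sum_left[OF m m']]
          tensor_product.admissible_tensor[OF m] tensor_product.admissible_tensor[OF m'])
  }
  {
    fix y' assume "y' \<in> carrier (biset_monoid K H)"
    then obtain Y' :: "'u ubiset" where Y': "admissible K H Y'" "y' = iso_class K H Y'"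
      by (elim biset_monoidE)
    obtain m' where m': "tensor_product K H G X Y' (tensor_biset K H G X Y') m'"
      using tensor[OF XY(1) Y'(1)] ..
    show "tensor_class K H G x (y \<otimes>\<^bsub>biset_monoid K H\<^esub> y') =
        tensor_class K H G x y \<otimes>\<^bsub>biset_monoid K G\<^esub> tensor_class K H G x y'"
      unfolding xy Y'(2)
      by (simp add: mult_iso_class[OF K H] mult_iso_class[OF K G] admissible_sum[OF K H] XY Y'
          tensor_class_iso_class[OF m] tensor_class_iso_class[OF m'] tensor_class_iso_class[OF tensor_product_sum_right[OF m m']]
          tensor_product.admissible_tensor[OF m] tensor_product.admissible_tensor[OF m'])
  }
qed

lemma monoid_enriched_burnside:
  "monoid_enriched {G :: 'u grpd. groupoid G} biset_monoid tensor_class (\<lambda>G. iso_class G G (id_biset G))"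
proof (rule monoid_enriched.intro; (unfold mem_Collect_eq)?)
  fix H K L M :: "'u grpd" and x y z
  assume grpd: "groupoid H" "groupoid K" "groupoid L" "groupoid M"
    and "x \<in> carrier (biset_monoid H K)" "y \<in> carrier (biset_monoid K L)" "z \<in> carrier (biset_monoid L M)"
  then obtain X Y Z :: "'u ubiset" where adm: "admissible H K X" "admissible K L Y" "admissible L M Z"
      and eqs: "x = iso_class H K X" "y = iso_class K L Y" "z = iso_class L M Z"
    by (elim biset_monoidE)
  \<comment> \<open>The four tensor products are iterated quotients, each with its own element type;
    only their classes lie in a common type.\<close>
  note tensor = tensor_product_tensor_biset[OF admissible_biset admissible_biset]
  note YX = tensor[OF grpd(2,3) adm(2) grpd(1,2) adm(1)] and ZY = tensor[OF grpd(3,4) adm(3) grpd(2,3) adm(2)]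
  note admYX = tensor_product.admissible_tensor[OF YX adm(2,1)] and admZY = tensor_product.admissible_tensor[OF ZY adm(3,2)]
  note Z_YX = tensor[OF grpd(3,4) adm(3) grpd(1,3) admYX] and ZY_X = tensor[OF grpd(2,4) admZY grpd(1,2) adm(1)]
  show "tensor_class H L M z (tensor_class H K L y x) = tensor_class H K M (tensor_class K L M z y) x"
    unfolding eqs tensor_class_iso_class[OF YX adm(2,1)] tensor_class_iso_class[OF ZY adm(3,2)]
      tensor_class_iso_class[OF Z_YX adm(3) admYX] tensor_class_iso_class[OF ZY_X admZY adm(1)]
    by (rule iso_class_eqI[OF tensor_product.biset_tensor[OF Z_YX] tensor_product_assoc[OF ZY YX ZY_X Z_YX]])
next
  fix H G :: "'u grpd" and x assume grpd: "groupoid H" "groupoid G" and "x \<in> carrier (biset_monoid H G)"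
  then obtain X :: "'u ubiset" where adm: "admissible H G X" and x: "x = iso_class H G X"
    by (elim biset_monoidE)
  show "tensor_class H H G x (iso_class H H (id_biset H)) = x"
    unfolding x
    by (rule tensor_class_iso_class[OF tensor_product_id_right[OF admissible_biset[OF grpd adm]] adm
          admissible_id_biset[OF grpd(1)]])
  show "tensor_class H G G (iso_class G G (id_biset G)) x = x"
    unfolding x
    by (rule tensor_class_iso_class[OF tensor_product_id_left[OF admissible_biset[OF grpd adm]]
          admissible_id_biset[OF grpd(2)] adm])
qed (simp_all add: biadditive_tensor_class iso_class_in_carrier admissible_id_biset)

section \<open>The Burnside category as a completion\<close>

interpretation burnside: monoid_enriched "{G :: 'u grpd. groupoid G}" biset_monoid tensor_class
  "\<lambda>G. iso_class G G (id_biset G)"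
  by (rule monoid_enriched_burnside)

lemma burnside_eq_completion: "(burnside :: ('u grpd, 'u bmor) preadd_cat) = burnside.completion"
  by (simp add: burnside_def burnside.completion_def bclass_def)

text \<open>A bi-set with an empty groupoid on one side has no values at all, so all such bi-sets
  are isomorphic to the empty one and the monoid of classes is trivial.\<close>

lemma zero_object_burnside:
  "\<exists>z. zero_object (burnside :: ('u grpd, 'u bmor) preadd_cat) z"
proof -
  define Z :: "'u grpd" where "Z = \<lparr> Ob = {}, Hom = (\<lambda>_ _. {}), Cmp = (\<lambda>_ _ _ g _. g), Idn = undefined \<rparr>"
  have Z: "groupoid Z" "Ob Z = {}"
    by (simp_all add: Z_def groupoid_def category_def)
  have "carrier (biset_monoid A B) = {\<one>\<^bsub>biset_monoid A B\<^esub>}"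
    if "groupoid A" "groupoid B" "Ob A = {} \<or> Ob B = {}" for A B :: "'u grpd"
  proof
    show "{\<one>\<^bsub>biset_monoid A B\<^esub>} \<subseteq> carrier (biset_monoid A B)"
      using that by (simp add: comm_monoid_biset_monoid comm_monoid.axioms monoid.one_closed)
    show "carrier (biset_monoid A B) \<subseteq> {\<one>\<^bsub>biset_monoid A B\<^esub>}"
      using that by (auto elim!: biset_monoidE intro!: iso_class_empty_eq_one admissible_biset)
  qed
  with Z have "zero_object burnside.completion Z"
    by (intro burnside.zero_object_completion) simp_all
  then show ?thesis
    unfolding burnside_eq_completion ..
qed

text \<open>Stated for two summands that cover \<open>P\<close>, which makes the roles of
  \<open>G\<close> and \<open>H\<close> symmetric, so that \<open>unit\<close> and
  \<open>cross\<close> are each proved once and used for both.\<close>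

lemma burnside_biproduct:
  fixes G H P :: "'u grpd"
  assumes "groupoid_summand G P i i" "groupoid_summand H P j j"
    and cover: "Ob P \<subseteq> i ` Ob G \<union> j ` Ob H" and disjoint: "i ` Ob G \<inter> j ` Ob H = {}"
  shows "is_product burnside G H P (proj P G i) (proj P H j)"
    and "is_coproduct burnside G H P (incl G P i) (incl H P j)"
proof -
  interpret i: groupoid_summand G P i i by fact
  interpret j: groupoid_summand H P j j by fact
  note grpd = i.groupoid_dom j.groupoid_dom i.groupoid_cod
  note adm = i.admissible_incl j.admissible_incl i.admissible_proj j.admissible_proj
  have cross: "tensor_class B P A (iso_class P A (hom_biset P id id k k)) (iso_class B P (hom_biset P l l id id)) =
      \<one>\<^bsub>biset_monoid B A\<^esub>"
    if "groupoid_summand A P k k" "groupoid_summand B P l l" "k ` Ob A \<inter> l ` Ob B = {}" for A B :: "'u grpd" and k l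
  proof -
    interpret k: groupoid_summand A P k k by fact
    interpret l: groupoid_summand B P l l by fact
    interpret T: tensor_product B P A "hom_biset P id id k k" "hom_biset P l l id id" "hom_biset P l l k k"
        "\<lambda>\<kappa> \<gamma> \<pi> x y. Cmp P (l \<kappa>) \<pi> (k \<gamma>) x y"
      by (rule tensor_product_proj_incl) unfold_locales
    \<comment> \<open>Different summands are isolated from each other, so the hom bi-set that models
      the composite has only empty values.\<close>
    have "Hom P (l b) (k a) = {}" if "a \<in> Ob A" "b \<in> Ob B" for a b
      using k.isolated[OF that(1) l.ob[OF that(2)]] that \<open>k ` Ob A \<inter> l ` Ob B = {}\<close> by blast
    then show ?thesis
      unfolding tensor_class_iso_class[OF T.tensor_product_axioms k.admissible_proj l.admissible_incl]
      by (intro iso_class_empty_eq_one T.W.biset_axioms) simp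
  qed
  have unit: "tensor_class A P A (iso_class P A (hom_biset P id id k k)) (iso_class A P (hom_biset P k k id id)) =
      iso_class A A (id_biset A)"
    if "groupoid_summand A P k k" for A :: "'u grpd" and k
  proof -
    interpret k: groupoid_summand A P k k by fact
    show ?thesis
      unfolding tensor_class_iso_class[OF tensor_product_proj_incl[OF k.groupoid_functor_axioms k.groupoid_functor_axioms]
          k.admissible_proj k.admissible_incl]
      by (rule iso_class_eqI[symmetric, OF admissible_biset k.nat_iso_id_biset])
        (simp_all add: k.groupoid_dom admissible_id_biset)
  qed
  have sum: "tensor_class P G P (iso_class G P (hom_biset P i i id id)) (iso_class P G (hom_biset P id id i i))
      \<otimes>\<^bsub>biset_monoid P P\<^esub>
      tensor_class P H P (iso_class H P (hom_biset P j j id id)) (iso_class P H (hom_biset P id id j j)) =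
      iso_class P P (id_biset P)"
  proof -
    note Ti = i.tensor_product_incl_proj and Tj = j.tensor_product_incl_proj
    note admi = tensor_product.admissible_tensor[OF Ti adm(1,3)] and admj = tensor_product.admissible_tensor[OF Tj adm(2,4)]
    show ?thesis
      unfolding tensor_class_iso_class[OF Ti adm(1,3)] tensor_class_iso_class[OF Tj adm(2,4)]
        mult_iso_class[OF grpd(3,3) admi admj]
      by (intro iso_class_eqI biset_sum admissible_biset[OF grpd(3,3)] admi admj nat_iso_sum_components disjoint cover)
  qed
  have disjoint': "j ` Ob H \<inter> i ` Ob G = {}"
    using disjoint by blast
  \<comment> \<open>The seven premises left open only say that the three objects and the four
    morphisms are in place.\<close>
  note biproduct = burnside.completion_biproduct[of G H P "iso_class G P (hom_biset P i i id id)"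
      "iso_class H P (hom_biset P j j id id)" "iso_class P G (hom_biset P id id i i)" "iso_class P H (hom_biset P id id j j)",
      OF _ _ _ _ _ _ _ unit[OF assms(1)] unit[OF assms(2)] cross[OF assms(1,2) disjoint]
        cross[OF assms(2,1) disjoint'] sum]
  show "is_product burnside G H P (proj P G i) (proj P H j)"
    unfolding burnside_eq_completion proj_def bclass_def
    by (rule biproduct(1)) (simp_all add: grpd adm iso_class_in_carrier)
  show "is_coproduct burnside G H P (incl G P i) (incl H P j)"
    unfolding burnside_eq_completion incl_def bclass_def
    by (rule biproduct(2)) (simp_all add: grpd adm iso_class_in_carrier)
qed

lemma disjoint_union_biproduct:
  fixes G H :: "'u grpd" and c :: "'u + 'u \<Rightarrow> 'u"
  assumes c: "inj c" and GH: "groupoid G" "groupoid H"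
  defines "P \<equiv> disjoint_union c G H"
  shows "is_product burnside G H P (proj P G (c \<circ> Inl)) (proj P H (c \<circ> Inr))"
    and "is_coproduct burnside G H P (incl G P (c \<circ> Inl)) (incl H P (c \<circ> Inr))"
proof -
  note summands = disjoint_union_summands[OF c GH, folded P_def]
  have cover: "Ob P \<subseteq> (c \<circ> Inl) ` Ob G \<union> (c \<circ> Inr) ` Ob H"
    by (simp add: P_def disjoint_union_simps[OF c])
  have disjoint: "(c \<circ> Inl) ` Ob G \<inter> (c \<circ> Inr) ` Ob H = {}"
    using c by (auto simp: inj_eq)
  show "is_product burnside G H P (proj P G (c \<circ> Inl)) (proj P H (c \<circ> Inr))"
    by (rule burnside_biproduct(1)[OF summands cover disjoint])
  show "is_coproduct burnside G H P (incl G P (c \<circ> Inl)) (incl H P (c \<circ> Inr))"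
    by (rule burnside_biproduct(2)[OF summands cover disjoint])
qed

text \<open>An injection \<open>c\<close> exists because \<open>'u\<close> is infinite, and any one
  of them yields a disjoint union serving as product and coproduct.\<close>

lemma additive_category_burnside: "additive_category (burnside :: ('u grpd, 'u bmor) preadd_cat)"
proof -
  obtain c :: "'u + 'u \<Rightarrow> 'u" where c: "inj c"
    using ex_inj_sum[OF inf] ..
  have ob: "Ob (burnside :: ('u grpd, 'u bmor) preadd_cat) = {G. groupoid G}"
    by (simp add: burnside_def)
  show ?thesis
    unfolding additive_category_def
  proof (intro conjI ballI zero_object_burnside)
    show "preadditive (burnside :: ('u grpd, 'u bmor) preadd_cat)"
      unfolding burnside_eq_completion by (rule burnside.preadditive_completion)
  qed (use disjoint_union_biproduct[OF c] ob in blast)+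
qed

end

theorem mainTheorem7:
  assumes "infinite (UNIV :: 'u set)"
  shows "additive_category (burnside :: ('u grpd, 'u bmor) preadd_cat) \<and>
    (\<forall>(c :: 'u + 'u \<Rightarrow> 'u) (G :: 'u grpd) (H :: 'u grpd).
      inj c \<longrightarrow> groupoid G \<longrightarrow> groupoid H \<longrightarrow>
      (let P = disjoint_union c G H; i = c \<circ> Inl; j = c \<circ> Inr in
        is_product burnside G H P (proj P G i) (proj P H j) \<and>
        is_coproduct burnside G H P (incl G P i) (incl H P j)))"
  using additive_category_burnside[OF assms] disjoint_union_biproduct[OF assms] by (simp add: Let_def)

end
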